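(* Let $F$ be a differential field of characteristic zero with algebraically closed field of constants $C$, and let $F_\infty$ be a complete Picard--Vessiot closure of $F$. Let $E$ be a differential subfield of $F_\infty$ containing $F$ which is finitely generated over $F$ (as a differential field). Then $E$ is contained in an iterated Picard--Vessiot extension of $F$. Conversely, if $E \supseteq F$ is a differential subfield of an iterated Picard--Vessiot extension of $F$, then there is a differential embedding of $E$ into $F_\infty$ over $F$.
   Context: Differential fields are ordinary (one derivation), of characteristic zero. A linear homogeneous differential equation over a differential field $M$ with constants $C$ is an equation $Y^{(n)}+a_{n-1}Y^{(n-1)}+\dots+a_0Y=0$ with $a_i\in M$. It has a full set of solutions in a differential extension with the same constants $C$ if its solution space there has dimension $n$ over $C$. A Picard--Vessiot extension of $M$ is a differential field extension $N\supseteq M$ with the same constants as $M$, such that for some linear homogeneous differential equation over $M$ there is a full set of solutions in $N$ and $N$ is generated over $M$ as a differential field by these solutions. A Picard--Vessiot closure of $M$ (with algebraically closed constants) is a differential extension $M_1\supseteq M$ with the same constants as $M$, in which every linear homogeneous differential equation over $M$ has a full set of solutions, and which is generated as a differential field over $M$ by solutions of such equations. A complete Picard--Vessiot closure of $F$ is the union $F_\infty=\bigcup_{i\ge 0}F_i$ of a tower $F=F_0\subseteq F_1\subseteq\cdots$ in which each $F_{i+1}$ is a Picard--Vessiot closure of $F_i$. A differential extension $E$ of $F$ is an iterated Picard--Vessiot extension if there is a chain of differential subfields $F=E_0\subseteq E_1\subseteq\dots\subseteq E_n=E$ such that for each $i$, $E_{i+1}$ is a Picard--Vessiot extension of $E_i$.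 An embedding over $F$ is a homomorphism of differential fields that is the identity on $F$. *)

theory Defs
  imports "HOL-Computational_Algebra.Polynomial"
begin

text \<open>
  A differential field is a set \<^term>\<open>K\<close> with \<^term>\<open>diff_subfield D K\<close>, inside some field of
  characteristic zero (a type) with derivation \<^term>\<open>D\<close>.  The surrounding type may be larger than
  the fields of interest: constants, solutions and generated subfields are all taken relative to
  explicit carrier sets.
\<close>

locale differential_field =
  fixes D :: "'a::field_char_0 \<Rightarrow> 'a"
  assumes deriv_add: "D (x + y) = D x + D y"
    and deriv_mult: "D (x * y) = D x * y + x * D y"

definition is_subfield :: "'a::field set \<Rightarrow> bool" where
  "is_subfield K \<longleftrightarrow> 0 \<in> K \<and> 1 \<in> K \<and>
     (\<forall>x\<in>K. \<forall>y\<in>K. x + y \<in> K \<and> x * y \<in> K) \<and>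
     (\<forall>x\<in>K. - x \<in> K \<and> inverse x \<in> K)"

definition diff_subfield :: "('a::field_char_0 \<Rightarrow> 'a) \<Rightarrow> 'a set \<Rightarrow> bool" where
  "diff_subfield D K \<longleftrightarrow> is_subfield K \<and> (\<forall>x\<in>K. D x \<in> K)"

definition constants :: "('a::field_char_0 \<Rightarrow> 'a) \<Rightarrow> 'a set \<Rightarrow> 'a set" where
  "constants D K = {x \<in> K. D x = 0}"

definition alg_closed_subfield :: "'a::field_char_0 set \<Rightarrow> bool" where
  "alg_closed_subfield C \<longleftrightarrow> is_subfield C \<and>
     (\<forall>p. (\<forall>i. coeff p i \<in> C) \<and> degree p > 0 \<longrightarrow> (\<exists>x\<in>C. poly p x = 0))"

definition diff_generated :: "('a::field_char_0 \<Rightarrow> 'a) \<Rightarrow> 'a set \<Rightarrow> 'a set" where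
  "diff_generated D S = \<Inter>{K. diff_subfield D K \<and> S \<subseteq> K}"

definition fin_gen_over :: "('a::field_char_0 \<Rightarrow> 'a) \<Rightarrow> 'a set \<Rightarrow> 'a set \<Rightarrow> bool" where
  "fin_gen_over D F E \<longleftrightarrow> (\<exists>S. finite S \<and> S \<subseteq> E \<and> E = diff_generated D (F \<union> S))"

text \<open>
  The pair \<^term>\<open>n\<close>, \<^term>\<open>a\<close> stands for the monic equation
  \<open>(D ^^ n) Y + a (n - 1) * (D ^^ (n - 1)) Y + \<dots> + a 0 * Y = 0\<close>; the values \<open>a i\<close> with \<open>i \<ge> n\<close> are irrelevant.
\<close>

definition equation_over :: "'a set \<Rightarrow> nat \<Rightarrow> (nat \<Rightarrow> 'a) \<Rightarrow> bool" where
  "equation_over M n a \<longleftrightarrow> (\<forall>i<n. a i \<in> M)"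

definition solutions ::
  "('a::field_char_0 \<Rightarrow> 'a) \<Rightarrow> nat \<Rightarrow> (nat \<Rightarrow> 'a) \<Rightarrow> 'a set \<Rightarrow> 'a set" where
  "solutions D n a N = {y \<in> N. (D ^^ n) y + (\<Sum>i<n. a i * (D ^^ i) y) = 0}"

text \<open>
  The scalars form a subfield \<^term>\<open>C\<close> and not a type, so the \<open>dim\<close> of the library's locale for
  vector spaces does not apply; dimension is stated as the existence of a basis with
  \<^term>\<open>n\<close> elements.
\<close>

definition is_basis_over :: "'a::field set \<Rightarrow> 'a set \<Rightarrow> 'a set \<Rightarrow> bool" where
  "is_basis_over C B V \<longleftrightarrow> finite B \<and> B \<subseteq> V \<and>
     (\<forall>c. (\<forall>b\<in>B. c b \<in> C) \<and> (\<Sum>b\<in>B. c b * b) = 0 \<longrightarrow> (\<forall>b\<in>B. c b = 0)) \<and>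
     (\<forall>v\<in>V. \<exists>c. (\<forall>b\<in>B. c b \<in> C) \<and> v = (\<Sum>b\<in>B. c b * b))"

definition has_dim_over :: "'a::field set \<Rightarrow> 'a set \<Rightarrow> nat \<Rightarrow> bool" where
  "has_dim_over C V n \<longleftrightarrow> (\<exists>B. is_basis_over C B V \<and> card B = n)"

definition full_set_of_solutions ::
  "('a::field_char_0 \<Rightarrow> 'a) \<Rightarrow> nat \<Rightarrow> (nat \<Rightarrow> 'a) \<Rightarrow> 'a set \<Rightarrow> bool" where
  "full_set_of_solutions D n a N \<longleftrightarrow> has_dim_over (constants D N) (solutions D n a N) n"

definition no_new_constants_ext :: "('a::field_char_0 \<Rightarrow> 'a) \<Rightarrow> 'a set \<Rightarrow> 'a set \<Rightarrow> bool" where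
  "no_new_constants_ext D M N \<longleftrightarrow>
     diff_subfield D M \<and> diff_subfield D N \<and> M \<subseteq> N \<and> constants D N = constants D M"

definition PV_extension :: "('a::field_char_0 \<Rightarrow> 'a) \<Rightarrow> 'a set \<Rightarrow> 'a set \<Rightarrow> bool" where
  "PV_extension D M N \<longleftrightarrow> no_new_constants_ext D M N \<and>
     (\<exists>n a. equation_over M n a \<and> full_set_of_solutions D n a N \<and>
        N = diff_generated D (M \<union> solutions D n a N))"

definition PV_closure :: "('a::field_char_0 \<Rightarrow> 'a) \<Rightarrow> 'a set \<Rightarrow> 'a set \<Rightarrow> bool" where
  "PV_closure D M N \<longleftrightarrow> no_new_constants_ext D M N \<and>
     (\<forall>n a. equation_over M n a \<longrightarrow> full_set_of_solutions D n a N) \<and>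
     N = diff_generated D (M \<union> {y. \<exists>n a. equation_over M n a \<and> y \<in> solutions D n a N})"

definition complete_PV_closure :: "('a::field_char_0 \<Rightarrow> 'a) \<Rightarrow> 'a set \<Rightarrow> 'a set \<Rightarrow> bool" where
  "complete_PV_closure D F Finf \<longleftrightarrow>
     (\<exists>T :: nat \<Rightarrow> 'a set. T 0 = F \<and> (\<forall>i. PV_closure D (T i) (T (Suc i))) \<and> Finf = (\<Union>i. T i))"

definition iterated_PV_extension :: "('a::field_char_0 \<Rightarrow> 'a) \<Rightarrow> 'a set \<Rightarrow> 'a set \<Rightarrow> bool" where
  "iterated_PV_extension D F E \<longleftrightarrow>
     (\<exists>m. \<exists>T :: nat \<Rightarrow> 'a set. T 0 = F \<and> T m = E \<and> (\<forall>i\<le>m. diff_subfield D (T i)) \<and>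
        (\<forall>i<m. PV_extension D (T i) (T (Suc i))))"

text \<open>Such a homomorphism is automatically injective, since \<^term>\<open>K\<close> is a field and 1 maps to 1.\<close>

definition diff_field_hom ::
  "('a::field_char_0 \<Rightarrow> 'a) \<Rightarrow> 'a set \<Rightarrow> ('b::field_char_0 \<Rightarrow> 'b) \<Rightarrow> 'b set \<Rightarrow> ('a \<Rightarrow> 'b) \<Rightarrow> bool" where
  "diff_field_hom D K D' L h \<longleftrightarrow> h ` K \<subseteq> L \<and> h 1 = 1 \<and>
     (\<forall>x\<in>K. \<forall>y\<in>K. h (x + y) = h x + h y \<and> h (x * y) = h x * h y) \<and>
     (\<forall>x\<in>K. h (D x) = D' (h x))"

end

theory Submission
  imports "HOL-Algebra.Algebraic_Closure_Type" "Jordan_Normal_Form.Determinant"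
    "HOL-Computational_Algebra.Formal_Power_Series" Defs
begin

text \<open>
  The first half is a finiteness argument.  An element of a Picard--Vessiot closure of \<open>T i\<close> is a
  differential rational expression in finitely many elements of \<open>T i\<close> and finitely many solutions
  of equations over \<open>T i\<close>; altogether only finitely many elements of \<open>T i\<close> are involved, the
  coefficients of those equations included.  By induction on \<open>i\<close> these lie in an iterated
  Picard--Vessiot extension of \<open>F\<close> inside \<open>T i\<close>, to which the full solution spaces in \<open>T (Suc i)\<close>
  are adjoined one equation at a time (\<open>finite_subset_of_PV_tower\<close>).

  The second half climbs a chain of Picard--Vessiot extensions \<open>U j\<close> and embeds \<open>U j\<close> into \<open>T j\<close>.
  One step is the uniqueness of Picard--Vessiot extensions, in the following form
  (\<open>PV_extension_embeds\<close>): if \<open>N\<close> is a Picard--Vessiot extension of \<open>K\<close> for an equation \<open>L\<close>, and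
  \<open>\<sigma>\<close> embeds \<open>K\<close> into a field \<open>N'\<close> in which \<open>\<sigma> L\<close> has a full set of solutions, where the field of
  constants of \<open>N'\<close> is algebraically closed and is the image of that of \<open>K\<close>, then \<open>\<sigma>\<close> extends to
  \<open>N\<close>.

  The usual proof divides a tensor product by a maximal differential ideal.  Here Taylor series
  replace the tensor product.  Let \<open>y\<close> and \<open>z\<close> be bases of the solution spaces in \<open>N\<close> and \<open>N'\<close>, let
  \<open>R\<close> be the ring generated over \<open>K\<close> by the derivatives of the \<open>y j\<close>, and let \<open>\<Omega>\<close> be an
  algebraically closed field containing \<open>N'\<close>.

  \<^item> Some ring homomorphism \<open>\<psi>\<close> from \<open>R\<close> to \<open>\<Omega>\<close> extends \<open>\<sigma>\<close> and keeps the Wronskian matrix of \<open>y\<close>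
    invertible; this is the extension theorem for homomorphisms into algebraically closed fields
    (\<open>hom_extends_from_subfield\<close>).  It need not commute with the derivations, but its twist
    \<open>r \<mapsto> \<Sum>i. \<psi> ((D ^^ i) r) / i! * t ^ i\<close> is a differential homomorphism into \<open>\<Omega>[[t]]\<close>.
    The field \<open>N'\<close> embeds differentially into the same ring by its own Taylor series.

  \<^item> A linear equation of order \<open>n\<close> has at most \<open>n\<close> independent solutions in \<open>\<Omega>[[t]]\<close>.  Hence
    there the images of the \<open>y j\<close> are combinations of the Taylor series of the \<open>z i\<close>, with an
    invertible matrix \<open>x\<close> of coefficients in \<open>\<Omega>\<close>.

  \<^item> The extension theorem again, now over the algebraically closed field of constants \<open>C\<close> of \<open>N'\<close>,
    gives a homomorphism \<open>\<chi>\<close> over \<open>C\<close> from \<open>C[x, 1/x]\<close> to \<open>C\<close>.  As the Taylor series of elements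
    of \<open>N'\<close> are linearly disjoint from \<open>\<Omega>\<close> over \<open>C\<close> (\<open>taylor_images_linearly_disjoint\<close>), \<open>\<chi>\<close>
    extends to a differential homomorphism from \<open>N'[x, 1/x]\<close> back to \<open>N'\<close>.  Composed with the
    twist of \<open>\<psi>\<close> it maps \<open>R\<close> to \<open>N'\<close> and the span of \<open>y\<close> onto the span of \<open>z\<close>
    (\<open>solution_ring_hom\<close>).

  It remains to see that this homomorphism is injective.  By symmetry there is one in the opposite
  direction, and the composite is an endomorphism of \<open>R\<close> over \<open>K\<close> that maps the \<open>C\<close>-span of \<open>y\<close> onto
  itself.  It therefore maps each of the finite-dimensional spaces of polynomial expressions of bounded
  degree in the derivatives of \<open>y\<close> onto itself, so that its kernel is zero
  (\<open>surjective_endo_injective\<close>).  Finally, \<open>N\<close> lies in the field of fractions of \<open>R\<close>.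
\<close>

section \<open>Rings inside a type and homomorphisms on them\<close>

definition is_subring :: "'a::comm_ring_1 set \<Rightarrow> bool" where
  "is_subring A \<longleftrightarrow> 0 \<in> A \<and> 1 \<in> A \<and>
     (\<forall>x\<in>A. \<forall>y\<in>A. x + y \<in> A \<and> x * y \<in> A) \<and> (\<forall>x\<in>A. - x \<in> A)"

text \<open>
  Nothing is said about the values of \<open>f\<close> outside \<open>A\<close>, nor about a codomain: a homomorphism
  and its extensions are functions on the same type.
\<close>
definition hom_on :: "'a::comm_ring_1 set \<Rightarrow> ('a \<Rightarrow> 'b::comm_ring_1) \<Rightarrow> bool" where
  "hom_on A f \<longleftrightarrow> f 1 = 1 \<and> (\<forall>x\<in>A. \<forall>y\<in>A. f (x + y) = f x + f y \<and> f (x * y) = f x * f y)"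

lemma subring_closed:
  assumes "is_subring A"
  shows subring_0: "0 \<in> A" and subring_1: "1 \<in> A"
    and subring_add: "\<And>x y. x \<in> A \<Longrightarrow> y \<in> A \<Longrightarrow> x + y \<in> A"
    and subring_mult: "\<And>x y. x \<in> A \<Longrightarrow> y \<in> A \<Longrightarrow> x * y \<in> A"
    and subring_minus: "\<And>x. x \<in> A \<Longrightarrow> - x \<in> A"
    and subring_diff: "\<And>x y. x \<in> A \<Longrightarrow> y \<in> A \<Longrightarrow> x - y \<in> A"
proof -
  fix x y assume xy: "x \<in> A" "y \<in> A"
  from assms xy have "x + - y \<in> A" unfolding is_subring_def by blast
  then show "x - y \<in> A" by simp
qed (use assms in \<open>auto simp: is_subring_def\<close>)

lemma subring_sum:
  assumes "is_subring A" "\<And>i. i \<in> I \<Longrightarrow> g i \<in> A"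
  shows "sum g I \<in> A"
  using assms(2) by (induction I rule: infinite_finite_induct)
    (auto simp: subring_closed[OF assms(1)])

lemma subring_power: "is_subring A \<Longrightarrow> x \<in> A \<Longrightarrow> x ^ n \<in> A"
  by (induction n) (auto simp: subring_closed)

lemma hom_on_simps:
  assumes "is_subring A" "hom_on A f"
  shows hom_on_0: "f 0 = 0" and hom_on_1: "f 1 = 1"
    and hom_on_add: "\<And>x y. x \<in> A \<Longrightarrow> y \<in> A \<Longrightarrow> f (x + y) = f x + f y"
    and hom_on_mult: "\<And>x y. x \<in> A \<Longrightarrow> y \<in> A \<Longrightarrow> f (x * y) = f x * f y"
    and hom_on_minus: "\<And>x. x \<in> A \<Longrightarrow> f (- x) = - f x"
    and hom_on_diff: "\<And>x y. x \<in> A \<Longrightarrow> y \<in> A \<Longrightarrow> f (x - y) = f x - f y"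
proof -
  note A = subring_closed[OF assms(1)]
  show add: "f (x + y) = f x + f y" if "x \<in> A" "y \<in> A" for x y
    using assms(2) that unfolding hom_on_def by auto
  show "f (x * y) = f x * f y" if "x \<in> A" "y \<in> A" for x y
    using assms(2) that unfolding hom_on_def by auto
  show "f 1 = 1"
    using assms(2) unfolding hom_on_def by auto
  show zero: "f 0 = 0"
    using add[of 0 0] A(1) by simp
  show neg: "f (- x) = - f x" if "x \<in> A" for x
    using add[of x "- x"] zero that A by (simp add: add_eq_0_iff)
  show "f (x - y) = f x - f y" if "x \<in> A" "y \<in> A" for x y
    using add[of x "- y"] neg that A by simp
qed

lemma hom_on_sum:
  assumes "is_subring A" "hom_on A f" "\<And>i. i \<in> I \<Longrightarrow> g i \<in> A"
  shows "f (sum g I) = (\<Sum>i\<in>I. f (g i))"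
  using assms(3) by (induction I rule: infinite_finite_induct)
    (auto simp: hom_on_simps[OF assms(1,2)] subring_sum[OF assms(1)])

lemma hom_on_power:
  "is_subring A \<Longrightarrow> hom_on A f \<Longrightarrow> x \<in> A \<Longrightarrow> f (x ^ n) = f x ^ n"
  by (induction n) (auto simp: hom_on_simps subring_power)

lemma hom_on_subset: "hom_on B f \<Longrightarrow> A \<subseteq> B \<Longrightarrow> hom_on A f"
  unfolding hom_on_def by blast

lemma subfield_imp_subring: "is_subfield K \<Longrightarrow> is_subring K"
  unfolding is_subfield_def is_subring_def by auto

lemma hom_on_subfield_eq_0_iff:
  assumes "is_subfield K" "hom_on K f" "x \<in> K"
  shows "f x = 0 \<longleftrightarrow> x = 0"
proof
  assume fx: "f x = 0"
  show "x = 0"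
  proof (rule ccontr)
    assume "x \<noteq> 0"
    then have "f (x * inverse x) = 1"
      using hom_on_1[OF subfield_imp_subring] assms by simp
    moreover have "inverse x \<in> K"
      using assms(1,3) unfolding is_subfield_def by auto
    ultimately show False
      using hom_on_mult[OF subfield_imp_subring[OF assms(1)] assms(2,3)] fx by simp
  qed
qed (use hom_on_0[OF subfield_imp_subring] assms in auto)

lemma hom_on_comp:
  assumes "hom_on A f" "f ` A \<subseteq> B" "hom_on B g"
  shows "hom_on A (g \<circ> f)"
  using assms unfolding hom_on_def by (auto simp: image_subset_iff)

definition polys_over :: "'a::comm_ring_1 set \<Rightarrow> 'a poly set" where
  "polys_over A = {p. \<forall>i. coeff p i \<in> A}"

lemma polys_over_subring:
  assumes "is_subring A"
  shows "is_subring (polys_over A)"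
  unfolding polys_over_def is_subring_def
  by (auto simp: coeff_mult subring_closed[OF assms] intro!: subring_sum[OF assms])

lemma polys_over_pCons:
  "pCons a p \<in> polys_over A \<longleftrightarrow> a \<in> A \<and> p \<in> polys_over A"
  unfolding polys_over_def
  by (auto simp: coeff_pCons split: nat.splits)

lemma polys_over_monom:
  "is_subring A \<Longrightarrow> a \<in> A \<Longrightarrow> monom a n \<in> polys_over A"
  unfolding polys_over_def by (auto simp: subring_closed)

lemma polys_over_smult:
  "is_subring A \<Longrightarrow> a \<in> A \<Longrightarrow> p \<in> polys_over A \<Longrightarrow> smult a p \<in> polys_over A"
  unfolding polys_over_def by (auto simp: subring_closed)

lemma polys_over_coeff: "p \<in> polys_over A \<Longrightarrow> coeff p i \<in> A"
  unfolding polys_over_def by auto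

lemma map_poly_hom_on:
  assumes "is_subring A" "hom_on A f"
  shows "hom_on (polys_over A) (map_poly f)"
  unfolding hom_on_def
proof (intro conjI ballI)
  note f = hom_on_simps[OF assms]
  show "map_poly f 1 = 1" by (simp add: f(2))
  fix p q assume pq: "p \<in> polys_over A" "q \<in> polys_over A"
  show "map_poly f (p + q) = map_poly f p + map_poly f q"
    by (intro poly_eqI) (simp add: coeff_map_poly f pq polys_over_coeff)
  show "map_poly f (p * q) = map_poly f p * map_poly f q"
    by (intro poly_eqI) (simp add: coeff_map_poly f pq polys_over_coeff coeff_mult
        hom_on_sum[OF assms] subring_mult[OF assms(1)])
qed

lemma map_poly_smult_hom:
  assumes "is_subring A" "hom_on A f" "a \<in> A" "p \<in> polys_over A"
  shows "map_poly f (smult a p) = smult (f a) (map_poly f p)"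
  by (intro poly_eqI) (simp add: coeff_map_poly hom_on_simps[OF assms(1,2)] assms polys_over_coeff)

lemma subring_poly:
  assumes "is_subring A" "p \<in> polys_over A" "x \<in> A"
  shows "poly p x \<in> A"
  using assms(2) by (induction p)
    (auto simp: polys_over_pCons subring_closed[OF assms(1)] assms(3))

lemma hom_on_poly:
  assumes "is_subring A" "hom_on A f" "p \<in> polys_over A" "x \<in> A"
  shows "f (poly p x) = poly (map_poly f p) (f x)"
  using assms(3)
proof (induction p)
  case (pCons a p)
  then have a: "a \<in> A" "p \<in> polys_over A" by (auto simp: polys_over_pCons)
  have "map_poly f (pCons a p) = pCons (f a) (map_poly f p)"
    using pCons.hyps by (intro map_poly_pCons) (auto simp: hom_on_simps[OF assms(1,2)])
  then show ?case
    using a pCons subring_poly[OF assms(1) a(2) assms(4)]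
    by (simp add: hom_on_simps[OF assms(1,2)] assms(4) subring_mult[OF assms(1)])
qed (simp add: hom_on_simps[OF assms(1,2)])

section \<open>Extending homomorphisms into algebraically closed fields\<close>

definition adjoin :: "'a::comm_ring_1 set \<Rightarrow> 'a \<Rightarrow> 'a set" where
  "adjoin A x = (\<lambda>p. poly p x) ` polys_over A"

lemma adjoin_subring:
  assumes "is_subring A"
  shows "is_subring (adjoin A x)"
proof -
  note P = subring_closed[OF polys_over_subring[OF assms]]
  have "poly p x + poly q x \<in> adjoin A x" "poly p x * poly q x \<in> adjoin A x"
    "- poly p x \<in> adjoin A x"
    if "p \<in> polys_over A" "q \<in> polys_over A" for p q
    using P(3)[OF that] P(4)[OF that] P(5)[OF that(1)] unfolding adjoin_def image_iff
    by (metis poly_add poly_mult poly_minus)+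
  moreover have "0 \<in> adjoin A x" "1 \<in> adjoin A x"
    using P(1,2) unfolding adjoin_def image_iff by (metis poly_0 poly_1)+
  ultimately show ?thesis
    unfolding is_subring_def by (auto simp: adjoin_def)
qed

lemma subset_adjoin: "is_subring A \<Longrightarrow> A \<subseteq> adjoin A x"
proof
  fix a assume "is_subring A" "a \<in> A"
  then have "[:a:] \<in> polys_over A" "poly [:a:] x = a"
    by (auto simp: polys_over_pCons subring_0[OF polys_over_subring])
  then show "a \<in> adjoin A x" unfolding adjoin_def image_iff by metis
qed

lemma gen_in_adjoin: "is_subring A \<Longrightarrow> x \<in> adjoin A x"
proof -
  assume "is_subring A"
  then have "[:0, 1:] \<in> polys_over A" "poly [:0, 1:] x = x"
    by (auto simp: polys_over_pCons subring_closed subring_closed[OF polys_over_subring])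
  then show ?thesis unfolding adjoin_def image_iff by metis
qed

text \<open>
  A value \<open>\<xi>\<close> for the new generator determines an extension as soon as \<open>\<xi>\<close> satisfies the
  images of all algebraic relations of \<open>x\<close> over \<open>A\<close>.
\<close>
lemma extend_hom_by_value:
  assumes A: "is_subring A" and f: "hom_on A f"
    and root: "\<And>p. p \<in> polys_over A \<Longrightarrow> poly p x = 0 \<Longrightarrow> poly (map_poly f p) \<xi> = 0"
  obtains g where "hom_on (adjoin A x) g" "\<And>a. a \<in> A \<Longrightarrow> g a = f a"
    "\<And>p. p \<in> polys_over A \<Longrightarrow> g (poly p x) = poly (map_poly f p) \<xi>"
proof -
  note P = subring_closed[OF polys_over_subring[OF A]]
  note F = hom_on_simps[OF polys_over_subring[OF A] map_poly_hom_on[OF A f]]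
  define g where "g z = poly (map_poly f (SOME p. p \<in> polys_over A \<and> poly p x = z)) \<xi>" for z
  have g: "g (poly p x) = poly (map_poly f p) \<xi>" if p: "p \<in> polys_over A" for p
  proof -
    define q where "q = (SOME q. q \<in> polys_over A \<and> poly q x = poly p x)"
    have q: "q \<in> polys_over A" "poly q x = poly p x"
      using someI[of "\<lambda>q. q \<in> polys_over A \<and> poly q x = poly p x" p] p
      unfolding q_def by auto
    have "poly (map_poly f (q - p)) \<xi> = 0"
      using root[of "q - p"] P(6) p q by simp
    then have "poly (map_poly f q) \<xi> = poly (map_poly f p) \<xi>"
      using F(6)[OF q(1) p] by simp
    then show ?thesis unfolding g_def q_def .
  qed
  show thesis
  proof
    show "g (poly p x) = poly (map_poly f p) \<xi>" if "p \<in> polys_over A" for p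
      by (rule g[OF that])
    show "g a = f a" if "a \<in> A" for a
    proof -
      have "[:a:] \<in> polys_over A"
        using that P(1) by (simp add: polys_over_pCons)
      from g[OF this] show ?thesis
        by (cases "a = 0") (simp_all add: map_poly_pCons hom_on_0[OF A f])
    qed
    have "g 1 = 1"
      using g[OF P(2)] F(2) by simp
    moreover have "g (poly p x + poly q x) = g (poly p x) + g (poly q x)"
      "g (poly p x * poly q x) = g (poly p x) * g (poly q x)"
      if "p \<in> polys_over A" "q \<in> polys_over A" for p q
      using g[OF P(3)[OF that]] g[OF P(4)[OF that]] that by (simp_all add: g F)
    ultimately show "hom_on (adjoin A x) g"
      unfolding hom_on_def adjoin_def by auto
  qed
qed

text \<open>
  Division with remainder without leaving a ring \<open>A\<close> that need not be a field: the dividend is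
  first multiplied by a power of the leading coefficient of the divisor.
\<close>
lemma pseudo_division_over:
  fixes p r :: "'a::idom poly"
  assumes A: "is_subring A" and r: "r \<in> polys_over A" "r \<noteq> 0" and p: "p \<in> polys_over A"
  obtains i s t where "s \<in> polys_over A" "t \<in> polys_over A"
    "smult (lead_coeff r ^ i) p = r * s + t" "t = 0 \<or> degree t < degree r"
proof -
  note P = subring_closed[OF polys_over_subring[OF A]]
  have "\<exists>i s t. s \<in> polys_over A \<and> t \<in> polys_over A \<and>
      smult (lead_coeff r ^ i) p = r * s + t \<and> (t = 0 \<or> degree t < degree r)"
    if "p = 0 \<or> degree p < n" for n
    using p that
  proof (induction n arbitrary: p)
    case 0
    then show ?case using P(1) by (intro exI[of _ 0]) auto
  next
    case (Suc n)
    show ?case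
    proof (cases "p = 0 \<or> degree p < degree r")
      case True
      then show ?thesis using P(1) Suc.prems by (intro exI[of _ 0] exI[of _ p]) auto
    next
      case False
      define q where "q = monom (lead_coeff p) (degree p - degree r)"
      define p' where "p' = smult (lead_coeff r) p - q * r"
      have q: "q \<in> polys_over A"
        unfolding q_def by (intro polys_over_monom[OF A] polys_over_coeff[OF Suc.prems(1)])
      have p': "p' \<in> polys_over A"
        unfolding p'_def
        by (intro P(6) P(4) polys_over_smult[OF A] q r(1) polys_over_coeff[OF r(1)] Suc.prems(1))
      have "p' = 0 \<or> degree p' < n"
      proof (cases "degree p' = 0 \<and> degree p = 0")
        case True
        then have "degree r = 0" using False by auto
        obtain a where a: "p = [:a:]" using True by (blast elim: degree_eq_zeroE)
        obtain b where b: "r = [:b:]" using \<open>degree r = 0\<close> by (rule degree_eq_zeroE)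
        show ?thesis unfolding p'_def q_def a b
          by (simp add: monom_0)
      next
        case *: False
        have qr: "degree (q * r) \<le> degree p"
          using False by (intro degree_mult_le[THEN order_trans])
            (simp add: q_def degree_monom_eq)
        have le: "degree p' \<le> degree p"
          unfolding p'_def by (intro degree_diff_le qr) simp
        have "coeff (q * r) (degree p) = lead_coeff p * lead_coeff r"
          using False unfolding q_def coeff_monom_mult by (simp add: le_diff_conv)
        then have "coeff p' (degree p) = 0"
          unfolding p'_def by simp
        with le * have "degree p' < degree p"
          by (metis le_neq_implies_less leading_coeff_0_iff degree_0 )
        then show ?thesis using Suc.prems(2) False by auto
      qed
      from Suc.IH[OF p' this] obtain i s t where
        st: "s \<in> polys_over A" "t \<in> polys_over A"
          "smult (lead_coeff r ^ i) p' = r * s + t" "t = 0 \<or> degree t < degree r"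
        by blast
      have "smult (lead_coeff r ^ Suc i) p = r * (s + smult (lead_coeff r ^ i) q) + t"
        using st(3) unfolding p'_def
        by (simp add: algebra_simps smult_diff_right)
      moreover have "s + smult (lead_coeff r ^ i) q \<in> polys_over A"
        by (intro P(3) polys_over_smult[OF A] subring_power[OF A] st(1) q polys_over_coeff[OF r(1)])
      ultimately show ?thesis using st by blast
    qed
  qed
  from this[of "Suc (degree p)"] that show thesis by blast
qed

lemma subfield_char_0_infinite:
  assumes "is_subfield (\<Omega> :: 'a::field_char_0 set)"
  shows "infinite \<Omega>"
proof -
  have "of_nat n \<in> \<Omega>" for n
    using subring_closed[OF subfield_imp_subring[OF assms]] by (induction n) auto
  then have "range (of_nat :: nat \<Rightarrow> 'a) \<subseteq> \<Omega>" by auto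
  moreover have "infinite (range (of_nat :: nat \<Rightarrow> 'a))"
    by (rule range_inj_infinite) (simp add: inj_on_def)
  ultimately show ?thesis using finite_subset by blast
qed

text \<open>
  The extension theorem for one generator.  Requiring the given \<open>v \<noteq> 0\<close> to stay nonzero, under the
  condition that one \<open>u \<noteq> 0\<close> in \<open>A\<close> does, is what makes the statement iterable.

  If \<open>x\<close> is transcendental over \<open>A\<close>, then \<open>v\<close> is a polynomial in \<open>x\<close>; if its leading coefficient
  survives, all but finitely many values for \<open>x\<close> are good.  If \<open>x\<close> is algebraic, let \<open>m\<close> be a
  nonzero polynomial of least degree with root \<open>x\<close>.  Some multiple \<open>w\<close> of \<open>v\<close> in the extended ring is a
  nonzero element of \<open>A\<close>; if \<open>w\<close> and the leading coefficient of \<open>m\<close> survive, every root of the image of \<open>m\<close> is good.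
\<close>
lemma hom_extends_to_adjoin:
  fixes A :: "'a::idom set" and \<Omega> :: "'b::field_char_0 set"
  assumes A: "is_subring A" and v: "v \<in> adjoin A x" "v \<noteq> 0"
    and \<Omega>: "alg_closed_subfield \<Omega>"
  shows "\<exists>u\<in>A. u \<noteq> 0 \<and> (\<forall>f. hom_on A f \<and> f ` A \<subseteq> \<Omega> \<and> f u \<noteq> 0 \<longrightarrow>
    (\<exists>g. hom_on (adjoin A x) g \<and> g ` adjoin A x \<subseteq> \<Omega> \<and> (\<forall>a\<in>A. g a = f a) \<and> g v \<noteq> 0))"
proof -
  note P = subring_closed[OF polys_over_subring[OF A]]
  have \<Omega>f: "is_subfield \<Omega>" and \<Omega>root: "\<And>p. p \<in> polys_over \<Omega> \<Longrightarrow> degree p > 0 \<Longrightarrow> \<exists>\<xi>\<in>\<Omega>. poly p \<xi> = 0"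
    using \<Omega> unfolding alg_closed_subfield_def polys_over_def by auto
  note \<Omega>r = subfield_imp_subring[OF \<Omega>f]
  have into: "map_poly f p \<in> polys_over \<Omega>"
    if "hom_on A f" "f ` A \<subseteq> \<Omega>" "p \<in> polys_over A" for f p
    using that polys_over_coeff[OF that(3)] unfolding polys_over_def
    by (auto simp: coeff_map_poly hom_on_0[OF A])
  obtain p where p: "p \<in> polys_over A" "v = poly p x"
    using v(1) unfolding adjoin_def by auto
  show ?thesis
  proof (cases "\<forall>q\<in>polys_over A. poly q x = 0 \<longrightarrow> q = 0")
    case True
    have "\<exists>g. hom_on (adjoin A x) g \<and> g ` adjoin A x \<subseteq> \<Omega> \<and> (\<forall>a\<in>A. g a = f a) \<and> g v \<noteq> 0"
      if f: "hom_on A f" "f ` A \<subseteq> \<Omega>" "f (lead_coeff p) \<noteq> 0" for f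
    proof -
      have "coeff (map_poly f p) (degree p) \<noteq> 0"
        using f(3) by (simp add: coeff_map_poly hom_on_0[OF A f(1)])
      then have "map_poly f p \<noteq> 0" by auto
      then have "finite {\<xi>. poly (map_poly f p) \<xi> = 0}"
        by (rule poly_roots_finite)
      then obtain \<xi> where \<xi>: "\<xi> \<in> \<Omega>" "poly (map_poly f p) \<xi> \<noteq> 0"
        using subfield_char_0_infinite[OF \<Omega>f] by (metis (mono_tags, lifting) finite_subset mem_Collect_eq subsetI)
      obtain g where g: "hom_on (adjoin A x) g" "\<And>a. a \<in> A \<Longrightarrow> g a = f a"
        "\<And>p. p \<in> polys_over A \<Longrightarrow> g (poly p x) = poly (map_poly f p) \<xi>"
        by (rule extend_hom_by_value[OF A f(1), of x \<xi>]) (use True in auto)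
      have "g ` adjoin A x \<subseteq> \<Omega>"
        unfolding adjoin_def using g(3) subring_poly[OF \<Omega>r into[OF f(1,2)] \<xi>(1)] by auto
      then show ?thesis using g p \<xi> by (intro exI[of _ g]) auto
    qed
    moreover have "lead_coeff p \<in> A" "lead_coeff p \<noteq> 0"
      using p v(2) polys_over_coeff by auto
    ultimately show ?thesis by blast
  next
    case False
    then obtain m0 where m0: "m0 \<in> polys_over A" "poly m0 x = 0" "m0 \<noteq> 0" by blast
    define m where "m = arg_min degree (\<lambda>q. q \<in> polys_over A \<and> poly q x = 0 \<and> q \<noteq> 0)"
    have m: "m \<in> polys_over A" "poly m x = 0" "m \<noteq> 0"
      and min: "\<And>q. q \<in> polys_over A \<Longrightarrow> poly q x = 0 \<Longrightarrow> degree q < degree m \<Longrightarrow> q = 0"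
      using arg_min_nat_lemma[of "\<lambda>q. q \<in> polys_over A \<and> poly q x = 0 \<and> q \<noteq> 0" m0 degree] m0
      unfolding m_def[symmetric] by (auto simp: not_less[symmetric])
    have degm: "degree m > 0"
      using m(2,3) by (metis degree_eq_zeroE gr0I pCons_0_0 poly_pCons mult_zero_right add.right_neutral poly_0)
    let ?c = "lead_coeff m"
    have c: "?c \<in> A" "?c \<noteq> 0" using m polys_over_coeff by auto
    \<comment> \<open>The multiple \<open>w\<close>: among the polynomials whose value at \<open>x\<close> is a nonzero multiple of \<open>v\<close>,
      one of least degree is constant, since otherwise the remainder of \<open>m\<close> modulo it has smaller degree.\<close>
    define G where "G r \<longleftrightarrow> r \<in> polys_over A \<and> poly r x \<noteq> 0 \<and> (\<exists>s\<in>polys_over A. poly r x = v * poly s x)" for r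
    define r where "r = arg_min degree G"
    have "G p" unfolding G_def using p v P(2) by (auto intro!: bexI[of _ 1])
    from arg_min_nat_lemma[of G, OF this, of degree]
    have r: "G r" and rmin: "\<And>q. G q \<Longrightarrow> degree r \<le> degree q"
      unfolding r_def by auto
    from r obtain s where rs: "r \<in> polys_over A" "poly r x \<noteq> 0" "s \<in> polys_over A" "poly r x = v * poly s x"
      unfolding G_def by blast
    have rnz: "r \<noteq> 0" using rs by auto
    have rm: "degree r < degree m"
    proof -
      obtain i s' t where t: "s' \<in> polys_over A" "t \<in> polys_over A"
        "smult (?c ^ i) r = m * s' + t" "t = 0 \<or> degree t < degree m"
        by (rule pseudo_division_over[OF A m(1,3) rs(1)])
      from arg_cong[OF t(3), of "\<lambda>q. poly q x"] have tx: "poly t x = ?c ^ i * poly r x"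
        using m(2) by simp
      then have "poly t x \<noteq> 0" using c rs by simp
      moreover have "poly t x = v * poly (smult (?c ^ i) s) x" using tx rs by simp
      moreover have "smult (?c ^ i) s \<in> polys_over A"
        using polys_over_smult[OF A] subring_power[OF A c(1)] rs(3) by blast
      ultimately have "G t" unfolding G_def using t by blast
      moreover have "t \<noteq> 0" using \<open>poly t x \<noteq> 0\<close> by auto
      ultimately show ?thesis using rmin t(4) by (meson order.strict_trans1)
    qed
    have "degree r = 0"
    proof (rule ccontr)
      assume dr: "degree r \<noteq> 0"
      obtain i s' t where t: "s' \<in> polys_over A" "t \<in> polys_over A"
        "smult (lead_coeff r ^ i) m = r * s' + t" "t = 0 \<or> degree t < degree r"
        by (rule pseudo_division_over[OF A rs(1) rnz m(1)])
      from arg_cong[OF t(3), of "\<lambda>q. poly q x"] have tx: "poly t x = - (poly r x * poly s' x)"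
        using m(2) by (simp add: eq_neg_iff_add_eq_0 add.commute)
      have "poly t x = 0"
      proof (rule ccontr)
        assume tnz: "poly t x \<noteq> 0"
        have "poly t x = v * poly (- (s * s')) x" using tx rs by simp
        moreover have "- (s * s') \<in> polys_over A" using P rs t by blast
        ultimately have "G t" unfolding G_def using t tnz by blast
        then have "degree r \<le> degree t" by (rule rmin)
        then show False using t(4) tnz by auto
      qed
      then have "t = 0" using min[OF t(2)] t(4) rm by auto
      have "poly s' x = 0" using tx \<open>poly t x = 0\<close> rs by simp
      have nz: "smult (lead_coeff r ^ i) m \<noteq> 0" using m rnz by simp
      then have "s' \<noteq> 0" using t(3) \<open>t = 0\<close> by auto
      have "degree m = degree (r * s')" using t(3) \<open>t = 0\<close> rnz
        by (metis add.right_neutral degree_smult_eq leading_coeff_0_iff power_not_zero)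
      also have "\<dots> = degree r + degree s'" using rnz \<open>s' \<noteq> 0\<close> by (simp add: degree_mult_eq)
      finally have "degree s' < degree m" using dr by simp
      with min[OF t(1) \<open>poly s' x = 0\<close>] \<open>s' \<noteq> 0\<close> show False by simp
    qed
    then obtain w where w: "r = [:w:]" by (meson degree_eq_zeroE)
    have wA: "w \<in> A" "w \<noteq> 0" "w = v * poly s x"
      using rs rnz unfolding w by (auto simp: polys_over_pCons)
    have "\<exists>g. hom_on (adjoin A x) g \<and> g ` adjoin A x \<subseteq> \<Omega> \<and> (\<forall>a\<in>A. g a = f a) \<and> g v \<noteq> 0"
      if f: "hom_on A f" "f ` A \<subseteq> \<Omega>" "f (?c * w) \<noteq> 0" for f
    proof -
      note F = hom_on_simps[OF polys_over_subring[OF A] map_poly_hom_on[OF A f(1)]]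
      have fc: "f ?c \<noteq> 0" "f w \<noteq> 0"
        using f(3) hom_on_mult[OF A f(1) c(1) wA(1)] by auto
      have "degree (map_poly f m) > 0"
        using degm fc(1) by (metis coeff_map_poly hom_on_0[OF A f(1)] le_degree order.strict_trans2)
      then obtain \<xi> where \<xi>: "\<xi> \<in> \<Omega>" "poly (map_poly f m) \<xi> = 0"
        using \<Omega>root into[OF f(1,2) m(1)] by blast
      obtain g where g: "hom_on (adjoin A x) g" "\<And>a. a \<in> A \<Longrightarrow> g a = f a"
        "\<And>p. p \<in> polys_over A \<Longrightarrow> g (poly p x) = poly (map_poly f p) \<xi>"
      proof (rule extend_hom_by_value[OF A f(1), of x \<xi>])
        fix q assume q: "q \<in> polys_over A" "poly q x = 0"
        obtain i s' t where t: "s' \<in> polys_over A" "t \<in> polys_over A"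
          "smult (?c ^ i) q = m * s' + t" "t = 0 \<or> degree t < degree m"
          by (rule pseudo_division_over[OF A m(1,3) q(1)])
        from arg_cong[OF t(3), of "\<lambda>q. poly q x"] have "poly t x = 0"
          using m(2) q(2) by simp
        with t(2,4) min have t0: "t = 0" by auto
        have "smult (f (?c ^ i)) (map_poly f q) = map_poly f m * map_poly f s'"
          using arg_cong[OF t(3), of "map_poly f"] t0 F(4)[OF m(1) t(1)]
            map_poly_smult_hom[OF A f(1) subring_power[OF A c(1)] q(1)] by simp
        from arg_cong[OF this, of "\<lambda>q. poly q \<xi>"] show "poly (map_poly f q) \<xi> = 0"
          using \<xi>(2) fc(1) by (simp add: hom_on_power[OF A f(1) c(1)])
      qed auto
      have "g ` adjoin A x \<subseteq> \<Omega>"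
        unfolding adjoin_def using g(3) subring_poly[OF \<Omega>r into[OF f(1,2)] \<xi>(1)] by auto
      moreover have "g v * g (poly s x) = f w"
        using hom_on_mult[OF adjoin_subring[OF A] g(1) v(1), of "poly s x"] rs(3) g(2)[OF wA(1)] wA(3)
        unfolding adjoin_def by auto
      ultimately show ?thesis using g fc by (intro exI[of _ g]) auto
    qed
    moreover have "?c * w \<in> A" "?c * w \<noteq> 0"
      using subring_mult[OF A c(1) wA(1)] c wA by auto
    ultimately show ?thesis by blast
  qed
qed

lemma hom_extends_to_adjoin_list:
  fixes A :: "'a::idom set" and \<Omega> :: "'b::field_char_0 set"
  assumes \<Omega>: "alg_closed_subfield \<Omega>"
    and A: "is_subring A" and v: "v \<in> foldl adjoin A xs" "v \<noteq> 0"
  shows "\<exists>u\<in>A. u \<noteq> 0 \<and> (\<forall>f. hom_on A f \<and> f ` A \<subseteq> \<Omega> \<and> f u \<noteq> 0 \<longrightarrow>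
    (\<exists>g. hom_on (foldl adjoin A xs) g \<and> g ` foldl adjoin A xs \<subseteq> \<Omega> \<and> (\<forall>a\<in>A. g a = f a) \<and> g v \<noteq> 0))"
  using A v
proof (induction xs arbitrary: A v)
  case Nil
  then show ?case by (intro bexI[of _ v]) auto
next
  case (Cons x xs)
  let ?B = "adjoin A x"
  note B = adjoin_subring[OF Cons.prems(1), of x]
  have "v \<in> foldl adjoin ?B xs" using Cons.prems(2) by simp
  from Cons.IH[OF B this Cons.prems(3)] obtain u' where u': "u' \<in> ?B" "u' \<noteq> 0"
    "\<And>f. hom_on ?B f \<Longrightarrow> f ` ?B \<subseteq> \<Omega> \<Longrightarrow> f u' \<noteq> 0 \<Longrightarrow>
      \<exists>g. hom_on (foldl adjoin ?B xs) g \<and> g ` foldl adjoin ?B xs \<subseteq> \<Omega> \<and> (\<forall>a\<in>?B. g a = f a) \<and> g v \<noteq> 0"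
    by blast
  from hom_extends_to_adjoin[OF Cons.prems(1) u'(1,2) \<Omega>] obtain u where u: "u \<in> A" "u \<noteq> 0"
    "\<And>f. hom_on A f \<Longrightarrow> f ` A \<subseteq> \<Omega> \<Longrightarrow> f u \<noteq> 0 \<Longrightarrow>
      \<exists>g. hom_on ?B g \<and> g ` ?B \<subseteq> \<Omega> \<and> (\<forall>a\<in>A. g a = f a) \<and> g u' \<noteq> 0"
    by blast
  have "\<exists>g. hom_on (foldl adjoin A (x # xs)) g \<and> g ` foldl adjoin A (x # xs) \<subseteq> \<Omega> \<and>
      (\<forall>a\<in>A. g a = f a) \<and> g v \<noteq> 0"
    if f: "hom_on A f" "f ` A \<subseteq> \<Omega>" "f u \<noteq> 0" for f
  proof -
    obtain g where g: "hom_on ?B g" "g ` ?B \<subseteq> \<Omega>" "\<forall>a\<in>A. g a = f a" "g u' \<noteq> 0"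
      using u(3)[OF f] by blast
    obtain h where h: "hom_on (foldl adjoin ?B xs) h" "h ` foldl adjoin ?B xs \<subseteq> \<Omega>"
      "\<forall>a\<in>?B. h a = g a" "h v \<noteq> 0"
      using u'(3)[OF g(1,2,4)] by blast
    show ?thesis
      using g h subset_adjoin[OF Cons.prems(1), of x] by (intro exI[of _ h]) auto
  qed
  with u(1,2) show ?case by blast
qed

lemma foldl_adjoin_contains:
  "is_subring A \<Longrightarrow> is_subring (foldl adjoin A xs) \<and> A \<union> set xs \<subseteq> foldl adjoin A xs"
proof (induction xs arbitrary: A)
  case (Cons x xs)
  from Cons.IH[OF adjoin_subring[OF Cons.prems, of x]]
    subset_adjoin[OF Cons.prems, of x] gen_in_adjoin[OF Cons.prems, of x]
  show ?case by auto
qed simp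

text \<open>
  Over a field the condition on \<open>u\<close> disappears, because homomorphisms on fields are injective.
\<close>
lemma hom_extends_from_subfield:
  fixes K :: "'a::field set" and \<Omega> :: "'b::field_char_0 set"
  assumes K: "is_subfield K" and f: "hom_on K f" "f ` K \<subseteq> \<Omega>"
    and \<Omega>: "alg_closed_subfield \<Omega>" and S: "finite S"
  obtains R g where "is_subring R" "K \<subseteq> R" "S \<subseteq> R" "hom_on R g" "g ` R \<subseteq> \<Omega>"
    "\<And>a. a \<in> K \<Longrightarrow> g a = f a"
proof -
  note Kr = subfield_imp_subring[OF K]
  obtain xs where xs: "set xs = S" using finite_list[OF S] by blast
  let ?R = "foldl adjoin K xs"
  have R: "is_subring ?R" "K \<union> S \<subseteq> ?R" using foldl_adjoin_contains[OF Kr, of xs] xs by auto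
  obtain u where u: "u \<in> K" "u \<noteq> 0"
    "f u \<noteq> 0 \<Longrightarrow> \<exists>g. hom_on ?R g \<and> g ` ?R \<subseteq> \<Omega> \<and> (\<forall>a\<in>K. g a = f a)"
    using hom_extends_to_adjoin_list[OF \<Omega> Kr subring_1[OF R(1)] one_neq_zero] f by blast
  have "f u \<noteq> 0" using hom_on_subfield_eq_0_iff[OF K f(1) u(1)] u(2) by simp
  with u(3) R that show thesis by auto
qed

(* the sign $ is kept for the coefficients of power series *)
no_notation vec_index (infixl \<open>$\<close> 100)

section \<open>Taylor series in a differential field\<close>

context differential_field
begin

lemma deriv_0 [simp]: "D 0 = 0"
  using deriv_add[of 0 0] by simp

lemma deriv_1 [simp]: "D 1 = 0"
  using deriv_mult[of 1 1] by simp

lemma deriv_minus: "D (- x) = - D x"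
  using deriv_add[of x "- x"] by (simp add: add_eq_0_iff)

lemma deriv_sum: "D (sum g I) = (\<Sum>i\<in>I. D (g i))"
  by (induction I rule: infinite_finite_induct) (auto simp: deriv_add)

lemma funpow_deriv_0 [simp]: "(D ^^ i) 0 = 0"
  by (induction i) auto

lemma funpow_deriv_add: "(D ^^ i) (x + y) = (D ^^ i) x + (D ^^ i) y"
  by (induction i) (auto simp: deriv_add)

lemma funpow_deriv_sum: "(D ^^ i) (sum g I) = (\<Sum>j\<in>I. (D ^^ i) (g j))"
  by (induction i) (auto simp: deriv_sum)

lemma funpow_deriv_const_mult: "D c = 0 \<Longrightarrow> (D ^^ i) (c * x) = c * (D ^^ i) x"
  by (induction i) (auto simp: deriv_mult)

lemma deriv_inverse: "D (inverse x) = - (D x * inverse x * inverse x)"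
proof (cases "x = 0")
  case False
  then have "D x * inverse x + x * D (inverse x) = 0"
    using deriv_mult[of x "inverse x"] by simp
  then have "x * D (inverse x) = - (D x * inverse x)"
    by (simp add: eq_neg_iff_add_eq_0 add.commute)
  then have "inverse x * (x * D (inverse x)) = inverse x * - (D x * inverse x)" by simp
  then show ?thesis
    using False by (simp add: mult_ac(1)[symmetric])
qed simp

end

text \<open>
  Independence of an indexed family, so that a repeated member counts as a dependence.
\<close>
definition indep_over :: "'a::comm_ring_1 set \<Rightarrow> 'i set \<Rightarrow> ('i \<Rightarrow> 'a) \<Rightarrow> bool" where
  "indep_over C J z \<longleftrightarrow>
     (\<forall>c. (\<forall>j\<in>J. c j \<in> C) \<and> (\<Sum>j\<in>J. c j * z j) = 0 \<longrightarrow> (\<forall>j\<in>J. c j = 0))"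

lemma indep_overD:
  assumes "indep_over C J z" "\<And>j. j \<in> J \<Longrightarrow> c j \<in> C" "(\<Sum>j\<in>J. c j * z j) = 0" "j \<in> J"
  shows "c j = 0"
  using assms unfolding indep_over_def by blast

lemma diff_subfield_closed:
  assumes "diff_subfield D N"
  shows diff_subfield_subfield: "is_subfield N" and diff_subfield_subring: "is_subring N"
    and diff_subfield_deriv: "\<And>x. x \<in> N \<Longrightarrow> D x \<in> N"
    and diff_subfield_funpow: "\<And>x i. x \<in> N \<Longrightarrow> (D ^^ i) x \<in> N"
    and diff_subfield_inverse: "\<And>x. x \<in> N \<Longrightarrow> inverse x \<in> N"
proof -
  show d: "D x \<in> N" if "x \<in> N" for x
    using assms that unfolding diff_subfield_def by auto
  show "is_subfield N" "is_subring N"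
    using assms subfield_imp_subring unfolding diff_subfield_def by auto
  then show "inverse x \<in> N" if "x \<in> N" for x using that unfolding is_subfield_def by auto
  show "(D ^^ i) x \<in> N" if "x \<in> N" for x i
    using that d by (induction i) auto
qed

text \<open>
  The twist that turns a ring homomorphism \<open>f\<close> into a homomorphism of differential rings to
  formal power series with their usual derivation.
\<close>
definition taylor :: "('a \<Rightarrow> 'b::field_char_0) \<Rightarrow> ('a \<Rightarrow> 'a) \<Rightarrow> 'a \<Rightarrow> 'b fps" where
  "taylor f D x = Abs_fps (\<lambda>i. f ((D ^^ i) x) / fact i)"

lemma fps_deriv_taylor: "fps_deriv (taylor f D x) = taylor f D (D x)"
proof (rule fps_ext)
  fix i
  have "f ((D ^^ Suc i) x) * of_nat (Suc i) / fact (Suc i) = f ((D ^^ i) (D x)) / fact i"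
    by (simp add: funpow_Suc_right del: funpow.simps of_nat_Suc)
  then show "fps_deriv (taylor f D x) $ i = taylor f D (D x) $ i"
    by (simp add: taylor_def mult.commute del: of_nat_Suc)
qed

lemma funpow_fps_deriv_taylor: "(fps_deriv ^^ i) (taylor f D x) = taylor f D ((D ^^ i) x)"
  by (induction i) (auto simp: fps_deriv_taylor)

lemma taylor_nth: "taylor f D x $ i = f ((D ^^ i) x) / fact i"
  by (simp add: taylor_def)

text \<open>
  Multiplicativity is Leibniz' rule for iterated derivatives.  The induction on the index of the
  coefficient gets it from the product rule alone, since the two sides have the same derivative.
\<close>
lemma taylor_hom_on:
  assumes "differential_field D" and A: "is_subring A" and DA: "\<And>x. x \<in> A \<Longrightarrow> D x \<in> A"
    and f: "hom_on A f"
  shows "hom_on A (taylor f D)"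
proof -
  interpret differential_field D by fact
  note f' = hom_on_simps[OF A f]
  have it: "(D ^^ i) x \<in> A" if "x \<in> A" for i x
    using that DA by (induction i) auto
  have add: "taylor f D (x + y) = taylor f D x + taylor f D y" if "x \<in> A" "y \<in> A" for x y
    by (rule fps_ext)
      (simp add: taylor_nth funpow_deriv_add f'(3)[OF it[OF that(1)] it[OF that(2)]] add_divide_distrib)
  have "taylor f D (x * y) $ i = (taylor f D x * taylor f D y) $ i" if "x \<in> A" "y \<in> A" for x y i
    using that
  proof (induction i arbitrary: x y)
    case 0
    then show ?case by (simp add: taylor_nth f')
  next
    case (Suc i)
    have "of_nat (Suc i) * taylor f D (x * y) $ Suc i = taylor f D (D x * y + x * D y) $ i"
      using arg_cong[OF fps_deriv_taylor[of f D "x * y"], of "\<lambda>g. g $ i"] by (simp add: deriv_mult)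
    also have "\<dots> = (fps_deriv (taylor f D x) * taylor f D y + taylor f D x * fps_deriv (taylor f D y)) $ i"
      using Suc by (simp add: add subring_mult[OF A] DA fps_deriv_taylor)
    also have "\<dots> = fps_deriv (taylor f D x * taylor f D y) $ i"
      by (simp only: fps_deriv_mult add.commute)
    also have "\<dots> = of_nat (Suc i) * (taylor f D x * taylor f D y) $ Suc i"
      unfolding fps_deriv_nth by simp
    finally show ?case
      by (simp del: of_nat_Suc)
  qed
  then have mult: "taylor f D (x * y) = taylor f D x * taylor f D y" if "x \<in> A" "y \<in> A" for x y
    using that by (intro fps_ext) auto
  have "taylor f D 1 $ i = 1 $ i" for i
    by (cases i) (simp_all add: taylor_nth f' funpow_Suc_right del: funpow.simps(2))
  then have "taylor f D 1 = 1" by (intro fps_ext)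
  with add mult show ?thesis unfolding hom_on_def by blast
qed

lemma taylor_constant:
  assumes "differential_field D" "D c = 0" "f 0 = 0"
  shows "taylor f D c = fps_const (f c)"
proof (rule fps_ext)
  interpret differential_field D by fact
  show "taylor f D c $ i = fps_const (f c) $ i" for i
    using assms by (cases i) (simp_all add: taylor_nth funpow_Suc_right del: funpow.simps(2))
qed

text \<open>
  A Wronskian argument in power series form: elements of \<open>N\<close> that are independent over the constants
  of \<open>N\<close> have Taylor series that are independent over all constants of the power series ring.
  Multiplying a relation by the Taylor series of \<open>inverse (z k)\<close> makes \<open>a k\<close> its constant term, which
  differentiation removes; the derivatives of the remaining quotients \<open>z j * inverse (z k)\<close> are still independent.
\<close>
lemma taylor_images_linearly_disjoint:
  fixes f :: "'a::field_char_0 \<Rightarrow> 'b::field_char_0"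
  assumes D: "differential_field D" and N: "diff_subfield D N" and f: "hom_on N f"
    and J: "finite J" and z: "z ` J \<subseteq> N" "indep_over (constants D N) J z"
    and rel: "(\<Sum>j\<in>J. fps_const (a j) * taylor f D (z j)) = 0"
  shows "\<forall>j\<in>J. a j = 0"
  using J z rel
proof (induction J arbitrary: z rule: finite_induct)
  case (insert k J)
  interpret differential_field D by fact
  note Nr = diff_subfield_subring[OF N]
  note T = hom_on_simps[OF Nr taylor_hom_on[OF D Nr diff_subfield_deriv[OF N] f]]
  note NC = subring_closed[OF Nr]
  have C0: "0 \<in> constants D N" "1 \<in> constants D N"
    using NC by (auto simp: constants_def)
  have zN: "z j \<in> N" if "j \<in> insert k J" for j using that insert.prems(1) by blast
  have zk: "z k \<noteq> 0"
  proof
    assume "z k = 0"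
    then have "(\<Sum>j\<in>insert k J. (if j = k then 1 else 0) * z j) = 0"
      by (intro sum.neutral) auto
    then have "(if k = k then 1 else 0) = (0::'a)"
      by (intro indep_overD[OF insert.prems(2), of "\<lambda>j. if j = k then 1 else 0" k]) (use C0 in auto)
    then show False by simp
  qed
  define w where "w j = z j * inverse (z k)" for j
  have iN: "inverse (z k) \<in> N" using diff_subfield_inverse[OF N] zN by auto
  have wN: "w j \<in> N" if "j \<in> insert k J" for j using zN[OF that] iN NC unfolding w_def by auto
  have wk: "w k = 1" using zk unfolding w_def by simp
  have "(\<Sum>j\<in>insert k J. fps_const (a j) * taylor f D (w j)) =
      (\<Sum>j\<in>insert k J. fps_const (a j) * taylor f D (z j)) * taylor f D (inverse (z k))"
    unfolding sum_distrib_right by (intro sum.cong refl) (simp add: w_def T(4) zN iN mult.assoc)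
  with insert.prems(3) have relw: "(\<Sum>j\<in>insert k J. fps_const (a j) * taylor f D (w j)) = 0" by simp
  have "fps_deriv (\<Sum>j\<in>insert k J. fps_const (a j) * taylor f D (w j)) = 0"
    unfolding relw by simp
  then have reld: "(\<Sum>j\<in>J. fps_const (a j) * taylor f D (D (w j))) = 0"
    using insert.hyps by (simp add: fps_deriv_sum fps_deriv_taylor wk T(1))
  have "indep_over (constants D N) J (\<lambda>j. D (w j))"
    unfolding indep_over_def
  proof (intro allI impI, elim conjE)
    fix c assume c: "\<forall>j\<in>J. c j \<in> constants D N" and "(\<Sum>j\<in>J. c j * D (w j)) = 0"
    moreover define e where "e = (\<Sum>j\<in>J. c j * w j)"
    ultimately have "D e = 0" by (simp add: deriv_sum deriv_mult constants_def)
    moreover have "e \<in> N" unfolding e_def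
      using c wN by (intro subring_sum[OF Nr] NC(4)) (auto simp: constants_def)
    ultimately have e: "- e \<in> constants D N" using NC by (simp add: constants_def deriv_minus)
    define c' where "c' j = (if j = k then - e else c j)" for j
    have "(\<Sum>j\<in>insert k J. c' j * z j) = - e * z k + (\<Sum>j\<in>J. c j * z j)"
      using insert.hyps by (simp add: c'_def) (intro sum.cong, auto)
    also have "(\<Sum>j\<in>J. c j * z j) = e * z k"
      unfolding e_def sum_distrib_right w_def using zk by (intro sum.cong) auto
    finally have "(\<Sum>j\<in>insert k J. c' j * z j) = 0" by simp
    moreover have "\<forall>j\<in>insert k J. c' j \<in> constants D N" using c e by (auto simp: c'_def)
    ultimately have "\<forall>j\<in>insert k J. c' j = 0"
      using insert.prems(2) unfolding indep_over_def by blast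
    then show "\<forall>j\<in>J. c j = 0" using insert.hyps(2) unfolding c'_def by (metis insertCI)
  qed
  moreover have "(\<lambda>j. D (w j)) ` J \<subseteq> N" using wN diff_subfield_deriv[OF N] by auto
  ultimately have aJ: "\<forall>j\<in>J. a j = 0" using insert.IH[of "\<lambda>j. D (w j)"] reld by auto
  then have "fps_const (a k) * taylor f D (w k) = 0"
    using relw insert.hyps by simp
  then have "a k = 0" by (simp add: wk T(2))
  with aJ show ?case by simp
qed simp

section \<open>Linear differential equations over power series\<close>

lemma funpow_fps_deriv_nth:
  "(fps_deriv ^^ i) g $ m = fact (m + i) / fact m * (g :: 'a::field_char_0 fps) $ (m + i)"
proof (induction i arbitrary: m)
  case (Suc i)
  have "(fact (Suc m) :: 'a) = of_nat (Suc m) * fact m" by simp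
  then show ?case using Suc[of "Suc m"] by (simp add: field_simps del: of_nat_Suc fact_Suc)
qed simp

definition fps_ode :: "nat \<Rightarrow> (nat \<Rightarrow> 'a fps) \<Rightarrow> 'a::field_char_0 fps \<Rightarrow> bool" where
  "fps_ode n b g \<longleftrightarrow> (fps_deriv ^^ n) g + (\<Sum>i<n. b i * (fps_deriv ^^ i) g) = 0"

text \<open>
  With all coefficients of \<open>g\<close> below index \<open>s + n\<close> zero, the coefficient of the equation at \<open>t ^ s\<close> consists of a nonzero
  multiple of the coefficient of \<open>g\<close> at \<open>t ^ (s + n)\<close> alone.
\<close>
lemma fps_ode_unique:
  assumes "fps_ode n b g" "\<And>i. i < n \<Longrightarrow> g $ i = 0"
  shows "g = 0"
proof (rule fps_ext)
  fix m
  show "g $ m = 0 $ m"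
  proof (induction m rule: less_induct)
    case (less m)
    show ?case
    proof (cases "m < n")
      case False
      define s where "s = m - n"
      have m: "m = s + n" using False by (simp add: s_def)
      have "(b i * (fps_deriv ^^ i) g) $ s = 0" if "i < n" for i
        unfolding fps_mult_nth funpow_fps_deriv_nth
        using that less by (intro sum.neutral) (auto simp: m)
      then have "(\<Sum>i<n. b i * (fps_deriv ^^ i) g) $ s = 0"
        by (simp add: fps_sum_nth)
      moreover have "((fps_deriv ^^ n) g + (\<Sum>i<n. b i * (fps_deriv ^^ i) g)) $ s = 0"
        using assms(1) unfolding fps_ode_def by simp
      ultimately have "(fps_deriv ^^ n) g $ s = 0" by simp
      then show ?thesis by (simp add: funpow_fps_deriv_nth m)
    qed (simp add: assms(2))
  qed
qed

lemma funpow_fps_deriv_sum: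
  "(fps_deriv ^^ i) (\<Sum>j\<in>J. fps_const (c j) * g j) = (\<Sum>j\<in>J. fps_const (c j) * (fps_deriv ^^ i) (g j))"
  by (induction i) (auto simp: fps_deriv_sum)

lemma fps_ode_linear:
  assumes "\<And>j. j \<in> J \<Longrightarrow> fps_ode n b (g j)"
  shows "fps_ode n b (\<Sum>j\<in>J. fps_const (c j) * g j)"
proof -
  have "(\<Sum>i<n. b i * (fps_deriv ^^ i) (\<Sum>j\<in>J. fps_const (c j) * g j)) =
      (\<Sum>j\<in>J. fps_const (c j) * (\<Sum>i<n. b i * (fps_deriv ^^ i) (g j)))"
    unfolding funpow_fps_deriv_sum sum_distrib_left
    by (subst sum.swap) (simp add: ac_simps)
  then have "(fps_deriv ^^ n) (\<Sum>j\<in>J. fps_const (c j) * g j) +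
       (\<Sum>i<n. b i * (fps_deriv ^^ i) (\<Sum>j\<in>J. fps_const (c j) * g j)) =
     (\<Sum>j\<in>J. fps_const (c j) * ((fps_deriv ^^ n) (g j) + (\<Sum>i<n. b i * (fps_deriv ^^ i) (g j))))"
    by (simp add: funpow_fps_deriv_sum sum.distrib distrib_left)
  also have "\<dots> = 0" using assms by (intro sum.neutral) (auto simp: fps_ode_def)
  finally show ?thesis unfolding fps_ode_def .
qed

lemma taylor_fps_ode:
  assumes D: "differential_field D" and A: "is_subring A" "\<And>x. x \<in> A \<Longrightarrow> D x \<in> A"
    and f: "hom_on A f" and a: "equation_over A n a" and y: "y \<in> solutions D n a A"
  shows "fps_ode n (\<lambda>i. taylor f D (a i)) (taylor f D y)"
proof -
  note T = taylor_hom_on[OF D A f]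
  have yA: "y \<in> A" using y unfolding solutions_def by auto
  have it: "(D ^^ i) y \<in> A" for i using yA A(2) by (induction i) auto
  have *: "a i * (D ^^ i) y \<in> A" if "i \<in> {..<n}" for i
    using that a it subring_mult[OF A(1)] unfolding equation_over_def by auto
  have "taylor f D ((D ^^ n) y + (\<Sum>i<n. a i * (D ^^ i) y)) = 0"
    using y hom_on_0[OF A(1) T] unfolding solutions_def by simp
  also have "taylor f D ((D ^^ n) y + (\<Sum>i<n. a i * (D ^^ i) y)) =
      taylor f D ((D ^^ n) y) + (\<Sum>i<n. taylor f D (a i * (D ^^ i) y))"
  proof -
    have "(\<Sum>i<n. a i * (D ^^ i) y) \<in> A" by (rule subring_sum[OF A(1) *])
    moreover have "taylor f D (\<Sum>i<n. a i * (D ^^ i) y) = (\<Sum>i<n. taylor f D (a i * (D ^^ i) y))"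
      by (rule hom_on_sum[OF A(1) T *])
    ultimately show ?thesis using hom_on_add[OF A(1) T it] by simp
  qed
  also have "(\<Sum>i<n. taylor f D (a i * (D ^^ i) y)) = (\<Sum>i<n. taylor f D (a i) * taylor f D ((D ^^ i) y))"
    using hom_on_mult[OF A(1) T _ it] a unfolding equation_over_def by (intro sum.cong) auto
  finally have "taylor f D ((D ^^ n) y) + (\<Sum>i<n. taylor f D (a i) * taylor f D ((D ^^ i) y)) = 0" .
  then show ?thesis unfolding fps_ode_def funpow_fps_deriv_taylor .
qed

text \<open>
  A vector in the kernel of the Wronskian matrix yields a combination of Taylor series of solutions whose
  initial conditions vanish.  By uniqueness that combination is zero, and by linear disjointness the
  vector is zero.  With \<open>f\<close> the identity this also rules out dependence over constants of the
  ambient type that lie outside \<open>N\<close>.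
\<close>
lemma wronskian_injective:
  fixes f :: "'a::field_char_0 \<Rightarrow> 'b::field_char_0"
  assumes D: "differential_field D" and N: "diff_subfield D N" and f: "hom_on N f"
    and a: "equation_over N n a" and y: "\<And>j. j < n \<Longrightarrow> y j \<in> solutions D n a N"
    and ind: "indep_over (constants D N) {..<n} y"
    and v: "\<And>i. i < n \<Longrightarrow> (\<Sum>j<n. f ((D ^^ i) (y j)) * v j) = 0"
    and j: "j < n"
  shows "v j = 0"
proof -
  define g where "g = (\<Sum>j<n. fps_const (v j) * taylor f D (y j))"
  have "fps_ode n (\<lambda>i. taylor f D (a i)) g" unfolding g_def
    by (intro fps_ode_linear taylor_fps_ode[OF D diff_subfield_subring[OF N] diff_subfield_deriv[OF N] f a])
      (auto simp: y)
  moreover have "g $ i = 0" if "i < n" for i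
  proof -
    have "g $ i = (\<Sum>j<n. f ((D ^^ i) (y j)) * v j) / fact i"
      unfolding g_def fps_sum_nth sum_divide_distrib
      by (intro sum.cong) (auto simp: taylor_nth)
    then show ?thesis using v[OF that] by simp
  qed
  ultimately have "g = 0" by (rule fps_ode_unique)
  with taylor_images_linearly_disjoint[OF D N f _ _ ind, of v] j y show ?thesis
    unfolding g_def solutions_def by auto
qed

lemma injective_matrix_has_inverse:
  fixes M :: "nat \<Rightarrow> nat \<Rightarrow> 'a::field"
  assumes inj: "\<And>v j. (\<And>i. i < n \<Longrightarrow> (\<Sum>j<n. M i j * v j) = 0) \<Longrightarrow> j < n \<Longrightarrow> v j = 0"
  obtains M' where
    "\<And>i k. i < n \<Longrightarrow> k < n \<Longrightarrow> (\<Sum>j<n. M i j * M' j k) = (if i = k then 1 else 0)"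
    "\<And>i k. i < n \<Longrightarrow> k < n \<Longrightarrow> (\<Sum>j<n. M' i j * M j k) = (if i = k then 1 else 0)"
proof -
  define A where "A = mat n n (\<lambda>(i, j). M i j)"
  have A: "A \<in> carrier_mat n n" by (simp add: A_def)
  have "det A \<noteq> 0"
  proof
    assume "det A = 0"
    then obtain v where v: "v \<in> carrier_vec n" "v \<noteq> 0\<^sub>v n" "A *\<^sub>v v = 0\<^sub>v n"
      unfolding det_0_iff_vec_prod_zero_field[OF A] by auto
    have "(\<Sum>j<n. M i j * vec_index v j) = 0" if "i < n" for i
    proof -
      have "vec_index (A *\<^sub>v v) i = 0" using v(3) that by simp
      then show ?thesis using that v(1)
        by (simp add: A_def scalar_prod_def lessThan_atLeast0)
    qed
    then have "vec_index v j = 0" if "j < n" for j using inj[of "\<lambda>j. vec_index v j"] that by auto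
    then have "v = 0\<^sub>v n" using v(1) by (intro eq_vecI) auto
    with v(2) show False by simp
  qed
  from det_non_zero_imp_unit[OF A this, of undefined]
  obtain B where B: "B \<in> carrier_mat n n" "B * A = 1\<^sub>m n" "A * B = 1\<^sub>m n"
    by (auto simp: Units_def ring_mat_def)
  show thesis
  proof
    fix i k assume ik: "i < n" "k < n"
    have "(A * B) $$ (i, k) = 1\<^sub>m n $$ (i, k)" using B by simp
    then show "(\<Sum>j<n. M i j * B $$ (j, k)) = (if i = k then 1 else 0)"
      using ik B(1) by (simp add: A_def scalar_prod_def lessThan_atLeast0)
    have "(B * A) $$ (i, k) = 1\<^sub>m n $$ (i, k)" using B by simp
    then show "(\<Sum>j<n. B $$ (i, j) * M j k) = (if i = k then 1 else 0)"
      using ik B(1) by (simp add: A_def scalar_prod_def lessThan_atLeast0)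
  qed
qed

lemma fps_ode_diff:
  assumes "fps_ode n b g" "fps_ode n b h"
  shows "fps_ode n b (g - h)"
  using fps_ode_linear[of "UNIV :: bool set" n b "\<lambda>t. if t then g else h" "\<lambda>t. if t then 1 else - 1"] assms
  by (simp add: UNIV_bool fps_const_neg[symmetric] del: fps_const_neg)

lemma fps_ode_cong:
  "(\<And>i. i < n \<Longrightarrow> b i = b' i) \<Longrightarrow> fps_ode n b g \<longleftrightarrow> fps_ode n b' g"
  unfolding fps_ode_def by simp

section \<open>Specializing constants\<close>

text \<open>
  A linear relation, with coefficients in \<open>A\<close>, between Taylor series of elements of \<open>N\<close> comes from
  relations over the constants of \<open>N\<close>, on which \<open>\<chi>\<close> is the identity.  A dependence among the \<open>u i\<close> is
  used to eliminate one of them; if there is none, all coefficients \<open>a i\<close> are zero.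
\<close>
lemma taylor_relation_specializes:
  fixes f :: "'a::field_char_0 \<Rightarrow> 'b::field_char_0"
  assumes D: "differential_field D" and N: "diff_subfield D N" and f: "hom_on N f"
    and A: "is_subring A" and \<chi>: "hom_on A \<chi>"
    and C: "\<And>c. c \<in> constants D N \<Longrightarrow> f c \<in> A \<and> \<chi> (f c) = c"
    and I: "finite I" and u: "\<And>i. i \<in> I \<Longrightarrow> u i \<in> N" and a: "\<And>i. i \<in> I \<Longrightarrow> a i \<in> A"
    and rel: "(\<Sum>i\<in>I. fps_const (a i) * taylor f D (u i)) = 0"
  shows "(\<Sum>i\<in>I. \<chi> (a i) * u i) = 0"
  using I u a rel
proof (induction I arbitrary: a rule: finite_psubset_induct)
  case (psubset I)
  interpret differential_field D by fact
  note Nr = diff_subfield_subring[OF N]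
  note T = hom_on_simps[OF Nr taylor_hom_on[OF D Nr diff_subfield_deriv[OF N] f]]
  show ?case
  proof (cases "indep_over (constants D N) I u")
    case True
    have "u ` I \<subseteq> N" using psubset.prems(1) by auto
    from taylor_images_linearly_disjoint[OF D N f psubset.hyps(1) this True psubset.prems(3)]
    have "\<forall>i\<in>I. a i = 0" .
    then show ?thesis using hom_on_0[OF A \<chi>] by simp
  next
    case False
    then obtain c k where c: "\<And>j. j \<in> I \<Longrightarrow> c j \<in> constants D N" "(\<Sum>j\<in>I. c j * u j) = 0"
      and k: "k \<in> I" "c k \<noteq> 0"
      unfolding indep_over_def by blast
    define J where "J = I - {k}"
    have J: "finite J" "J \<subset> I" "k \<notin> J" "I = insert k J" using psubset.hyps(1) k(1) by (auto simp: J_def)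
    define d where "d j = - (c j * inverse (c k))" for j
    have dC: "d j \<in> constants D N" if "j \<in> J" for j
      using c(1)[of j] c(1)[OF k(1)] that J diff_subfield_inverse[OF N] subring_closed[OF Nr]
      unfolding constants_def d_def by (auto simp: deriv_mult deriv_inverse deriv_minus)
    have "c k * u k = - (\<Sum>j\<in>J. c j * u j)"
      using c(2) J by (simp add: eq_neg_iff_add_eq_0)
    moreover have "u k = inverse (c k) * (c k * u k)"
      using k(2) by simp
    ultimately have uk: "u k = (\<Sum>j\<in>J. d j * u j)"
      by (simp add: d_def sum_negf sum_distrib_left mult_ac)
    have Jd: "u j \<in> N" "d j \<in> N" "a j \<in> A" if "j \<in> J" for j
      using that dC psubset.prems J by (auto simp: constants_def)
    have Tuk: "taylor f D (u k) = (\<Sum>j\<in>J. fps_const (f (d j)) * taylor f D (u j))"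
    proof -
      have "taylor f D (u k) = (\<Sum>j\<in>J. taylor f D (d j * u j))"
        unfolding uk using Jd
        by (intro hom_on_sum[OF Nr taylor_hom_on[OF D Nr diff_subfield_deriv[OF N] f]] subring_mult[OF Nr])
      also have "\<dots> = (\<Sum>j\<in>J. fps_const (f (d j)) * taylor f D (u j))"
        using Jd dC by (intro sum.cong refl)
          (simp add: T(4) taylor_constant[where f = f, OF D _ hom_on_0[OF Nr f]] constants_def)
      finally show ?thesis .
    qed
    define a' where "a' j = a j + a k * f (d j)" for j
    have "(\<Sum>j\<in>J. fps_const (a' j) * taylor f D (u j)) =
        (\<Sum>j\<in>J. fps_const (a j) * taylor f D (u j)) + fps_const (a k) * taylor f D (u k)"
      unfolding Tuk a'_def sum_distrib_left sum.distrib[symmetric]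
      by (intro sum.cong refl) (simp add: algebra_simps flip: fps_const_add fps_const_mult)
    also have "\<dots> = 0" using psubset.prems(3) J by (simp add: add.commute)
    finally have "(\<Sum>j\<in>J. \<chi> (a' j) * u j) = 0"
      using psubset.IH[OF J(2), of a'] Jd dC C psubset.prems(2)[OF k(1)] subring_closed[OF A]
      by (auto simp: a'_def)
    moreover have "(\<Sum>j\<in>J. \<chi> (a' j) * u j) = (\<Sum>j\<in>J. \<chi> (a j) * u j) + \<chi> (a k) * u k"
      unfolding uk sum_distrib_left sum.distrib[symmetric]
      using Jd dC C psubset.prems(2)[OF k(1)] subring_closed[OF A]
      by (intro sum.cong refl) (simp add: a'_def hom_on_simps[OF A \<chi>] algebra_simps)
    ultimately show ?thesis using J by (simp add: add.commute)
  qed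
qed

text \<open>
  The ring \<open>S\<close> generated by the Taylor series of \<open>N\<close> and by \<open>A\<close> plays the role of the tensor product
  of \<open>N\<close> and \<open>A\<close> over the constants, and \<open>\<theta>\<close> that of the tensor product of the identity with \<open>\<chi>\<close>.
  Elements of \<open>S\<close> are represented by lists of pairs, standing for sums of products.
\<close>
lemma specialization_of_taylor_compositum:
  fixes f :: "'a::field_char_0 \<Rightarrow> 'b::field_char_0"
  assumes D: "differential_field D" and N: "diff_subfield D N" and f: "hom_on N f"
    and A: "is_subring A" and \<chi>: "hom_on A \<chi>" "\<chi> ` A \<subseteq> constants D N"
    and C: "\<And>c. c \<in> constants D N \<Longrightarrow> f c \<in> A \<and> \<chi> (f c) = c"
  obtains S \<theta> where "is_subring S" "hom_on S \<theta>" "\<theta> ` S \<subseteq> N"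
    "\<And>u. u \<in> N \<Longrightarrow> taylor f D u \<in> S \<and> \<theta> (taylor f D u) = u"
    "\<And>a. a \<in> A \<Longrightarrow> fps_const a \<in> S \<and> \<theta> (fps_const a) = \<chi> a"
    "\<And>s. s \<in> S \<Longrightarrow> fps_deriv s \<in> S \<and> \<theta> (fps_deriv s) = D (\<theta> s)"
proof -
  interpret differential_field D by fact
  note Nr = diff_subfield_subring[OF N]
  note T = hom_on_simps[OF Nr taylor_hom_on[OF D Nr diff_subfield_deriv[OF N] f]]
  define P where "P = lists (A \<times> N)"
  define rep where "rep ps = (\<Sum>(a, u)\<leftarrow>ps. fps_const a * taylor f D u)" for ps
  define val where "val ps = (\<Sum>(a, u)\<leftarrow>ps. \<chi> a * u)" for ps
  define \<theta> where "\<theta> s = val (SOME ps. ps \<in> P \<and> rep ps = s)" for s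
  define neg where "neg ps = map (\<lambda>(a :: 'b, u :: 'a). (- a, u)) ps" for ps
  define mul where "mul ps qs = concat (map (\<lambda>(a, u). map (\<lambda>(b, v). (a * b, u * v)) qs) ps)"
    for ps qs :: "('b \<times> 'a) list"
  define der where "der ps = map (\<lambda>(a :: 'b, u). (a, D u)) ps" for ps
  have rep_simps: "rep [] = 0" "rep ((a, u) # ps) = fps_const a * taylor f D u + rep ps"
    and val_simps: "val [] = 0" "val ((a, u) # ps) = \<chi> a * u + val ps" for a u ps
    by (simp_all add: rep_def val_def)
  have app: "rep (ps @ qs) = rep ps + rep qs" "val (ps @ qs) = val ps + val qs" for ps qs
    by (simp_all add: rep_def val_def)
  have appP: "ps @ qs \<in> P" if "ps \<in> P" "qs \<in> P" for ps qs using that by (simp add: P_def)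
  have neg: "neg ps \<in> P \<and> rep (neg ps) = - rep ps \<and> val (neg ps) = - val ps" if "ps \<in> P" for ps
    using that unfolding P_def
    by (induction ps) (auto simp: neg_def rep_simps val_simps subring_closed[OF A]
        hom_on_simps[OF A \<chi>(1)] fps_const_neg[symmetric] simp del: fps_const_neg)
  \<comment> \<open>so the value of a list depends only on the series that it represents\<close>
  have zero: "val ps = 0" if "ps \<in> P" "rep ps = 0" for ps
  proof -
    have in_P: "fst (ps ! i) \<in> A \<and> snd (ps ! i) \<in> N" if "i < length ps" for i
      using \<open>ps \<in> P\<close> nth_mem[OF that] unfolding P_def by (auto simp: in_lists_conv_set mem_Times_iff)
    have "(\<Sum>i<length ps. \<chi> (fst (ps ! i)) * snd (ps ! i)) = 0"
      by (rule taylor_relation_specializes[OF D N f A \<chi>(1) C])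
        (use that in_P in \<open>auto simp: rep_def sum_list_sum_nth case_prod_unfold lessThan_atLeast0\<close>)
    then show ?thesis by (simp add: val_def sum_list_sum_nth case_prod_unfold lessThan_atLeast0)
  qed
  have \<theta>: "\<theta> (rep ps) = val ps" if "ps \<in> P" for ps
  proof -
    define qs where "qs = (SOME qs. qs \<in> P \<and> rep qs = rep ps)"
    have qs: "qs \<in> P" "rep qs = rep ps"
      using someI[of "\<lambda>qs. qs \<in> P \<and> rep qs = rep ps" ps] that unfolding qs_def by auto
    have "val (qs @ neg ps) = 0"
      using qs neg[OF that] by (intro zero appP) (auto simp: app)
    then have "val qs = val ps" using neg[OF that] by (simp add: app)
    then show ?thesis unfolding \<theta>_def qs_def .
  qed
  have map_mul: "map (\<lambda>(b, v). (a * b, u * v)) qs \<in> P \<and>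
      rep (map (\<lambda>(b, v). (a * b, u * v)) qs) = fps_const a * taylor f D u * rep qs \<and>
      val (map (\<lambda>(b, v). (a * b, u * v)) qs) = \<chi> a * u * val qs"
    if "qs \<in> P" "a \<in> A" "u \<in> N" for qs a u
    using that unfolding P_def
    by (induction qs) (auto simp: rep_simps val_simps subring_closed[OF A] subring_closed[OF Nr]
        hom_on_simps[OF A \<chi>(1)] T algebra_simps simp flip: fps_const_mult)
  have mul: "mul ps qs \<in> P \<and> rep (mul ps qs) = rep ps * rep qs \<and> val (mul ps qs) = val ps * val qs"
    if ps: "ps \<in> P" and qs: "qs \<in> P" for ps qs
    using ps
  proof (induction ps)
    case (Cons p ps)
    obtain a u where p: "p = (a, u)" by fastforce
    with Cons.prems have "a \<in> A" "u \<in> N" "ps \<in> P" by (auto simp: P_def)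
    with Cons.IH map_mul[OF qs, of a u] show ?case
      by (auto simp: mul_def p app rep_simps val_simps P_def algebra_simps)
  qed (simp add: mul_def P_def rep_simps val_simps)
  have der: "der ps \<in> P \<and> rep (der ps) = fps_deriv (rep ps) \<and> val (der ps) = D (val ps)"
    if "ps \<in> P" for ps
  proof -
    have "D (\<chi> a) = 0" if "a \<in> A" for a using \<chi>(2) that by (auto simp: constants_def)
    with that show ?thesis unfolding P_def
      by (induction ps) (auto simp: der_def rep_simps val_simps fps_deriv_taylor deriv_add deriv_mult
          diff_subfield_deriv[OF N])
  qed
  have single: "[(a, u)] \<in> P" "rep [(a, u)] = fps_const a * taylor f D u" "val [(a, u)] = \<chi> a * u"
    if "a \<in> A" "u \<in> N" for a u
    using that by (auto simp: P_def rep_simps val_simps)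
  have valN: "val ps \<in> N" if "ps \<in> P" for ps
    using that \<chi>(2) unfolding P_def
    by (induction ps) (auto simp: val_simps subring_closed[OF Nr] constants_def image_subset_iff)
  show thesis
  proof (rule that[of "rep ` P" \<theta>])
    have "0 \<in> rep ` P" using rep_simps(1) by (intro image_eqI[of _ _ "[]"]) (auto simp: P_def)
    moreover have "1 \<in> rep ` P"
      using single[OF subring_1[OF A] subring_1[OF Nr]] T(2) by (intro image_eqI[of _ _ "[(1, 1)]"]) auto
    moreover have "rep ps + rep qs \<in> rep ` P \<and> rep ps * rep qs \<in> rep ` P" if "ps \<in> P" "qs \<in> P" for ps qs
      using app(1)[of ps qs] appP[OF that] mul[OF that] by (metis imageI)
    moreover have "- rep ps \<in> rep ` P" if "ps \<in> P" for ps
      using neg[OF that] by (metis imageI)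
    ultimately show "is_subring (rep ` P)" unfolding is_subring_def by blast
    have "\<theta> 1 = 1"
      using \<theta>[OF single(1)[OF subring_1[OF A] subring_1[OF Nr]]]
        single(2,3)[OF subring_1[OF A] subring_1[OF Nr]] T(2) hom_on_1[OF A \<chi>(1)] by simp
    moreover have "\<theta> (rep ps + rep qs) = \<theta> (rep ps) + \<theta> (rep qs) \<and> \<theta> (rep ps * rep qs) = \<theta> (rep ps) * \<theta> (rep qs)"
      if "ps \<in> P" "qs \<in> P" for ps qs
      using app[of ps qs] \<theta>[OF appP[OF that]] mul[OF that] \<theta>[of "mul ps qs"] \<theta> that by simp
    ultimately show "hom_on (rep ` P) \<theta>" unfolding hom_on_def by blast
    show "\<theta> ` rep ` P \<subseteq> N" using \<theta> valN by auto
    show "taylor f D u \<in> rep ` P \<and> \<theta> (taylor f D u) = u" if "u \<in> N" for u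
      using imageI[OF single(1)[OF subring_1[OF A] that], of rep] \<theta>[OF single(1)[OF subring_1[OF A] that]]
        single(2,3)[OF subring_1[OF A] that] hom_on_1[OF A \<chi>(1)] by simp
    show "fps_const a \<in> rep ` P \<and> \<theta> (fps_const a) = \<chi> a" if "a \<in> A" for a
      using imageI[OF single(1)[OF that subring_1[OF Nr]], of rep] \<theta>[OF single(1)[OF that subring_1[OF Nr]]]
        single(2,3)[OF that subring_1[OF Nr]] T(2) by simp
    show "fps_deriv s \<in> rep ` P \<and> \<theta> (fps_deriv s) = D (\<theta> s)" if "s \<in> rep ` P" for s
    proof -
      from that obtain ps where ps: "ps \<in> P" "s = rep ps" by auto
      show ?thesis
        using der[OF ps(1)] \<theta>[OF ps(1)] \<theta>[of "der ps"] imageI[of "der ps" P rep] ps(2) by simp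
    qed
  qed
qed

section \<open>Homomorphisms of solution rings\<close>

definition subring_closure :: "'a::comm_ring_1 set \<Rightarrow> 'a set" where
  "subring_closure S = \<Inter>{A. is_subring A \<and> S \<subseteq> A}"

lemma subring_closure_least: "is_subring A \<Longrightarrow> S \<subseteq> A \<Longrightarrow> subring_closure S \<subseteq> A"
  unfolding subring_closure_def by blast

lemma subset_subring_closure: "S \<subseteq> subring_closure S"
  unfolding subring_closure_def by blast

lemma subring_closure_subring: "is_subring (subring_closure S)"
  unfolding subring_closure_def is_subring_def by blast

lemma subring_vimage_Int:
  assumes "is_subring R" "hom_on R f" "is_subring S"
  shows "is_subring {r \<in> R. f r \<in> S}"
  unfolding is_subring_def
  using subring_closed[OF assms(1)] subring_closed[OF assms(3)] hom_on_simps[OF assms(1,2)] by auto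

text \<open>
  Derivatives of order \<open>n\<close> and higher are omitted: for solutions of an equation of order \<open>n\<close> they
  are combinations of the lower ones, so the ring is closed under the derivation (\<open>solution_ring_deriv\<close>).
\<close>
definition solution_ring :: "'a::field_char_0 set \<Rightarrow> ('a \<Rightarrow> 'a) \<Rightarrow> nat \<Rightarrow> (nat \<Rightarrow> 'a) \<Rightarrow> 'a set" where
  "solution_ring K D n y = subring_closure (K \<union> (\<lambda>(i, j). (D ^^ i) (y j)) ` ({..<n} \<times> {..<n}))"

lemma solution_ring_subring: "is_subring (solution_ring K D n y)"
  unfolding solution_ring_def by (rule subring_closure_subring)

lemma solution_ring_base: "K \<subseteq> solution_ring K D n y"
  using subset_subring_closure unfolding solution_ring_def by blast

lemma solution_ring_gen: "i < n \<Longrightarrow> j < n \<Longrightarrow> (D ^^ i) (y j) \<in> solution_ring K D n y"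
  using subset_subring_closure[of "K \<union> (\<lambda>(i, j). (D ^^ i) (y j)) ` ({..<n} \<times> {..<n})"]
  unfolding solution_ring_def by auto

lemma solution_ring_y: "j < n \<Longrightarrow> y j \<in> solution_ring K D n y"
  using solution_ring_gen[of 0 n j D y K] by simp

lemma solution_ring_subset:
  assumes "is_subring A" "K \<subseteq> A" "\<And>i j. i < n \<Longrightarrow> j < n \<Longrightarrow> (D ^^ i) (y j) \<in> A"
  shows "solution_ring K D n y \<subseteq> A"
  unfolding solution_ring_def by (rule subring_closure_least) (use assms in auto)

lemma solution_ring_deriv:
  assumes D: "differential_field D" and K: "diff_subfield D K"
    and a: "equation_over K n a" and y: "\<And>j. j < n \<Longrightarrow> y j \<in> solutions D n a N"
    and r: "r \<in> solution_ring K D n y"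
  shows "D r \<in> solution_ring K D n y"
proof -
  interpret differential_field D by fact
  let ?R = "solution_ring K D n y"
  note R = subring_closed[OF solution_ring_subring[of K D n y]]
  have "is_subring {r \<in> ?R. D r \<in> ?R}"
    unfolding is_subring_def using R by (auto simp: deriv_add deriv_mult deriv_minus)
  then have "?R \<subseteq> {r \<in> ?R. D r \<in> ?R}"
  proof (rule solution_ring_subset)
    show "K \<subseteq> {r \<in> ?R. D r \<in> ?R}"
      using solution_ring_base[of K D n y] diff_subfield_deriv[OF K] by blast
    fix i j assume ij: "i < n" "j < n"
    have "(D ^^ Suc i) (y j) \<in> ?R"
    proof (cases "Suc i = n")
      case True
      have "(D ^^ n) (y j) = - (\<Sum>i<n. a i * (D ^^ i) (y j))"
        using y[OF ij(2)] by (simp add: solutions_def eq_neg_iff_add_eq_0)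
      moreover have "(\<Sum>i<n. a i * (D ^^ i) (y j)) \<in> ?R"
        using a solution_ring_base[of K D n y] solution_ring_gen[OF _ ij(2)]
        by (intro subring_sum[OF solution_ring_subring] R(4)) (auto simp: equation_over_def)
      ultimately show ?thesis using R(5) True by simp
    next
      case False
      then show ?thesis using ij by (intro solution_ring_gen) auto
    qed
    with solution_ring_gen[OF ij] show "(D ^^ i) (y j) \<in> {r \<in> ?R. D r \<in> ?R}" by simp
  qed
  with r show ?thesis by blast
qed

lemma to_ac_hom_on: "hom_on A (to_ac :: 'a::field \<Rightarrow> 'a alg_closure)"
  unfolding hom_on_def by simp

lemma alg_closed_subfield_alg_closure:
  "alg_closed_subfield (UNIV :: 'a::field_char_0 alg_closure set)"
  unfolding alg_closed_subfield_def is_subfield_def using alg_closed_imp_poly_has_root by blast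

lemma inverse_of_matrix_product:
  fixes P Q P' Q' :: "nat \<Rightarrow> nat \<Rightarrow> 'a::comm_ring_1"
  assumes P: "\<And>i k. i < n \<Longrightarrow> k < n \<Longrightarrow> (\<Sum>j<n. P' i j * P j k) = (if i = k then 1 else 0)"
    and Q: "\<And>i k. i < n \<Longrightarrow> k < n \<Longrightarrow> (\<Sum>j<n. Q i j * Q' j k) = (if i = k then 1 else 0)"
    and ik: "i < n" "k < n"
  shows "(\<Sum>j<n. (\<Sum>l<n. P' i l * Q l j) * (\<Sum>l<n. Q' j l * P l k)) = (if i = k then 1 else 0)"
proof -
  have "(\<Sum>j<n. (\<Sum>l<n. P' i l * Q l j) * (\<Sum>m<n. Q' j m * P m k)) =
      (\<Sum>j<n. \<Sum>l<n. \<Sum>m<n. P' i l * (Q l j * Q' j m) * P m k)"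
    by (simp only: sum_product mult.assoc)
  also have "\<dots> = (\<Sum>l<n. \<Sum>m<n. \<Sum>j<n. P' i l * (Q l j * Q' j m) * P m k)"
    by (subst sum.swap, rule sum.cong[OF refl], subst sum.swap) simp
  also have "\<dots> = (\<Sum>l<n. \<Sum>m<n. P' i l * (if l = m then 1 else 0) * P m k)"
    by (intro sum.cong refl) (simp add: sum_distrib_left[symmetric] sum_distrib_right[symmetric] Q)
  also have "\<dots> = (\<Sum>l<n. \<Sum>m<n. if l = m then P' i l * P m k else 0)"
    by (intro sum.cong refl) auto
  also have "\<dots> = (\<Sum>l<n. P' i l * P l k)"
    by (intro sum.cong refl) simp
  finally show ?thesis using P[OF ik] by simp
qed

text \<open>
  The Taylor series argument outlined at the beginning.  The invertibility of the Wronskian matrices is carried along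
  by adjoining the entries of inverse matrices to the rings on which \<open>\<psi>\<close> and \<open>\<chi>\<close> are defined; in
  this way \<open>c\<close> and \<open>c'\<close> come out as matrices of constants that express \<open>h \<circ> y\<close> and \<open>z\<close> through each other.
  The hypothesis that the constants of \<open>N'\<close> come from \<open>K\<close> serves to write them as values of \<open>\<sigma>\<close>.
\<close>
lemma solution_ring_hom:
  fixes D :: "'a::field_char_0 \<Rightarrow> 'a" and D' :: "'b::field_char_0 \<Rightarrow> 'b"
  assumes D: "differential_field D" and D': "differential_field D'"
    and N: "diff_subfield D N" and N': "diff_subfield D' N'"
    and K: "diff_subfield D K" "K \<subseteq> N"
    and \<sigma>: "hom_on K \<sigma>" "\<sigma> ` K \<subseteq> N'" "\<And>x. x \<in> K \<Longrightarrow> \<sigma> (D x) = D' (\<sigma> x)"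
    and a: "equation_over K n a"
    and y: "\<And>j. j < n \<Longrightarrow> y j \<in> solutions D n a N" "indep_over (constants D N) {..<n} y"
    and z: "\<And>j. j < n \<Longrightarrow> z j \<in> solutions D' n (\<lambda>i. \<sigma> (a i)) N'" "indep_over (constants D' N') {..<n} z"
    and C: "alg_closed_subfield (constants D' N')" "constants D' N' \<subseteq> \<sigma> ` constants D K"
  obtains h c c' where "hom_on (solution_ring K D n y) h"
    "h ` solution_ring K D n y \<subseteq> solution_ring (\<sigma> ` K) D' n z"
    "\<And>x. x \<in> K \<Longrightarrow> h x = \<sigma> x"
    "\<And>r. r \<in> solution_ring K D n y \<Longrightarrow> h (D r) = D' (h r)"
    "\<And>i j. i < n \<Longrightarrow> j < n \<Longrightarrow> c i j \<in> constants D K \<and> c' i j \<in> constants D K"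
    "\<And>j. j < n \<Longrightarrow> h (y j) = (\<Sum>i<n. z i * \<sigma> (c i j))"
    "\<And>j. j < n \<Longrightarrow> z j = (\<Sum>i<n. h (y i) * \<sigma> (c' i j))"
proof -
  interpret D: differential_field D by fact
  interpret D': differential_field D' by fact
  define R where "R = solution_ring K D n y"
  define \<tau> where "\<tau> = taylor to_ac D'"
  define C' where "C' = constants D' N'"
  have R: "is_subring R" "K \<subseteq> R" "\<And>i j. i < n \<Longrightarrow> j < n \<Longrightarrow> (D ^^ i) (y j) \<in> R" "\<And>j. j < n \<Longrightarrow> y j \<in> R"
    unfolding R_def by (auto intro: solution_ring_subring solution_ring_gen solution_ring_y
        subsetD[OF solution_ring_base])
  have RD: "D r \<in> R" if "r \<in> R" for r
    using solution_ring_deriv[OF D K(1) a, of y N] y(1) that unfolding R_def by blast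
  note Nr = diff_subfield_subring[OF N] and N'r = diff_subfield_subring[OF N']
  note Kr = diff_subfield_subring[OF K(1)]
  have aN: "equation_over N n a" "equation_over R n a" "equation_over N' n (\<lambda>i. \<sigma> (a i))"
    using a K(2) R(2) \<sigma>(2) unfolding equation_over_def by auto
  \<comment> \<open>\<open>\<psi>\<close> is also defined on the inverse \<open>Y'\<close> of the Wronskian matrix of \<open>y\<close>, so the image of that
    matrix is invertible\<close>
  obtain Y' where Y': "\<And>i k. i < n \<Longrightarrow> k < n \<Longrightarrow> (\<Sum>j<n. (D ^^ i) (y j) * Y' j k) = (if i = k then 1 else 0)"
    by (rule injective_matrix_has_inverse[of n "\<lambda>i j. (D ^^ i) (y j)"])
      (use wronskian_injective[OF D N _ aN(1) y, of "\<lambda>x. x"] in \<open>auto simp: hom_on_def\<close>)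
  have "hom_on K (to_ac \<circ> \<sigma>)" using hom_on_comp[OF \<sigma>(1,2) to_ac_hom_on] .
  then obtain R1 \<psi> where R1: "is_subring R1" "K \<subseteq> R1"
    "(\<lambda>(i, j). (D ^^ i) (y j)) ` ({..<n} \<times> {..<n}) \<union> (\<lambda>(i, j). Y' i j) ` ({..<n} \<times> {..<n}) \<subseteq> R1"
    and \<psi>: "hom_on R1 \<psi>" "\<And>x. x \<in> K \<Longrightarrow> \<psi> x = to_ac (\<sigma> x)"
    by (rule hom_extends_from_subfield[OF diff_subfield_subfield[OF K(1)] _ _ alg_closed_subfield_alg_closure,
      of "to_ac \<circ> \<sigma>" "(\<lambda>(i, j). (D ^^ i) (y j)) ` ({..<n} \<times> {..<n}) \<union> (\<lambda>(i, j). Y' i j) ` ({..<n} \<times> {..<n})"]) auto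
  have "R \<subseteq> R1" unfolding R_def using R1 by (intro solution_ring_subset) auto
  then have \<psi>R: "hom_on R \<psi>" using \<psi>(1) hom_on_subset by blast
  have \<psi>Y: "(\<Sum>j<n. \<psi> ((D ^^ i) (y j)) * \<psi> (Y' j k)) = (if i = k then 1 else 0)"
    if "i < n" "k < n" for i k
  proof -
    have in1: "(D ^^ i) (y j) \<in> R1" "Y' j k \<in> R1" if "j < n" for j
      using R1(3) that \<open>i < n\<close> \<open>k < n\<close> by auto
    have "(\<Sum>j<n. \<psi> ((D ^^ i) (y j)) * \<psi> (Y' j k)) = \<psi> (\<Sum>j<n. (D ^^ i) (y j) * Y' j k)"
      using in1 by (subst hom_on_sum[OF R1(1) \<psi>(1)])
        (auto simp: hom_on_mult[OF R1(1) \<psi>(1)] subring_mult[OF R1(1)])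
    then show ?thesis using Y'[OF that] hom_on_simps(1,2)[OF R1(1) \<psi>(1)] by simp
  qed
  \<comment> \<open>the twist of \<open>\<psi>\<close>, which on \<open>K\<close> agrees with the Taylor series in \<open>N'\<close>\<close>
  define \<Psi> where "\<Psi> = taylor \<psi> D"
  have \<Psi>: "hom_on R \<Psi>" unfolding \<Psi>_def using D R(1) RD \<psi>R by (rule taylor_hom_on)
  have \<Psi>K: "\<Psi> x = \<tau> (\<sigma> x)" if x: "x \<in> K" for x
  proof -
    have "(D ^^ i) x \<in> K \<and> \<sigma> ((D ^^ i) x) = (D' ^^ i) (\<sigma> x)" for i
      by (induction i) (auto simp: x \<sigma>(3) diff_subfield_deriv[OF K(1)])
    then show ?thesis unfolding \<Psi>_def \<tau>_def taylor_def using \<psi>(2) by (intro fps_ext) simp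
  qed
  have yR: "y j \<in> solutions D n a R" if "j < n" for j
    using y(1)[OF that] R(4)[OF that] by (simp add: solutions_def)
  \<comment> \<open>\<open>x\<close> is chosen such that the combinations of the Taylor series of the \<open>z i\<close> satisfy the initial
    conditions of the twisted \<open>y j\<close>; \<open>x'\<close> is its inverse\<close>
  obtain Z' where Z': "\<And>i k. i < n \<Longrightarrow> k < n \<Longrightarrow> (\<Sum>j<n. to_ac ((D' ^^ i) (z j)) * Z' j k) = (if i = k then 1 else 0)"
    "\<And>i k. i < n \<Longrightarrow> k < n \<Longrightarrow> (\<Sum>j<n. Z' i j * to_ac ((D' ^^ j) (z k))) = (if i = k then 1 else 0)"
    by (rule injective_matrix_has_inverse[of n "\<lambda>i j. to_ac ((D' ^^ i) (z j))"])
      (use wronskian_injective[OF D' N' to_ac_hom_on aN(3) z] in auto)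
  define x where "x i j = (\<Sum>l<n. Z' i l * \<psi> ((D ^^ l) (y j)))" for i j
  define x' where "x' i j = (\<Sum>l<n. \<psi> (Y' i l) * to_ac ((D' ^^ l) (z j)))" for i j
  have xx': "(\<Sum>j<n. x i j * x' j k) = (if i = k then 1 else 0)" if "i < n" "k < n" for i k
    unfolding x_def x'_def using Z'(2) \<psi>Y that by (rule inverse_of_matrix_product)
  have \<Psi>y: "\<Psi> (y j) = (\<Sum>i<n. fps_const (x i j) * \<tau> (z i))" if j: "j < n" for j
  proof -
    let ?b = "\<lambda>i. \<tau> (\<sigma> (a i))"
    have "fps_ode n (\<lambda>i. \<Psi> (a i)) (\<Psi> (y j))"
      unfolding \<Psi>_def by (rule taylor_fps_ode[OF D R(1) RD \<psi>R aN(2) yR[OF j]])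
    then have "fps_ode n ?b (\<Psi> (y j))"
      using a by (subst fps_ode_cong[of n _ "\<lambda>i. \<Psi> (a i)"]) (auto simp: \<Psi>K equation_over_def)
    moreover have "fps_ode n ?b (\<Sum>i<n. fps_const (x i j) * \<tau> (z i))"
      unfolding \<tau>_def
      by (intro fps_ode_linear taylor_fps_ode[OF D' N'r diff_subfield_deriv[OF N'] to_ac_hom_on aN(3)])
        (auto simp: z)
    ultimately have ode: "fps_ode n ?b (\<Psi> (y j) - (\<Sum>i<n. fps_const (x i j) * \<tau> (z i)))"
      by (rule fps_ode_diff)
    have "(\<Psi> (y j) - (\<Sum>i<n. fps_const (x i j) * \<tau> (z i))) $ l = 0" if l: "l < n" for l
    proof -
      have "(\<Sum>i<n. to_ac ((D' ^^ l) (z i)) * x i j) = (\<Sum>i<n. \<Sum>m<n. to_ac ((D' ^^ l) (z i)) * Z' i m * \<psi> ((D ^^ m) (y j)))"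
        by (simp add: x_def sum_distrib_left mult.assoc)
      also have "\<dots> = (\<Sum>m<n. (\<Sum>i<n. to_ac ((D' ^^ l) (z i)) * Z' i m) * \<psi> ((D ^^ m) (y j)))"
        by (subst sum.swap) (simp add: sum_distrib_right)
      also have "\<dots> = (\<Sum>m<n. if l = m then \<psi> ((D ^^ m) (y j)) else 0)"
        using l by (intro sum.cong refl) (simp add: Z'(1))
      also have "\<dots> = \<psi> ((D ^^ l) (y j))" using l by simp
      finally have "(\<Sum>i<n. x i j * to_ac ((D' ^^ l) (z i))) = \<psi> ((D ^^ l) (y j))"
        by (simp add: mult.commute)
      then show ?thesis
        by (simp add: \<Psi>_def \<tau>_def fps_sum_nth taylor_nth sum_divide_distrib[symmetric])
    qed
    from fps_ode_unique[OF ode this] show ?thesis by simp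
  qed
  \<comment> \<open>\<open>\<chi>\<close> is the identity on the constants of \<open>N'\<close>, which sit in the algebraic closure as \<open>to_ac ` C'\<close>\<close>
  have C'f: "is_subfield C'" using C(1) unfolding alg_closed_subfield_def C'_def by simp
  note C'r = subfield_imp_subring[OF C'f]
  have "is_subfield (to_ac ` C')"
    using C'f unfolding is_subfield_def
    by (auto simp flip: to_ac_add to_ac_mult to_ac_minus to_ac_inverse to_ac_0 to_ac_1)
  moreover have "hom_on (to_ac ` C') of_ac"
    unfolding hom_on_def by (auto simp flip: to_ac_add to_ac_mult to_ac_1)
  ultimately obtain A \<chi> where A: "is_subring A" "to_ac ` C' \<subseteq> A"
      "(\<lambda>(i, j). x i j) ` ({..<n} \<times> {..<n}) \<union> (\<lambda>(i, j). x' i j) ` ({..<n} \<times> {..<n}) \<subseteq> A"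
    and \<chi>: "hom_on A \<chi>" "\<chi> ` A \<subseteq> C'" "\<And>c. c \<in> to_ac ` C' \<Longrightarrow> \<chi> c = of_ac c"
    by (rule hom_extends_from_subfield[of "to_ac ` C'" of_ac C'
      "(\<lambda>(i, j). x i j) ` ({..<n} \<times> {..<n}) \<union> (\<lambda>(i, j). x' i j) ` ({..<n} \<times> {..<n})"])
      (use C(1) in \<open>auto simp: C'_def\<close>)
  have xA: "x i j \<in> A" "x' i j \<in> A" if "i < n" "j < n" for i j using A(3) that by auto
  obtain S \<theta> where S: "is_subring S" and \<theta>: "hom_on S \<theta>" "\<theta> ` S \<subseteq> N'"
    "\<And>u. u \<in> N' \<Longrightarrow> \<tau> u \<in> S \<and> \<theta> (\<tau> u) = u"
    "\<And>a. a \<in> A \<Longrightarrow> fps_const a \<in> S \<and> \<theta> (fps_const a) = \<chi> a"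
    "\<And>s. s \<in> S \<Longrightarrow> fps_deriv s \<in> S \<and> \<theta> (fps_deriv s) = D' (\<theta> s)"
    unfolding \<tau>_def
    by (rule specialization_of_taylor_compositum[OF D' N' to_ac_hom_on A(1) \<chi>(1)])
      (use A \<chi> in \<open>auto simp: C'_def\<close>)
  have zN: "z j \<in> N'" if "j < n" for j using z(1)[OF that] by (simp add: solutions_def)
  define h where "h r = \<theta> (\<Psi> r)" for r
  have \<Psi>yS: "\<Psi> (y j) \<in> S" if "j < n" for j
    unfolding \<Psi>y[OF that] using \<theta>(3,4) xA zN that
    by (intro subring_sum[OF S] subring_mult[OF S]) auto
  have \<Psi>D: "\<Psi> ((D ^^ i) r) = (fps_deriv ^^ i) (\<Psi> r)" for i r
    unfolding \<Psi>_def by (simp add: funpow_fps_deriv_taylor)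
  have "R \<subseteq> {r \<in> R. \<Psi> r \<in> S}"
    unfolding R_def
  proof (rule solution_ring_subset)
    show "is_subring {r \<in> solution_ring K D n y. \<Psi> r \<in> S}"
      using subring_vimage_Int[OF R(1) \<Psi> S] unfolding R_def .
    show "K \<subseteq> {r \<in> solution_ring K D n y. \<Psi> r \<in> S}"
      using R(2) \<Psi>K \<theta>(3) \<sigma>(2) unfolding R_def by auto
    fix i j assume ij: "i < n" "j < n"
    have "(fps_deriv ^^ i) (\<Psi> (y j)) \<in> S" using \<Psi>yS[OF ij(2)] \<theta>(5) by (induction i) auto
    then show "(D ^^ i) (y j) \<in> {r \<in> solution_ring K D n y. \<Psi> r \<in> S}"
      using R(3)[OF ij] unfolding R_def by (simp add: \<Psi>D)
  qed
  then have \<Psi>S: "\<Psi> ` R \<subseteq> S" by auto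
  have h: "hom_on R h" using hom_on_comp[OF \<Psi> \<Psi>S \<theta>(1)] unfolding h_def comp_def .
  have hK: "h u = \<sigma> u" if "u \<in> K" for u
    using that \<sigma>(2) \<theta>(3) unfolding h_def by (simp add: \<Psi>K image_subset_iff)
  have hD: "h (D r) = D' (h r)" if "r \<in> R" for r
    using \<theta>(5)[of "\<Psi> r"] that \<Psi>S \<Psi>D[of 1 r] unfolding h_def by (simp add: image_subset_iff)
  define pre where "pre e = (SOME c. c \<in> constants D K \<and> \<sigma> c = e)" for e
  have pre: "pre e \<in> constants D K" "\<sigma> (pre e) = e" if "e \<in> C'" for e
    using someI_ex[of "\<lambda>c. c \<in> constants D K \<and> \<sigma> c = e"] that C(2) unfolding pre_def C'_def by auto
  have \<chi>C: "\<chi> (x i j) \<in> C'" "\<chi> (x' i j) \<in> C'" if "i < n" "j < n" for i j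
    using \<chi>(2) xA[OF that] by auto
  have hy: "h (y j) = (\<Sum>i<n. z i * \<chi> (x i j))" if "j < n" for j
    unfolding h_def \<Psi>y[OF that] using \<theta>(3,4) xA zN that
    by (subst hom_on_sum[OF S \<theta>(1)])
      (auto simp: hom_on_mult[OF S \<theta>(1)] subring_mult[OF S] mult.commute)
  have zh: "z j = (\<Sum>i<n. h (y i) * \<chi> (x' i j))" if j: "j < n" for j
  proof -
    have \<chi>x: "(\<Sum>i<n. \<chi> (x l i) * \<chi> (x' i j)) = (if l = j then 1 else 0)" if "l < n" for l
    proof -
      have "(\<Sum>i<n. \<chi> (x l i) * \<chi> (x' i j)) = \<chi> (\<Sum>i<n. x l i * x' i j)"
        using xA that j by (subst hom_on_sum[OF A(1) \<chi>(1)])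
          (auto simp: hom_on_mult[OF A(1) \<chi>(1)] subring_mult[OF A(1)])
      then show ?thesis using xx'[OF that j] hom_on_simps(1,2)[OF A(1) \<chi>(1)] by simp
    qed
    have "(\<Sum>i<n. h (y i) * \<chi> (x' i j)) = (\<Sum>i<n. \<Sum>l<n. z l * (\<chi> (x l i) * \<chi> (x' i j)))"
      by (simp add: hy sum_distrib_right mult.assoc)
    also have "\<dots> = (\<Sum>l<n. z l * (\<Sum>i<n. \<chi> (x l i) * \<chi> (x' i j)))"
      by (subst sum.swap) (simp add: sum_distrib_left)
    also have "\<dots> = (\<Sum>l<n. if l = j then z l else 0)"
      by (intro sum.cong refl) (simp add: \<chi>x)
    also have "\<dots> = z j" using j by simp
    finally show ?thesis by simp
  qed
  show thesis
  proof (rule that[of h "\<lambda>i j. pre (\<chi> (x i j))" "\<lambda>i j. pre (\<chi> (x' i j))"])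
    show "hom_on (solution_ring K D n y) h" using h unfolding R_def .
    show "h u = \<sigma> u" if "u \<in> K" for u by (rule hK[OF that])
    show "h (D r) = D' (h r)" if "r \<in> solution_ring K D n y" for r using hD that unfolding R_def .
    show "pre (\<chi> (x i j)) \<in> constants D K \<and> pre (\<chi> (x' i j)) \<in> constants D K" if "i < n" "j < n" for i j
      using pre \<chi>C that by blast
    show hy': "h (y j) = (\<Sum>i<n. z i * \<sigma> (pre (\<chi> (x i j))))" if "j < n" for j
      using hy that pre \<chi>C by simp
    show "z j = (\<Sum>i<n. h (y i) * \<sigma> (pre (\<chi> (x' i j))))" if "j < n" for j
      using zh[OF that] pre \<chi>C that by simp
    let ?R' = "solution_ring (\<sigma> ` K) D' n z"
    have "R \<subseteq> {r \<in> R. h r \<in> ?R'}"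
      unfolding R_def
    proof (rule solution_ring_subset)
      show "is_subring {r \<in> solution_ring K D n y. h r \<in> ?R'}"
        using subring_vimage_Int[OF R(1) h solution_ring_subring] unfolding R_def .
      show "K \<subseteq> {r \<in> solution_ring K D n y. h r \<in> ?R'}"
        using R(2) hK solution_ring_base[of "\<sigma> ` K" D' n z] unfolding R_def by auto
      fix i j assume ij: "i < n" "j < n"
      have "h ((D ^^ i) (y j)) = (D' ^^ i) (h (y j))"
      proof (induction i)
        case (Suc i)
        have "(D ^^ i) (y j) \<in> R" for i using R(4)[OF ij(2)] RD by (induction i) auto
        with Suc hD show ?case by simp
      qed simp
      also have "\<dots> = (\<Sum>l<n. (D' ^^ i) (\<chi> (x l j) * z l))"
        by (simp add: hy[OF ij(2)] D'.funpow_deriv_sum mult.commute)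
      also have "\<dots> = (\<Sum>l<n. \<chi> (x l j) * (D' ^^ i) (z l))"
        using \<chi>C ij by (intro sum.cong refl D'.funpow_deriv_const_mult) (auto simp: C'_def constants_def)
      also have "\<dots> \<in> ?R'"
      proof (intro subring_sum[OF solution_ring_subring] subring_mult[OF solution_ring_subring])
        fix l assume l: "l \<in> {..<n}"
        have "\<chi> (x l j) = \<sigma> (pre (\<chi> (x l j)))" "pre (\<chi> (x l j)) \<in> K"
          using pre \<chi>C[of l j] l ij by (auto simp: constants_def)
        then show "\<chi> (x l j) \<in> ?R'" using solution_ring_base[of "\<sigma> ` K" D' n z] by (metis imageI subsetD)
        show "(D' ^^ i) (z l) \<in> ?R'" using l ij by (intro solution_ring_gen) auto
      qed
      finally show "(D ^^ i) (y j) \<in> {r \<in> solution_ring K D n y. h r \<in> ?R'}"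
        using R(3)[OF ij] unfolding R_def by simp
    qed
    then show "h ` solution_ring K D n y \<subseteq> ?R'" unfolding R_def by auto
  qed
qed

section \<open>Injectivity of surjective endomorphisms\<close>

text \<open>
  Linear combinations over a ring \<open>K\<close> inside the type.  The inductive form gives the images of
  spans under homomorphisms by rule induction, whether or not the homomorphism is injective on \<open>B\<close>.
\<close>
inductive_set lin_span :: "'a::comm_ring_1 set \<Rightarrow> 'a set \<Rightarrow> 'a set" for K B where
  zero: "0 \<in> lin_span K B"
| step: "c \<in> K \<Longrightarrow> b \<in> B \<Longrightarrow> u \<in> lin_span K B \<Longrightarrow> c * b + u \<in> lin_span K B"

lemma lin_span_add: "u \<in> lin_span K B \<Longrightarrow> v \<in> lin_span K B \<Longrightarrow> u + v \<in> lin_span K B"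
  by (induction u rule: lin_span.induct) (auto simp: add.assoc intro: lin_span.intros)

lemma lin_span_scale: "is_subring K \<Longrightarrow> k \<in> K \<Longrightarrow> u \<in> lin_span K B \<Longrightarrow> k * u \<in> lin_span K B"
  by (erule lin_span.induct)
    (auto simp: distrib_left mult.assoc[symmetric] intro!: lin_span.intros subring_mult)

lemma lin_span_gen: "is_subring K \<Longrightarrow> b \<in> B \<Longrightarrow> b \<in> lin_span K B"
  using lin_span.step[of 1 K b B 0] by (simp add: subring_1 lin_span.zero)

lemma lin_span_subset:
  assumes "is_subring K" "B \<subseteq> lin_span K B'"
  shows "lin_span K B \<subseteq> lin_span K B'"
proof
  fix u assume "u \<in> lin_span K B"
  then show "u \<in> lin_span K B'"
    by induction (use assms in \<open>auto intro!: lin_span.zero lin_span_add lin_span_scale\<close>)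
qed

lemma lin_span_mono: "B \<subseteq> B' \<Longrightarrow> lin_span K B \<subseteq> lin_span K B'"
proof
  fix u assume B: "B \<subseteq> B'" and "u \<in> lin_span K B"
  from this(2) show "u \<in> lin_span K B'"
    by induction (use B in \<open>auto intro!: lin_span.intros\<close>)
qed

lemma lin_span_sum:
  "(\<And>i. i \<in> I \<Longrightarrow> f i \<in> lin_span K B) \<Longrightarrow> sum f I \<in> lin_span K B"
  by (induction I rule: infinite_finite_induct) (auto intro: lin_span.zero lin_span_add)

lemma lin_span_in_subring:
  assumes "is_subring R" "K \<subseteq> R" "B \<subseteq> R" "u \<in> lin_span K B"
  shows "u \<in> R"
  using assms(4)
proof induction
  case (step c b u)
  then show ?case
    using assms(2,3) by (intro subring_add[OF assms(1)] subring_mult[OF assms(1)]) auto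
qed (rule subring_0[OF assms(1)])

lemma lin_span_mult:
  assumes K: "is_subring K" and u: "u \<in> lin_span K B" and v: "v \<in> lin_span K W"
  shows "u * v \<in> lin_span K ((\<lambda>(b, w). b * w) ` (B \<times> W))"
  using u
proof induction
  case (step c b u)
  have "b * v \<in> lin_span K ((\<lambda>(b, w). b * w) ` (B \<times> W))"
    using v
  proof induction
    case (step d w v)
    then have "d * (b * w) + b * v \<in> lin_span K ((\<lambda>(b, w). b * w) ` (B \<times> W))"
      using \<open>b \<in> B\<close> by (intro lin_span.step) auto
    then show ?case by (simp add: algebra_simps)
  qed (simp add: lin_span.zero)
  then have "c * (b * v) + u * v \<in> lin_span K ((\<lambda>(b, w). b * w) ` (B \<times> W))"
    by (intro lin_span_add lin_span_scale[OF K step(1)] step.IH)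
  then show ?case by (simp add: algebra_simps)
qed (simp add: lin_span.zero)

lemma lin_span_nonzero_cases:
  assumes K: "is_subring K" and B: "finite B" and u: "u \<in> lin_span K B" "u \<noteq> 0"
  obtains c b v where "c \<in> K" "c \<noteq> 0" "b \<in> B" "v \<in> lin_span K (B - {b})" "u = c * b + v"
proof -
  have "\<exists>c\<in>K. \<exists>b\<in>B. c \<noteq> 0 \<and> (\<exists>v\<in>lin_span K (B - {b}). u = c * b + v)"
    using B u
  proof (induction B rule: finite_induct)
    case empty
    from empty(1) have "u = 0" by cases auto
    with empty show ?case by simp
  next
    case (insert b B)
    have "\<exists>c\<in>K. \<exists>v\<in>lin_span K B. w = c * b + v" if "w \<in> lin_span K (insert b B)" for w
      using that
    proof induction
      case zero
      show ?case using subring_0[OF K] lin_span.zero by (intro bexI[of _ 0]) auto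
    next
      case (step d x w)
      then obtain c v where cv: "c \<in> K" "v \<in> lin_span K B" "w = c * b + v" by blast
      show ?case
      proof (cases "x = b")
        case True
        then show ?thesis using cv step subring_add[OF K]
          by (intro bexI[of _ "d + c"] bexI[of _ v]) (auto simp: algebra_simps)
      next
        case False
        then have "d * x + v \<in> lin_span K B" using cv step by (auto intro: lin_span.step)
        moreover have "d * x + w = c * b + (d * x + v)" using cv(3) by (simp add: algebra_simps)
        ultimately show ?thesis using cv(1) by blast
      qed
    qed
    from this[OF insert.prems(1)] obtain c v where cv: "c \<in> K" "v \<in> lin_span K B" "u = c * b + v" by blast
    show ?case
    proof (cases "c = 0")
      case True
      with cv insert.prems obtain c' b' v' where *: "c' \<in> K" "b' \<in> B" "c' \<noteq> 0"
        "v' \<in> lin_span K (B - {b'})" "u = c' * b' + v'"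
        using insert.IH by auto
      have "v' \<in> lin_span K (insert b B - {b'})"
        using lin_span_mono[of "B - {b'}" "insert b B - {b'}" K] *(4) by blast
      with * show ?thesis by blast
    next
      case False
      then show ?thesis using cv insert.hyps by (intro bexI[of _ c] bexI[of _ b]) auto
    qed
  qed
  with that show thesis by blast
qed

text \<open>
  Choose a generating set \<open>A\<close> with the least number of elements.  If \<open>r \<noteq> 0\<close> lay in the kernel, the
  image of some \<open>b \<in> A\<close> would be a combination of the images of the others; these would generate
  the image, which is everything, contradicting the choice of \<open>A\<close>.
\<close>
lemma surjective_endo_of_lin_span_injective:
  fixes K :: "'a::field set"
  assumes K: "is_subfield K" and R: "is_subring R" "K \<subseteq> R" and \<theta>: "hom_on R \<theta>" "\<And>x. x \<in> K \<Longrightarrow> \<theta> x = x"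
    and B: "finite B" "B \<subseteq> R" and into: "\<theta> ` lin_span K B \<subseteq> lin_span K B"
    and onto: "lin_span K B \<subseteq> \<theta> ` lin_span K B"
    and r: "r \<in> lin_span K B" "\<theta> r = 0"
  shows "r = 0"
proof (rule ccontr)
  assume "r \<noteq> 0"
  note Kr = subfield_imp_subring[OF K]
  define P where "P A \<longleftrightarrow> finite A \<and> lin_span K A = lin_span K B" for A
  define A where "A = arg_min card P"
  have "P B" using B by (simp add: P_def)
  from arg_min_nat_lemma[of P, OF this, of card]
  have A: "finite A" "lin_span K A = lin_span K B" and min: "\<And>A'. P A' \<Longrightarrow> card A \<le> card A'"
    unfolding A_def[symmetric] by (auto simp: P_def)
  have MR: "lin_span K A \<subseteq> R"
    using lin_span_in_subring[OF R B(2)] A(2) by blast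
  have gen: "b \<in> U \<Longrightarrow> b \<in> lin_span K U" for b U by (rule lin_span_gen[OF Kr])
  have AR: "A \<subseteq> R" using gen MR by (meson subsetD subsetI)
  obtain c b v where cb: "c \<in> K" "c \<noteq> 0" "b \<in> A" "v \<in> lin_span K (A - {b})" "r = c * b + v"
    by (rule lin_span_nonzero_cases[OF Kr A(1), of r]) (use r(1) A(2) \<open>r \<noteq> 0\<close> in auto)
  define A' where "A' = \<theta> ` (A - {b})"
  have img: "\<theta> u \<in> lin_span K (\<theta> ` U)" if "u \<in> lin_span K U" "U \<subseteq> R" for u U
    using that(1)
  proof induction
    case zero
    then show ?case by (simp add: hom_on_0[OF R(1) \<theta>(1)] lin_span.zero)
  next
    case (step d x u)
    have "\<theta> (d * x + u) = d * \<theta> x + \<theta> u"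
      using step that(2) R lin_span_in_subring[OF R that(2)]
      by (simp add: hom_on_simps[OF R(1) \<theta>(1)] subring_closed[OF R(1)] \<theta>(2) subset_iff)
    with step show ?case by (auto intro: lin_span.step)
  qed
  have "\<theta> r = c * \<theta> b + \<theta> v"
    using cb AR R lin_span_in_subring[OF R, of "A - {b}" v]
    by (auto simp: hom_on_simps[OF R(1) \<theta>(1)] subring_closed[OF R(1)] \<theta>(2) subset_iff)
  then have "c * \<theta> b = - \<theta> v" using r(2) by (simp add: eq_neg_iff_add_eq_0)
  moreover have "\<theta> b = inverse c * (c * \<theta> b)" using cb(2) by simp
  ultimately have "\<theta> b = (- inverse c) * \<theta> v" by simp
  moreover have "\<theta> v \<in> lin_span K A'" unfolding A'_def using cb(4) AR by (intro img) auto
  moreover have "- inverse c \<in> K" using K cb(1) unfolding is_subfield_def by auto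
  ultimately have \<theta>b: "\<theta> b \<in> lin_span K A'" using lin_span_scale[OF Kr] by metis
  have "\<theta> ` A \<subseteq> lin_span K A'"
  proof
    fix x assume "x \<in> \<theta> ` A"
    then have "x = \<theta> b \<or> x \<in> A'" unfolding A'_def by blast
    then show "x \<in> lin_span K A'" using \<theta>b gen by auto
  qed
  from lin_span_subset[OF Kr this] have "lin_span K B \<subseteq> lin_span K A'"
    using onto img[of _ A] AR A(2) by (auto simp: subset_iff image_iff)
  moreover have "lin_span K A' \<subseteq> lin_span K B"
  proof (rule lin_span_subset[OF Kr])
    show "A' \<subseteq> lin_span K B"
      unfolding A'_def using into gen[of _ A] A(2) by (auto simp: image_subset_iff)
  qed
  ultimately have "P A'" using A(1) by (auto simp: P_def A'_def)
  have "card A' \<le> card (A - {b})" unfolding A'_def using A(1) by (intro card_image_le) auto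
  also have "\<dots> < card A" using A(1) cb(3) by (rule card_Diff1_less)
  finally show False using min[OF \<open>P A'\<close>] by simp
qed

text \<open>
  The endomorphism preserves the filtration of \<open>R\<close> by the spans of products of \<open>d\<close> elements of \<open>W\<close>,
  and surjectivity on the span of \<open>W\<close> passes to products, so the previous lemma applies in each degree.
  The filtration is increasing because \<open>1 \<in> W\<close>.
\<close>
lemma surjective_endo_injective:
  fixes K :: "'a::field set"
  assumes K: "is_subfield K" and W: "finite W" "1 \<in> W" and R: "R = subring_closure (K \<union> W)"
    and \<theta>: "hom_on R \<theta>" "\<And>x. x \<in> K \<Longrightarrow> \<theta> x = x"
    and into: "\<theta> ` W \<subseteq> lin_span K W" and onto: "W \<subseteq> \<theta> ` lin_span K W"
    and r: "r \<in> R" "\<theta> r = 0"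
  shows "r = 0"
proof -
  note Kr = subfield_imp_subring[OF K]
  have Rr: "is_subring R" and KR: "K \<subseteq> R" and WR: "W \<subseteq> R"
    using subring_closure_subring subset_subring_closure[of "K \<union> W"] unfolding R by auto
  \<comment> \<open>\<open>B d\<close> is the set of products of \<open>d\<close> elements of \<open>W\<close>\<close>
  define B where "B d = ((\<lambda>B. (\<lambda>(b, w). b * w) ` (B \<times> W)) ^^ d) {1}" for d
  have B0: "B 0 = {1}" and BS: "B (Suc d) = (\<lambda>(b, w). b * w) ` (B d \<times> W)" for d
    by (simp_all add: B_def)
  have fin: "finite (B d)" and BR: "B d \<subseteq> R" for d
    by (induction d) (use W WR in \<open>auto simp: B0 BS subset_iff intro!: subring_1[OF Rr] subring_mult[OF Rr]\<close>)
  have mono: "B d \<subseteq> B e" if "d \<le> e" for d e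
    using that
  proof (induction e rule: dec_induct)
    case (step e)
    have "B e \<subseteq> B (Suc e)"
    proof
      fix b assume "b \<in> B e"
      then show "b \<in> B (Suc e)" unfolding BS using W(2) by (intro image_eqI[of _ _ "(b, 1)"]) auto
    qed
    with step show ?case by blast
  qed simp
  have mult: "u * v \<in> lin_span K (B (d + e))" if "u \<in> lin_span K (B d)" "v \<in> lin_span K (B e)" for u v d e
  proof -
    have "b * b' \<in> B (d + e)" if "b \<in> B d" "b' \<in> B e" for b b'
      using that(2)
    proof (induction e arbitrary: b')
      case (Suc e)
      then obtain b'' w where "b' = b'' * w" "b'' \<in> B e" "w \<in> W" unfolding BS by auto
      with Suc.IH[of b''] show ?case unfolding add_Suc_right BS
        by (intro image_eqI[of _ _ "(b * b'', w)"]) auto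
    qed (use that in \<open>simp add: B0\<close>)
    then have "(\<lambda>(b, w). b * w) ` (B d \<times> B e) \<subseteq> B (d + e)" by auto
    from subsetD[OF lin_span_mono[OF this] lin_span_mult[OF Kr that]] show ?thesis .
  qed
  have "is_subring (\<Union>d. lin_span K (B d))"
    unfolding is_subring_def
  proof (intro conjI ballI)
    show "0 \<in> (\<Union>d. lin_span K (B d))" by (auto intro: lin_span.zero)
    have "1 \<in> lin_span K (B 0)" by (rule lin_span_gen[OF Kr]) (simp add: B0)
    then show "1 \<in> (\<Union>d. lin_span K (B d))" by blast
    fix u assume "u \<in> (\<Union>d. lin_span K (B d))"
    then obtain d where u: "u \<in> lin_span K (B d)" by blast
    show "- u \<in> (\<Union>d. lin_span K (B d))"
      using lin_span_scale[OF Kr subring_minus[OF Kr subring_1[OF Kr]] u] by auto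
    fix v assume "v \<in> (\<Union>d. lin_span K (B d))"
    then obtain e where v: "v \<in> lin_span K (B e)" by blast
    show "u * v \<in> (\<Union>d. lin_span K (B d))" using mult[OF u v] by blast
    have "u \<in> lin_span K (B (d + e))" "v \<in> lin_span K (B (d + e))"
      using u v lin_span_mono[OF mono] by (meson le_add1 le_add2 subsetD)+
    then show "u + v \<in> (\<Union>d. lin_span K (B d))" using lin_span_add by blast
  qed
  moreover have "K \<subseteq> (\<Union>d. lin_span K (B d))"
  proof
    fix k assume "k \<in> K"
    then have "k * 1 + 0 \<in> lin_span K (B 0)" by (intro lin_span.intros) (auto simp: B0)
    then show "k \<in> (\<Union>d. lin_span K (B d))" by auto
  qed
  moreover have "W \<subseteq> (\<Union>d. lin_span K (B d))"
  proof
    fix w assume "w \<in> W"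
    then have "w \<in> lin_span K (B (Suc 0))" by (intro lin_span_gen[OF Kr]) (auto simp: B0 BS intro!: image_eqI[of _ _ "(1, w)"])
    then show "w \<in> (\<Union>d. lin_span K (B d))" by blast
  qed
  ultimately have "R \<subseteq> (\<Union>d. lin_span K (B d))"
    unfolding R by (intro subring_closure_least) auto
  with r(1) obtain d where rd: "r \<in> lin_span K (B d)" by blast
  have inR: "u \<in> R" if "u \<in> lin_span K U" "U \<subseteq> R" for u U
    by (rule lin_span_in_subring[OF Rr KR that(2,1)])
  have \<theta>lin: "\<theta> (k * u + v) = k * \<theta> u + \<theta> v" if "k \<in> K" "u \<in> R" "v \<in> R" for k u v
    using that KR by (auto simp: hom_on_simps[OF Rr \<theta>(1)] subring_closed[OF Rr] \<theta>(2) subset_iff)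
  have span_into: "\<theta> ` lin_span K U \<subseteq> lin_span K U'" if "\<theta> ` U \<subseteq> lin_span K U'" "U \<subseteq> R" for U U'
  proof
    fix x assume "x \<in> \<theta> ` lin_span K U"
    then obtain u where u: "u \<in> lin_span K U" "x = \<theta> u" by blast
    from u(1) have "\<theta> u \<in> lin_span K U'"
    proof induction
      case (step c b u)
      then show ?case using that inR[OF _ that(2)]
        by (subst \<theta>lin) (auto intro!: lin_span_add lin_span_scale[OF Kr])
    qed (simp add: hom_on_0[OF Rr \<theta>(1)] lin_span.zero)
    with u show "x \<in> lin_span K U'" by simp
  qed
  have span_onto: "lin_span K U \<subseteq> \<theta> ` lin_span K U'" if U: "U \<subseteq> \<theta> ` lin_span K U'" "U' \<subseteq> R" for U U'
  proof
    fix u assume "u \<in> lin_span K U"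
    then show "u \<in> \<theta> ` lin_span K U'"
    proof induction
      case zero
      then show ?case using hom_on_0[OF Rr \<theta>(1)] lin_span.zero by (intro image_eqI[of _ _ 0]) auto
    next
      case (step c b u)
      obtain y where y: "y \<in> lin_span K U'" "u = \<theta> y" using step.IH by (rule imageE)
      obtain x where x: "x \<in> lin_span K U'" "b = \<theta> x" using subsetD[OF U(1) step(2)] by (rule imageE)
      note xy = x y
      have "\<theta> (c * x + y) = c * b + u" using xy step inR[OF _ U(2)] by (subst \<theta>lin) auto
      moreover have "c * x + y \<in> lin_span K U'"
        using xy step by (intro lin_span_add lin_span_scale[OF Kr])
      ultimately show ?case by (metis imageI)
    qed
  qed
  have BB: "\<theta> ` B d \<subseteq> lin_span K (B d) \<and> B d \<subseteq> \<theta> ` lin_span K (B d)" for d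
  proof (induction d)
    case 0
    have "1 \<in> lin_span K (B 0)" using lin_span_gen[OF Kr, of 1 "B 0"] by (simp add: B0)
    then show ?case using hom_on_1[OF Rr \<theta>(1)] unfolding B0 by (auto intro: image_eqI[of _ _ 1])
  next
    case (Suc d)
    show ?case
    proof (intro conjI subsetI)
      fix x assume "x \<in> \<theta> ` B (Suc d)"
      then obtain b w where bw: "b \<in> B d" "w \<in> W" "x = \<theta> (b * w)" unfolding BS by auto
      then have "x = \<theta> b * \<theta> w" using BR WR by (auto simp: hom_on_mult[OF Rr \<theta>(1)] subset_iff)
      moreover have "\<theta> b * \<theta> w \<in> lin_span K (B (Suc d))"
        unfolding BS using bw Suc into by (intro lin_span_mult[OF Kr]) auto
      ultimately show "x \<in> lin_span K (B (Suc d))" by simp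
    next
      fix x assume "x \<in> B (Suc d)"
      then obtain b w where bw: "b \<in> B d" "w \<in> W" "x = b * w" unfolding BS by auto
      then obtain u v where uv: "u \<in> lin_span K (B d)" "b = \<theta> u" "v \<in> lin_span K W" "w = \<theta> v"
        using Suc onto by blast
      have "\<theta> (u * v) = x"
        using uv bw inR[OF uv(1) BR] inR[OF uv(3) WR] by (simp add: hom_on_mult[OF Rr \<theta>(1)])
      moreover have "u * v \<in> lin_span K (B (Suc d))"
        unfolding BS by (rule lin_span_mult[OF Kr uv(1,3)])
      ultimately show "x \<in> \<theta> ` lin_span K (B (Suc d))" by blast
    qed
  qed
  show ?thesis
    using BB[of d] span_into[OF _ BR, of d "B d"] span_onto[OF _ BR, of "B d" d]
    by (intro surjective_endo_of_lin_span_injective[OF K Rr KR \<theta> fin BR _ _ rd r(2)]) simp_all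
qed

section \<open>Fields of fractions\<close>

definition fractions :: "'a::field set \<Rightarrow> 'a set" where
  "fractions R = {p * inverse q |p q. p \<in> R \<and> q \<in> R \<and> q \<noteq> 0}"

lemma fractionsI: "p \<in> R \<Longrightarrow> q \<in> R \<Longrightarrow> q \<noteq> 0 \<Longrightarrow> p * inverse q \<in> fractions R"
  unfolding fractions_def by blast

lemma fraction_add: "q \<noteq> 0 \<Longrightarrow> s \<noteq> 0 \<Longrightarrow>
    p * inverse q + r * inverse s = (p * s + r * q) * inverse (q * (s :: 'a::field))"
  by (simp add: field_simps)

lemma fraction_mult: "(p * inverse q) * (r * inverse s) = (p * r) * inverse (q * (s :: 'a::field))"
  by (simp add: mult_ac)

lemma (in differential_field) deriv_fraction:
  "q \<noteq> 0 \<Longrightarrow> D (p * inverse q) = (D p * q + - (p * D q)) * inverse (q * q)"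
  unfolding deriv_mult deriv_inverse by (simp add: divide_simps)

lemma subset_fractions: "is_subring R \<Longrightarrow> R \<subseteq> fractions R"
proof
  fix r assume "is_subring R" "r \<in> R"
  then have "r * inverse 1 \<in> fractions R" by (intro fractionsI subring_1) auto
  then show "r \<in> fractions R" by simp
qed

lemma fractions_diff_subfield:
  assumes D: "differential_field D" and R: "is_subring R" "\<And>r. r \<in> R \<Longrightarrow> D r \<in> R"
  shows "diff_subfield D (fractions R)"
proof -
  interpret differential_field D by fact
  note Rc = subring_closed[OF R(1)]
  have F: "0 \<in> fractions R" "1 \<in> fractions R" using subset_fractions[OF R(1)] Rc by auto
  have *: "x + y \<in> fractions R" "x * y \<in> fractions R" "- x \<in> fractions R" "inverse x \<in> fractions R"
    "D x \<in> fractions R" if xy: "x \<in> fractions R" "y \<in> fractions R" for x y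
  proof -
    from xy obtain p q r s where pq: "x = p * inverse q" "y = r * inverse s" "p \<in> R" "q \<in> R" "q \<noteq> 0"
      "r \<in> R" "s \<in> R" "s \<noteq> 0" unfolding fractions_def by blast
    show "x + y \<in> fractions R"
      unfolding pq(1,2) fraction_add[OF pq(5,8)]
      by (intro fractionsI Rc(3,4) pq(3,4,6,7)) (use pq(5,8) in simp)
    show "x * y \<in> fractions R"
      unfolding pq(1,2) fraction_mult
      by (intro fractionsI Rc(4) pq(3,4,6,7)) (use pq(5,8) in simp)
    have "- x = - p * inverse q" by (simp add: pq(1))
    also have "\<dots> \<in> fractions R" by (intro fractionsI Rc(5) pq(3-5))
    finally show "- x \<in> fractions R" .
    show "inverse x \<in> fractions R"
    proof (cases "p = 0")
      case False
      have "inverse x = q * inverse p" by (simp add: pq(1) mult.commute)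
      also have "\<dots> \<in> fractions R" by (intro fractionsI pq(3,4) False)
      finally show ?thesis .
    qed (use F pq(1) in simp)
    show "D x \<in> fractions R"
      unfolding pq(1) deriv_fraction[OF pq(5)]
      by (intro fractionsI Rc(3,4,5) R(2) pq(3,4)) (use pq(5) in simp)
  qed
  show ?thesis unfolding diff_subfield_def is_subfield_def using F *(1,2) *(3-5)[OF _ F(1)] by simp
qed

lemma injective_hom_extends_to_fractions:
  fixes h :: "'a::field_char_0 \<Rightarrow> 'b::field_char_0"
  assumes D: "differential_field D" and D': "differential_field D'"
    and R: "is_subring R" "\<And>r. r \<in> R \<Longrightarrow> D r \<in> R"
    and h: "hom_on R h" "\<And>r. r \<in> R \<Longrightarrow> h (D r) = D' (h r)" "\<And>r. r \<in> R \<Longrightarrow> h r = 0 \<Longrightarrow> r = 0"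
    and N': "diff_subfield D' N'" "h ` R \<subseteq> N'"
  obtains g where "diff_field_hom D (fractions R) D' N' g" "\<And>r. r \<in> R \<Longrightarrow> g r = h r"
proof -
  interpret D: differential_field D by fact
  interpret D': differential_field D' by fact
  note Rc = subring_closed[OF R(1)] and hs = hom_on_simps[OF R(1) h(1)]
  define P where "P x t \<longleftrightarrow> fst t \<in> R \<and> snd t \<in> R \<and> snd t \<noteq> 0 \<and> x = fst t * inverse (snd t)" for x and t :: "'a \<times> 'a"
  define g where "g x = h (fst (SOME t. P x t)) * inverse (h (snd (SOME t. P x t)))" for x
  have g: "g (p * inverse q) = h p * inverse (h q)" if "p \<in> R" "q \<in> R" "q \<noteq> 0" for p q
  proof -
    define t where "t = (SOME t. P (p * inverse q) t)"
    have "P (p * inverse q) t" unfolding t_def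
      by (rule someI[of _ "(p, q)"]) (use that in \<open>simp add: P_def\<close>)
    then have t: "fst t \<in> R" "snd t \<in> R" "snd t \<noteq> 0" "p * inverse q = fst t * inverse (snd t)"
      unfolding P_def by auto
    have "p * snd t = (p * inverse q) * (q * snd t)" using that by simp
    also have "\<dots> = fst t * q" unfolding t(4) using t(3) by simp
    finally have "p * snd t = fst t * q" .
    from arg_cong[OF this, of h] have "h p * h (snd t) = h (fst t) * h q"
      using t that by (simp add: hs(4))
    moreover have "h q \<noteq> 0" "h (snd t) \<noteq> 0" using h(3) t that by auto
    ultimately have "h (fst t) * inverse (h (snd t)) = h p * inverse (h q)"
      by (simp add: nonzero_eq_divide_eq nonzero_divide_eq_eq flip: divide_inverse)
    then show ?thesis unfolding g_def t_def[symmetric] .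
  qed
  have gR: "g r = h r" if "r \<in> R" for r
    using g[OF that Rc(2)] hs(2) by simp
  have gDom: "g (x + y) = g x + g y \<and> g (x * y) = g x * g y \<and> g (D x) = D' (g x) \<and> g x \<in> N'"
    if xy: "x \<in> fractions R" "y \<in> fractions R" for x y
  proof -
    from xy obtain p q r s where pq: "x = p * inverse q" "y = r * inverse s" "p \<in> R" "q \<in> R" "q \<noteq> 0"
      "r \<in> R" "s \<in> R" "s \<noteq> 0" unfolding fractions_def by blast
    have nz: "h q \<noteq> 0" "h s \<noteq> 0" using h(3) pq by auto
    have gx: "g x = h p * inverse (h q)" "g y = h r * inverse (h s)" using pq g by auto
    have hm: "h (u * v) = h u * h v" "h (u + v) = h u + h v" "u * v \<in> R"
      if "u \<in> R" "v \<in> R" for u v using that by (auto intro: hs Rc)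
    have hm': "h (- u) = - h u" "- u \<in> R" if "u \<in> R" for u using that by (auto intro: hs Rc)
    have sum: "x + y = (p * s + r * q) * inverse (q * s)"
      and prd: "x * y = (p * r) * inverse (q * s)"
      and der: "D x = (D p * q + - (p * D q)) * inverse (q * q)"
      unfolding pq(1,2) using fraction_add[OF pq(5,8)] fraction_mult D.deriv_fraction[OF pq(5)] by auto
    have "g (x + y) = h (p * s + r * q) * inverse (h (q * s))"
      unfolding sum by (rule g) (use pq Rc(3,4) in auto)
    then have "g (x + y) = g x + g y"
      by (simp only: gx fraction_add[OF nz] hm pq(3-8))
    moreover have "g (x * y) = h (p * r) * inverse (h (q * s))"
      unfolding prd by (rule g) (use pq Rc(4) in auto)
    then have "g (x * y) = g x * g y"
      by (simp only: gx fraction_mult hm pq(3-8))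
    moreover have "g (D x) = h (D p * q + - (p * D q)) * inverse (h (q * q))"
      unfolding der by (rule g) (use pq in \<open>auto intro: Rc(4,6) R(2)\<close>)
    then have "g (D x) = D' (g x)"
      by (simp only: gx D'.deriv_fraction[OF nz(1)] hm hm' h(2) R(2) pq(3-8))
    moreover have "g x \<in> N'"
    proof -
      have "h p \<in> N'" "h q \<in> N'" using N'(2) pq by auto
      then show ?thesis unfolding gx
        by (intro subring_mult[OF diff_subfield_subring[OF N'(1)]] diff_subfield_inverse[OF N'(1)])
    qed
    ultimately show ?thesis by simp
  qed
  have "g 1 = 1" using gR[OF Rc(2)] hs(2) by simp
  moreover have "g (D x) = D' (g x)" "g x \<in> N'" if "x \<in> fractions R" for x
    using gDom[OF that subsetD[OF subset_fractions[OF R(1)] Rc(1)]] by auto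
  moreover have "g (x + y) = g x + g y" "g (x * y) = g x * g y"
    if "x \<in> fractions R" "y \<in> fractions R" for x y
    using gDom[OF that] by auto
  ultimately have "diff_field_hom D (fractions R) D' N' g"
    unfolding diff_field_hom_def image_subset_iff by simp
  then show thesis using gR by (rule that)
qed

section \<open>Homomorphisms of differential fields\<close>

lemma diff_field_hom_iff:
  "diff_field_hom D K D' L h \<longleftrightarrow> hom_on K h \<and> h ` K \<subseteq> L \<and> (\<forall>x\<in>K. h (D x) = D' (h x))"
  unfolding diff_field_hom_def hom_on_def by auto

lemma constants_subring:
  assumes "differential_field D" "diff_subfield D K"
  shows "is_subring (constants D K)"
proof -
  interpret differential_field D by fact
  show ?thesis
    unfolding is_subring_def constants_def
    using subring_closed[OF diff_subfield_subring[OF assms(2)]]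
    by (auto simp: deriv_add deriv_mult deriv_minus)
qed

lemma hom_on_subfield_inj:
  assumes "is_subfield K" "hom_on K f"
  shows "inj_on f K"
proof (rule inj_onI)
  fix x y assume xy: "x \<in> K" "y \<in> K" "f x = f y"
  note Kr = subfield_imp_subring[OF assms(1)]
  have "f (x - y) = 0" using hom_on_diff[OF Kr assms(2)] xy by simp
  then show "x = y" using hom_on_subfield_eq_0_iff[OF assms] subring_diff[OF Kr xy(1,2)] by simp
qed

lemma hom_on_inverse:
  fixes f :: "'a::field \<Rightarrow> 'b::field"
  assumes "is_subfield K" "hom_on K f" "x \<in> K"
  shows "f (inverse x) = inverse (f x)"
proof (cases "x = 0")
  case True
  then show ?thesis using hom_on_0[OF subfield_imp_subring[OF assms(1)] assms(2)] by simp
next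
  case False
  note Kr = subfield_imp_subring[OF assms(1)]
  have "inverse x \<in> K" using assms(1,3) unfolding is_subfield_def by auto
  then have "f x * f (inverse x) = 1"
    using hom_on_mult[OF Kr assms(2,3)] hom_on_1[OF Kr assms(2)] False by (metis right_inverse)
  then show ?thesis by (metis inverse_unique)
qed

lemma hom_image_subfield:
  fixes f :: "'a::field \<Rightarrow> 'b::field"
  assumes "is_subfield K" "hom_on K f"
  shows "is_subfield (f ` K)"
proof -
  note Kr = subfield_imp_subring[OF assms(1)]
  note f = hom_on_simps[OF Kr assms(2)]
  have "0 \<in> f ` K" "1 \<in> f ` K" using f(1,2) subring_closed(1,2)[OF Kr] by (metis imageI)+
  moreover have "f x + f y \<in> f ` K \<and> f x * f y \<in> f ` K" if "x \<in> K" "y \<in> K" for x y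
    using that f(3,4) subring_closed(3,4)[OF Kr] by (metis imageI)
  moreover have "- f x \<in> f ` K \<and> inverse (f x) \<in> f ` K" if "x \<in> K" for x
  proof -
    have "inverse x \<in> K" using assms(1) that unfolding is_subfield_def by auto
    with that f(5) subring_closed(5)[OF Kr] hom_on_inverse[OF assms that] show ?thesis by (metis imageI)
  qed
  ultimately show ?thesis unfolding is_subfield_def by blast
qed

lemma diff_field_hom_image:
  assumes "diff_subfield D K" "diff_field_hom D K D' L f"
  shows "diff_subfield D' (f ` K)"
  using assms hom_image_subfield[of K f] unfolding diff_subfield_def diff_field_hom_iff
  by (metis (no_types, lifting) imageE imageI)

lemma constants_hom_image:
  assumes "differential_field D" "diff_subfield D K" "diff_field_hom D K D' L f"
  shows "constants D' (f ` K) = f ` constants D K"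
proof -
  interpret differential_field D by fact
  have f: "hom_on K f" "\<And>x. x \<in> K \<Longrightarrow> f (D x) = D' (f x)"
    using assms(3) unfolding diff_field_hom_iff by auto
  have "D' (f x) = 0 \<longleftrightarrow> D x = 0" if "x \<in> K" for x
    using hom_on_subfield_eq_0_iff[OF diff_subfield_subfield[OF assms(2)] f(1) diff_subfield_deriv[OF assms(2) that]]
      f(2)[OF that] by simp
  then show ?thesis unfolding constants_def by auto
qed

lemma diff_field_hom_inv_into:
  assumes D: "differential_field D" and K: "diff_subfield D K" "K \<subseteq> N" and f: "diff_field_hom D K D' L f"
  shows "diff_field_hom D' (f ` K) D N (inv_into K f)"
proof -
  note Ks = diff_subfield_subfield[OF K(1)] and Kr = diff_subfield_subring[OF K(1)]
  have h: "hom_on K f" "\<And>x. x \<in> K \<Longrightarrow> f (D x) = D' (f x)"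
    using f unfolding diff_field_hom_iff by auto
  have i: "inv_into K f (f x) = x" if "x \<in> K" for x
    by (rule inv_into_f_f[OF hom_on_subfield_inj[OF Ks h(1)] that])
  have "inv_into K f (f x + f y) = x + y" "inv_into K f (f x * f y) = x * y" if "x \<in> K" "y \<in> K" for x y
    using i[OF subring_add[OF Kr that]] i[OF subring_mult[OF Kr that]] hom_on_simps(3,4)[OF Kr h(1) that]
    by auto
  moreover have "inv_into K f 1 = 1"
    using i[OF subring_1[OF Kr]] hom_on_1[OF Kr h(1)] by simp
  moreover have "inv_into K f (D' (f x)) = D x" if "x \<in> K" for x
    using i[OF diff_subfield_deriv[OF K(1) that]] h(2)[OF that] by simp
  ultimately show ?thesis
    unfolding diff_field_hom_def using K(2) i by (auto simp: image_subset_iff)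
qed

text \<open>
  A polynomial over the image is pulled back coefficientwise along the inverse of \<open>f\<close>.
\<close>
lemma alg_closed_hom_image:
  fixes f :: "'a::field_char_0 \<Rightarrow> 'b::field_char_0"
  assumes C: "alg_closed_subfield C" and f: "hom_on C f"
  shows "alg_closed_subfield (f ` C)"
proof -
  have Cs: "is_subfield C" and root: "\<And>p. p \<in> polys_over C \<Longrightarrow> degree p > 0 \<Longrightarrow> \<exists>x\<in>C. poly p x = 0"
    using C unfolding alg_closed_subfield_def polys_over_def by auto
  note Cr = subfield_imp_subring[OF Cs]
  define g where "g = inv_into C f"
  have g: "g x \<in> C" "f (g x) = x" if "x \<in> f ` C" for x
    using that unfolding g_def by (auto intro: inv_into_into f_inv_into_f)
  have "\<exists>x\<in>f ` C. poly p x = 0" if p: "\<forall>i. coeff p i \<in> f ` C" "degree p > 0" for p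
  proof -
    define q where "q = map_poly g p"
    have g0: "g 0 = 0"
      using inv_into_f_f[OF hom_on_subfield_inj[OF Cs f] subring_0[OF Cr]] hom_on_0[OF Cr f]
      unfolding g_def by simp
    have q: "q \<in> polys_over C" unfolding q_def polys_over_def
      using g p by (simp add: coeff_map_poly g0)
    have fq: "map_poly f q = p"
      unfolding q_def using g p
      by (intro poly_eqI) (simp add: coeff_map_poly g0 hom_on_0[OF Cr f])
    have "degree p \<le> degree q" unfolding fq[symmetric]
      by (intro degree_le) (simp add: coeff_map_poly hom_on_0[OF Cr f] coeff_eq_0)
    then obtain x where x: "x \<in> C" "poly q x = 0" using root[OF q] p(2) by auto
    have "poly p (f x) = f (poly q x)" using hom_on_poly[OF Cr f q x(1)] fq by simp
    then show ?thesis using x hom_on_0[OF Cr f] by auto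
  qed
  then show ?thesis using hom_image_subfield[OF Cs f] unfolding alg_closed_subfield_def by blast
qed

section \<open>Uniqueness of Picard--Vessiot extensions\<close>

lemma solution_space_basis:
  assumes full: "full_set_of_solutions D n a N" and C: "is_subring (constants D N)"
  obtains y where "\<And>j. j < n \<Longrightarrow> y j \<in> solutions D n a N" "indep_over (constants D N) {..<n} y"
    "solutions D n a N \<subseteq> lin_span (constants D N) (y ` {..<n})"
proof -
  obtain B where B: "is_basis_over (constants D N) B (solutions D n a N)" "card B = n"
    using full unfolding full_set_of_solutions_def has_dim_over_def by blast
  then have fin: "finite B" and Bs: "B \<subseteq> solutions D n a N" unfolding is_basis_over_def by auto
  obtain y where y: "bij_betw y {..<n} B"
    using ex_bij_betw_nat_finite[OF fin] B(2) by (auto simp: lessThan_atLeast0)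
  have yB: "y ` {..<n} = B" using y by (rule bij_betw_imp_surj_on)
  have "indep_over (constants D N) {..<n} y"
    unfolding indep_over_def
  proof (intro allI impI, elim conjE)
    fix c assume c: "\<forall>j\<in>{..<n}. c j \<in> constants D N" "(\<Sum>j<n. c j * y j) = 0"
    define e where "e b = c (inv_into {..<n} y b)" for b
    have e: "e (y j) = c j" if "j < n" for j
      unfolding e_def using inv_into_f_f[OF bij_betw_imp_inj_on[OF y]] that by simp
    have "(\<Sum>b\<in>B. e b * b) = (\<Sum>j<n. e (y j) * y j)"
      by (rule sum.reindex_bij_betw[OF y, symmetric])
    also have "\<dots> = 0" using c(2) by (simp add: e)
    finally have "(\<Sum>b\<in>B. e b * b) = 0" .
    moreover have "\<forall>b\<in>B. e b \<in> constants D N" using c(1) yB e by auto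
    ultimately have "\<forall>b\<in>B. e b = 0" using B(1) unfolding is_basis_over_def by blast
    then show "\<forall>j\<in>{..<n}. c j = 0" using e yB by auto
  qed
  moreover have "solutions D n a N \<subseteq> lin_span (constants D N) (y ` {..<n})"
  proof
    fix v assume "v \<in> solutions D n a N"
    then obtain c where c: "\<forall>b\<in>B. c b \<in> constants D N" "v = (\<Sum>b\<in>B. c b * b)"
      using B(1) unfolding is_basis_over_def by blast
    show "v \<in> lin_span (constants D N) (y ` {..<n})"
      unfolding c(2) yB using c(1) by (intro lin_span_sum lin_span_scale[OF C] lin_span_gen[OF C]) auto
  qed
  moreover have "y j \<in> solutions D n a N" if "j < n" for j using yB Bs that by auto
  ultimately show thesis using that by blast
qed

text \<open>
  The two matrices of constants amount to the statement that \<open>h\<close> maps the space of solutions spanned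
  by \<open>y\<close> onto the one spanned by \<open>z\<close>; in this form the result can be composed with its mirror image.
\<close>
lemma solution_ring_hom_onto:
  fixes D :: "'a::field_char_0 \<Rightarrow> 'a" and D' :: "'b::field_char_0 \<Rightarrow> 'b"
  assumes D: "differential_field D" and D': "differential_field D'"
    and N: "diff_subfield D N" and N': "diff_subfield D' N'"
    and K: "diff_subfield D K" "K \<subseteq> N"
    and \<sigma>: "diff_field_hom D K D' N' \<sigma>"
    and a: "equation_over K n a"
    and y: "\<And>j. j < n \<Longrightarrow> y j \<in> solutions D n a N" "indep_over (constants D N) {..<n} y"
    and z: "\<And>j. j < n \<Longrightarrow> z j \<in> solutions D' n (\<lambda>i. \<sigma> (a i)) N'" "indep_over (constants D' N') {..<n} z"
    and C: "alg_closed_subfield (constants D' N')" "constants D' N' \<subseteq> \<sigma> ` constants D K"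
  obtains h where "hom_on (solution_ring K D n y) h"
    "h ` solution_ring K D n y \<subseteq> solution_ring (\<sigma> ` K) D' n z"
    "\<And>x. x \<in> K \<Longrightarrow> h x = \<sigma> x"
    "\<And>r. r \<in> solution_ring K D n y \<Longrightarrow> h (D r) = D' (h r)"
    "h ` lin_span (constants D K) (y ` {..<n}) = lin_span (constants D' (\<sigma> ` K)) (z ` {..<n})"
proof -
  let ?R = "solution_ring K D n y"
  note Rr = solution_ring_subring[of K D n y]
  have \<sigma>': "hom_on K \<sigma>" "\<sigma> ` K \<subseteq> N'" "\<And>x. x \<in> K \<Longrightarrow> \<sigma> (D x) = D' (\<sigma> x)"
    using \<sigma> unfolding diff_field_hom_iff by auto
  obtain h c c' where h: "hom_on ?R h" "h ` ?R \<subseteq> solution_ring (\<sigma> ` K) D' n z"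
    "\<And>x. x \<in> K \<Longrightarrow> h x = \<sigma> x" "\<And>r. r \<in> ?R \<Longrightarrow> h (D r) = D' (h r)"
    and c: "\<And>i j. i < n \<Longrightarrow> j < n \<Longrightarrow> c i j \<in> constants D K \<and> c' i j \<in> constants D K"
      "\<And>j. j < n \<Longrightarrow> h (y j) = (\<Sum>i<n. z i * \<sigma> (c i j))"
      "\<And>j. j < n \<Longrightarrow> z j = (\<Sum>i<n. h (y i) * \<sigma> (c' i j))"
    using solution_ring_hom[OF D D' N N' K \<sigma>' a y z C] by blast
  define C1 where "C1 = constants D K"
  define C2 where "C2 = \<sigma> ` C1"
  have C2: "constants D' (\<sigma> ` K) = C2"
    unfolding C2_def C1_def by (rule constants_hom_image[OF D K(1) \<sigma>])
  have C1r: "is_subring C1" unfolding C1_def by (rule constants_subring[OF D K(1)])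
  have C2r: "is_subring C2"
    using constants_subring[OF D' diff_field_hom_image[OF K(1) \<sigma>]] C2 by simp
  have C1R: "C1 \<subseteq> ?R" and hC: "\<And>e. e \<in> C1 \<Longrightarrow> h e = \<sigma> e"
    using solution_ring_base[of K D n y] h(3) by (auto simp: C1_def constants_def)
  have yR: "y ` {..<n} \<subseteq> ?R" using solution_ring_y[of _ n y K D] by auto
  have VR: "u \<in> ?R" if "u \<in> lin_span C1 (y ` {..<n})" for u
    by (rule lin_span_in_subring[OF Rr C1R yR that])
  have hlin: "h (e * u + v) = \<sigma> e * h u + h v" if "e \<in> C1" "u \<in> ?R" "v \<in> ?R" for e u v
    using that C1R by (auto simp: hom_on_simps[OF Rr h(1)] hC subring_mult[OF Rr] subset_iff)
  have "h ` lin_span C1 (y ` {..<n}) = lin_span C2 (z ` {..<n})"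
  proof (intro equalityI subsetI)
    fix w assume "w \<in> h ` lin_span C1 (y ` {..<n})"
    then obtain u where u: "u \<in> lin_span C1 (y ` {..<n})" "w = h u" by blast
    from u(1) have "h u \<in> lin_span C2 (z ` {..<n})"
    proof induction
      case zero
      then show ?case by (simp add: hom_on_0[OF Rr h(1)] lin_span.zero)
    next
      case (step e b u)
      then obtain j where j: "j < n" "b = y j" by blast
      have "h b \<in> lin_span C2 (z ` {..<n})"
        unfolding j(2) c(2)[OF j(1)]
      proof (rule lin_span_sum)
        fix i assume i: "i \<in> {..<n}"
        have "\<sigma> (c i j) * z i \<in> lin_span C2 (z ` {..<n})"
          using c(1)[of i j] i j(1) by (intro lin_span_scale[OF C2r] lin_span_gen[OF C2r]) (auto simp: C2_def C1_def)
        then show "z i * \<sigma> (c i j) \<in> lin_span C2 (z ` {..<n})" by (simp add: mult.commute)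
      qed
      moreover have "h (e * b + u) = \<sigma> e * h b + h u"
        using step yR VR by (intro hlin) auto
      moreover have "\<sigma> e \<in> C2" using step(1) by (simp add: C2_def)
      ultimately show ?case using step(4) lin_span_add[OF lin_span_scale[OF C2r]] by simp
    qed
    then show "w \<in> lin_span C2 (z ` {..<n})" using u by simp
  next
    fix w assume "w \<in> lin_span C2 (z ` {..<n})"
    then show "w \<in> h ` lin_span C1 (y ` {..<n})"
    proof induction
      case zero
      then show ?case using hom_on_0[OF Rr h(1)] lin_span.zero by (intro image_eqI[of _ _ 0]) auto
    next
      case (step e b w)
      obtain u where u: "u \<in> lin_span C1 (y ` {..<n})" "w = h u" using step(4) by (rule imageE)
      obtain j where j: "j < n" "b = z j" using step(2) by blast
      obtain e' where e': "e' \<in> C1" "e = \<sigma> e'" using step(1) unfolding C2_def by (rule imageE)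
      define s where "s = (\<Sum>i<n. c' i j * y i)"
      have s: "s \<in> lin_span C1 (y ` {..<n})"
        unfolding s_def using c(1) j
        by (intro lin_span_sum lin_span_scale[OF C1r] lin_span_gen[OF C1r]) (auto simp: C1_def)
      have "h s = (\<Sum>i<n. h (c' i j * y i))"
        unfolding s_def using c(1) j yR C1R
        by (intro hom_on_sum[OF Rr h(1)] subring_mult[OF Rr]) (auto simp: C1_def)
      also have "\<dots> = (\<Sum>i<n. h (y i) * \<sigma> (c' i j))"
      proof (intro sum.cong refl)
        fix i assume "i \<in> {..<n}"
        then have "c' i j \<in> C1" "y i \<in> ?R" using c(1) j yR by (auto simp: C1_def)
        then show "h (c' i j * y i) = h (y i) * \<sigma> (c' i j)"
          using hom_on_mult[OF Rr h(1)] C1R hC by (simp add: mult.commute subset_iff)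
      qed
      finally have "h s = b" using c(3)[OF j(1)] j(2) by simp
      then have "e * b + w = h (e' * s + u)"
        using hlin[OF e'(1) VR[OF s] VR[OF u(1)]] e'(2) u(2) by simp
      moreover have "e' * s + u \<in> lin_span C1 (y ` {..<n})"
        by (intro lin_span_add lin_span_scale[OF C1r] e' s u)
      ultimately show ?case by blast
    qed
  qed
  then show thesis using that[of h] h unfolding C2 C1_def by simp
qed

text \<open>
  The homomorphism \<open>g\<close> in the opposite direction starts from the inverse of \<open>\<sigma>\<close> on \<open>\<sigma> ` K\<close>; it exists because the
  constants of \<open>N\<close>, being those of \<open>K\<close>, are algebraically closed.  Its composite \<open>\<theta>\<close> with \<open>h\<close> is an
  endomorphism of \<open>R\<close> over \<open>K\<close> that commutes with \<open>D\<close> and maps the solution space \<open>V\<close> onto itself, so it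
  also maps the span of the derivatives of solutions onto itself.
\<close>
lemma PV_extension_embeds:
  fixes D :: "'a::field_char_0 \<Rightarrow> 'a" and D' :: "'b::field_char_0 \<Rightarrow> 'b"
  assumes D: "differential_field D" and D': "differential_field D'"
    and PV: "PV_extension D K N" and N': "diff_subfield D' N'"
    and \<sigma>: "diff_field_hom D K D' N' \<sigma>"
    and full: "\<And>n a. equation_over (\<sigma> ` K) n a \<Longrightarrow> full_set_of_solutions D' n a N'"
    and C: "alg_closed_subfield (constants D K)" "constants D' N' = \<sigma> ` constants D K"
  obtains h where "diff_field_hom D N D' N' h" "\<And>x. x \<in> K \<Longrightarrow> h x = \<sigma> x"
proof -
  interpret D: differential_field D by fact
  have K: "diff_subfield D K" "K \<subseteq> N" and N: "diff_subfield D N" and CN: "constants D N = constants D K"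
    using PV unfolding PV_extension_def no_new_constants_ext_def by auto
  obtain n a where a: "equation_over K n a" "full_set_of_solutions D n a N"
    "N = diff_generated D (K \<union> solutions D n a N)"
    using PV unfolding PV_extension_def by blast
  note Ks = diff_subfield_subfield[OF K(1)] and Kr = diff_subfield_subring[OF K(1)]
  have \<sigma>h: "hom_on K \<sigma>" "\<sigma> ` K \<subseteq> N'" "\<And>x. x \<in> K \<Longrightarrow> \<sigma> (D x) = D' (\<sigma> x)"
    using \<sigma> unfolding diff_field_hom_iff by auto
  let ?K' = "\<sigma> ` K" and ?a' = "\<lambda>i. \<sigma> (a i)" and ?\<tau> = "inv_into K \<sigma>"
  note K' = diff_field_hom_image[OF K(1) \<sigma>]
  have \<tau>: "diff_field_hom D' ?K' D N ?\<tau>" by (rule diff_field_hom_inv_into[OF D K \<sigma>])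
  have \<tau>\<sigma>: "?\<tau> (\<sigma> x) = x" if "x \<in> K" for x
    by (rule inv_into_f_f[OF hom_on_subfield_inj[OF Ks \<sigma>h(1)] that])
  have \<tau>K: "?\<tau> ` ?K' = K" using \<tau>\<sigma> by force
  have a': "equation_over ?K' n ?a'" using a(1) unfolding equation_over_def by auto
  have C'K: "constants D' ?K' = \<sigma> ` constants D K" by (rule constants_hom_image[OF D K(1) \<sigma>])
  have CKr: "is_subring (constants D K)" by (rule constants_subring[OF D K(1)])
  have CKK: "constants D K \<subseteq> K" by (auto simp: constants_def)
  have C': "alg_closed_subfield (constants D' N')"
    unfolding C(2) by (rule alg_closed_hom_image[OF C(1) hom_on_subset[OF \<sigma>h(1) CKK]])
  obtain y where y: "\<And>j. j < n \<Longrightarrow> y j \<in> solutions D n a N" "indep_over (constants D N) {..<n} y"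
    "solutions D n a N \<subseteq> lin_span (constants D N) (y ` {..<n})"
    using solution_space_basis[OF a(2)] CKr CN by metis
  obtain z where z: "\<And>j. j < n \<Longrightarrow> z j \<in> solutions D' n ?a' N'" "indep_over (constants D' N') {..<n} z"
    using solution_space_basis[OF full[OF a'] constants_subring[OF D' N']] by metis
  define R where "R = solution_ring K D n y"
  define R' where "R' = solution_ring ?K' D' n z"
  define V where "V = lin_span (constants D K) (y ` {..<n})"
  define V' where "V' = lin_span (constants D' ?K') (z ` {..<n})"
  have sol: "solutions D n (\<lambda>i. ?\<tau> (?a' i)) N = solutions D n a N"
    using a(1) \<tau>\<sigma> unfolding solutions_def equation_over_def by simp
  have Rr: "is_subring R" and KR: "K \<subseteq> R" and yR: "\<And>j. j < n \<Longrightarrow> y j \<in> R"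
    and gen: "\<And>i j. i < n \<Longrightarrow> j < n \<Longrightarrow> (D ^^ i) (y j) \<in> R"
    unfolding R_def by (auto intro: solution_ring_subring solution_ring_y solution_ring_gen
        subsetD[OF solution_ring_base])
  have RD: "D r \<in> R" if "r \<in> R" for r
    using solution_ring_deriv[where y = y, OF D K(1) a(1) y(1)] that unfolding R_def by blast
  obtain h where h: "hom_on R h" "h ` R \<subseteq> R'" "\<And>x. x \<in> K \<Longrightarrow> h x = \<sigma> x"
    "\<And>r. r \<in> R \<Longrightarrow> h (D r) = D' (h r)" "h ` V = V'"
    using solution_ring_hom_onto[OF D D' N N' K \<sigma> a(1) y(1,2) z C', of thesis] C(2)
    unfolding R_def R'_def V_def V'_def by auto
  obtain g where g: "hom_on R' g" "g ` R' \<subseteq> R" "\<And>x. x \<in> ?K' \<Longrightarrow> g x = ?\<tau> x"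
    "\<And>r. r \<in> R' \<Longrightarrow> g (D' r) = D (g r)" "g ` V' = V"
  proof (rule solution_ring_hom_onto[OF D' D N' N K' \<sigma>h(2) \<tau> a', of z y])
    show "alg_closed_subfield (constants D N)" using C(1) CN by simp
    show "constants D N \<subseteq> ?\<tau> ` constants D' ?K'"
      unfolding C'K CN using \<tau>\<sigma> CKK by force
  qed (use y z sol that \<tau>K in \<open>auto simp: R_def R'_def V_def V'_def\<close>)
  define \<theta> where "\<theta> = g \<circ> h"
  have \<theta>: "hom_on R \<theta>" unfolding \<theta>_def by (rule hom_on_comp[OF h(1,2) g(1)])
  have \<theta>R: "\<theta> r \<in> R" if "r \<in> R" for r using that h(2) g(2) unfolding \<theta>_def by auto
  have \<theta>K: "\<theta> x = x" if "x \<in> K" for x using that h(3) g(3) \<tau>\<sigma> unfolding \<theta>_def by simp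
  have \<theta>D: "\<theta> (D r) = D (\<theta> r)" if "r \<in> R" for r
    using that h(2,4) g(4) unfolding \<theta>_def by (auto simp: image_subset_iff)
  have \<theta>V: "\<theta> ` V = V" unfolding \<theta>_def image_comp[symmetric] h(5) g(5) ..
  have VR: "V \<subseteq> R"
    unfolding V_def using lin_span_in_subring[OF Rr, of "constants D K" "y ` {..<n}"] CKK KR yR by blast
  have \<theta>Di: "\<theta> ((D ^^ i) r) = (D ^^ i) (\<theta> r)" if r: "r \<in> R" for i r
  proof (induction i)
    case (Suc i)
    have "(D ^^ i) r \<in> R" for i using r RD by (induction i) auto
    with Suc \<theta>D show ?case by simp
  qed simp
  define W where "W = insert 1 ((\<lambda>(i, j). (D ^^ i) (y j)) ` ({..<n} \<times> {..<n}))"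
  have DV: "(D ^^ i) v \<in> lin_span K W" if i: "i < n" and v: "v \<in> V" for i v
    using v unfolding V_def
  proof induction
    case (step c b u)
    then obtain j where j: "j < n" "b = y j" by blast
    have "(D ^^ i) (c * b + u) = c * (D ^^ i) b + (D ^^ i) u"
      using step(1) by (simp add: D.funpow_deriv_add D.funpow_deriv_const_mult constants_def)
    moreover have "(D ^^ i) b \<in> W" using i j unfolding W_def by auto
    ultimately show ?case using step CKK by (auto intro!: lin_span.step)
  qed (simp add: lin_span.zero)
  have yV: "y j \<in> V" if "j < n" for j
    unfolding V_def using that by (intro lin_span_gen[OF CKr]) auto
  have inj: "r = 0" if r: "r \<in> R" "\<theta> r = 0" for r
  proof (rule surjective_endo_injective[OF Ks _ _ _ \<theta> \<theta>K _ _ r])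
    show "finite W" "1 \<in> W" by (auto simp: W_def)
    have "K \<union> W = K \<union> (\<lambda>(i, j). (D ^^ i) (y j)) ` ({..<n} \<times> {..<n})"
      using subring_1[OF Kr] unfolding W_def by auto
    then show "R = subring_closure (K \<union> W)" unfolding R_def solution_ring_def by simp
    have one: "\<theta> 1 = 1" "1 \<in> lin_span K W"
      using \<theta>K subring_1[OF Kr] lin_span_gen[OF Kr, of 1 W] by (auto simp: W_def)
    show "\<theta> ` W \<subseteq> lin_span K W"
    proof
      fix x assume "x \<in> \<theta> ` W"
      then consider "x = \<theta> 1" | i j where "i < n" "j < n" "x = \<theta> ((D ^^ i) (y j))"
        unfolding W_def by auto
      then show "x \<in> lin_span K W"
      proof cases
        case 2
        have "\<theta> (y j) \<in> V" using \<theta>V yV[OF 2(2)] by blast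
        then show ?thesis using DV[OF 2(1)] \<theta>Di[OF yR[OF 2(2)]] 2(3) by simp
      qed (use one in simp)
    qed
    show "W \<subseteq> \<theta> ` lin_span K W"
    proof
      fix x assume "x \<in> W"
      then consider "x = 1" | i j where "i < n" "j < n" "x = (D ^^ i) (y j)"
        unfolding W_def by auto
      then show "x \<in> \<theta> ` lin_span K W"
      proof cases
        case 1
        then show ?thesis using one by (metis imageI)
      next
        case 2
        have "y j \<in> \<theta> ` V" using \<theta>V yV[OF 2(2)] by simp
        then obtain v where v: "y j = \<theta> v" "v \<in> V" by (rule imageE)
        then have "x = \<theta> ((D ^^ i) v)" using \<theta>Di VR 2(3) by auto
        then show ?thesis using DV[OF 2(1) v(2)] by blast
      qed
    qed
  qed
  have g0: "g 0 = 0" using hom_on_0[OF solution_ring_subring g(1)[unfolded R'_def]] .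
  have "r = 0" if "r \<in> R" "h r = 0" for r
    using inj[OF that(1)] that(2) g0 unfolding \<theta>_def by simp
  moreover have "h ` R \<subseteq> N'"
  proof -
    have "R' \<subseteq> N'" unfolding R'_def
      using z(1) \<sigma>h(2) diff_subfield_funpow[OF N']
      by (intro solution_ring_subset diff_subfield_subring[OF N']) (auto simp: solutions_def)
    then show ?thesis using h(2) by blast
  qed
  ultimately obtain G where G: "diff_field_hom D (fractions R) D' N' G" "\<And>r. r \<in> R \<Longrightarrow> G r = h r"
    using injective_hom_extends_to_fractions[OF D D' Rr RD h(1,4) _ N'] by blast
  have "solutions D n a N \<subseteq> R" using y(3) VR unfolding V_def CN by blast
  then have "K \<union> solutions D n a N \<subseteq> fractions R" using KR subset_fractions[OF Rr] by blast
  then have "N \<subseteq> fractions R"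
    using fractions_diff_subfield[OF D Rr RD] a(3) unfolding diff_generated_def by blast
  then have "diff_field_hom D N D' N' G" using G(1) unfolding diff_field_hom_def by blast
  moreover have "G x = \<sigma> x" if "x \<in> K" for x using G(2) h(3) KR that by auto
  ultimately show thesis by (rule that)
qed

section \<open>Finitely generated differential subfields of a tower\<close>

lemma diff_subfield_Inter:
  assumes "\<And>K. K \<in> \<K> \<Longrightarrow> diff_subfield D K" "\<K> \<noteq> {}"
  shows "diff_subfield D (\<Inter>\<K>)"
  using assms unfolding diff_subfield_def is_subfield_def by blast

lemma diff_subfield_UNIV: "diff_subfield D UNIV"
  unfolding diff_subfield_def is_subfield_def by simp

lemma diff_generated_diff_subfield: "diff_subfield D (diff_generated D S)"
  unfolding diff_generated_def by (rule diff_subfield_Inter) (use diff_subfield_UNIV in auto)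

lemma subset_diff_generated: "S \<subseteq> diff_generated D S"
  unfolding diff_generated_def by blast

lemma diff_generated_least: "diff_subfield D K \<Longrightarrow> S \<subseteq> K \<Longrightarrow> diff_generated D S \<subseteq> K"
  unfolding diff_generated_def by blast

lemma diff_generated_mono: "S \<subseteq> S' \<Longrightarrow> diff_generated D S \<subseteq> diff_generated D S'"
  unfolding diff_generated_def by blast

text \<open>
  The differential fields generated by finite subsets form a directed family, so their union is a differential field.
\<close>
lemma diff_generated_finitary:
  assumes "x \<in> diff_generated D S"
  obtains A where "finite A" "A \<subseteq> S" "x \<in> diff_generated D A"
proof -
  define U where "U = (\<Union>A\<in>{A. finite A \<and> A \<subseteq> S}. diff_generated D A)"
  have UI: "x \<in> U" if "x \<in> diff_generated D A" "finite A" "A \<subseteq> S" for x A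
    using that unfolding U_def by blast
  have gen: "is_subfield (diff_generated D A)" "\<And>x. x \<in> diff_generated D A \<Longrightarrow> D x \<in> diff_generated D A" for A
    using diff_generated_diff_subfield[of D A] unfolding diff_subfield_def by auto
  have "diff_subfield D U"
    unfolding diff_subfield_def is_subfield_def
  proof (intro conjI ballI)
    show "0 \<in> U" "1 \<in> U" using UI[of _ "{}"] gen(1)[of "{}"] unfolding is_subfield_def by auto
    fix x assume "x \<in> U"
    then obtain A where A: "finite A" "A \<subseteq> S" "x \<in> diff_generated D A" unfolding U_def by blast
    show "- x \<in> U" "inverse x \<in> U" "D x \<in> U"
      using UI[OF _ A(1,2)] A(3) gen(1)[of A] gen(2)[OF A(3)] unfolding is_subfield_def by auto
    fix y assume "y \<in> U"
    then obtain B where B: "finite B" "B \<subseteq> S" "y \<in> diff_generated D B" unfolding U_def by blast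
    have "x \<in> diff_generated D (A \<union> B)" "y \<in> diff_generated D (A \<union> B)"
      using A(3) B(3) diff_generated_mono[of _ "A \<union> B" D] by blast+
    then show "x + y \<in> U" "x * y \<in> U"
      using UI[of _ "A \<union> B"] A B gen(1)[of "A \<union> B"] unfolding is_subfield_def by auto
  qed
  moreover have "S \<subseteq> U"
  proof
    fix x assume "x \<in> S"
    then show "x \<in> U" using subset_diff_generated[of "{x}" D] by (intro UI[of _ "{x}"]) auto
  qed
  ultimately have "x \<in> U" using assms diff_generated_least[of D U S] by blast
  with that show thesis unfolding U_def by blast
qed

lemma iterated_PV_extension_refl: "diff_subfield D F \<Longrightarrow> iterated_PV_extension D F F"
  unfolding iterated_PV_extension_def by (intro exI[of _ 0] exI[of _ "\<lambda>_. F"]) simp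

lemma iterated_PV_extension_step:
  assumes "iterated_PV_extension D F K" "PV_extension D K L"
  shows "iterated_PV_extension D F L"
proof -
  obtain m T where T: "T 0 = F" "T m = K" "\<And>i. i \<le> m \<Longrightarrow> diff_subfield D (T i)"
    "\<And>i. i < m \<Longrightarrow> PV_extension D (T i) (T (Suc i))"
    using assms(1) unfolding iterated_PV_extension_def by blast
  define T' where "T' i = (if i \<le> m then T i else L)" for i
  have "diff_subfield D L" using assms(2) unfolding PV_extension_def no_new_constants_ext_def by blast
  with T assms(2) have "T' 0 = F" "T' (Suc m) = L" "\<forall>i\<le>Suc m. diff_subfield D (T' i)"
    "\<forall>i<Suc m. PV_extension D (T' i) (T' (Suc i))"
    unfolding T'_def by (auto simp: less_Suc_eq_le le_less)
  then show ?thesis unfolding iterated_PV_extension_def by blast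
qed

lemma iterated_PV_extension_no_new_constants:
  assumes "iterated_PV_extension D F K"
  shows "no_new_constants_ext D F K"
proof -
  obtain m T where T: "T 0 = F" "T m = K" "\<And>i. i \<le> m \<Longrightarrow> diff_subfield D (T i)"
    "\<And>i. i < m \<Longrightarrow> PV_extension D (T i) (T (Suc i))"
    using assms unfolding iterated_PV_extension_def by blast
  have "no_new_constants_ext D F (T i)" if "i \<le> m" for i
    using that
  proof (induction i)
    case 0
    then show ?case using T(1) T(3)[of 0] by (simp add: no_new_constants_ext_def)
  next
    case (Suc i)
    then show ?case using T(4)[of i] unfolding PV_extension_def no_new_constants_ext_def by auto
  qed
  with T(2) show ?thesis by auto
qed

text \<open>
  As \<open>L\<close> lies between \<open>K\<close> and \<open>M\<close>, it has their constants, and it contains all solutions in \<open>M\<close>;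
  so a basis of the solution space in \<open>M\<close> is one in \<open>L\<close>.
\<close>
lemma PV_extension_by_solution_space:
  assumes K: "no_new_constants_ext D K M" and a: "equation_over K n a"
    and full: "full_set_of_solutions D n a M"
  defines "L \<equiv> diff_generated D (K \<union> solutions D n a M)"
  shows "PV_extension D K L" "no_new_constants_ext D L M"
proof -
  have M: "diff_subfield D K" "diff_subfield D M" "K \<subseteq> M" "constants D M = constants D K"
    using K unfolding no_new_constants_ext_def by auto
  have L: "diff_subfield D L" "K \<subseteq> L" "solutions D n a M \<subseteq> L"
    using diff_generated_diff_subfield subset_diff_generated unfolding L_def by blast+
  have "L \<subseteq> M" unfolding L_def
    using M by (intro diff_generated_least) (auto simp: solutions_def)
  moreover have "constants D L = constants D M"
    using M(4) L(2) \<open>L \<subseteq> M\<close> unfolding constants_def by blast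
  moreover have "solutions D n a L = solutions D n a M"
    using L(3) \<open>L \<subseteq> M\<close> unfolding solutions_def by blast
  ultimately show "PV_extension D K L" "no_new_constants_ext D L M"
    using M L a full unfolding PV_extension_def no_new_constants_ext_def full_set_of_solutions_def
    by (auto simp: L_def intro!: exI[of _ n] exI[of _ a])
qed

lemma iterated_PV_extension_adjoin_solution_spaces:
  assumes "iterated_PV_extension D F K" "no_new_constants_ext D K M" and "finite Q"
    and "\<And>n a. (n, a) \<in> Q \<Longrightarrow> equation_over K n a \<and> full_set_of_solutions D n a M"
  shows "\<exists>L. iterated_PV_extension D F L \<and> no_new_constants_ext D L M \<and> K \<subseteq> L \<and>
    (\<forall>(n, a)\<in>Q. solutions D n a M \<subseteq> L)"
  using assms(3,4)
proof (induction Q rule: finite_induct)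
  case empty
  then show ?case using assms(1,2) by auto
next
  case (insert q Q)
  obtain n a where q: "q = (n, a)" by fastforce
  obtain L where L: "iterated_PV_extension D F L" "no_new_constants_ext D L M" "K \<subseteq> L"
    "\<forall>(n, a)\<in>Q. solutions D n a M \<subseteq> L"
    using insert by blast
  have a: "equation_over L n a" "full_set_of_solutions D n a M"
    using insert.prems q L(3) unfolding equation_over_def by auto
  let ?L = "diff_generated D (L \<union> solutions D n a M)"
  have "L \<subseteq> ?L" "solutions D n a M \<subseteq> ?L"
    using subset_diff_generated[of "L \<union> solutions D n a M" D] by auto
  moreover from this(1) have "\<forall>(n, a)\<in>Q. solutions D n a M \<subseteq> ?L" using L(4) by blast
  moreover note PV_extension_by_solution_space[OF L(2) a]
  ultimately show ?case
    using iterated_PV_extension_step[OF L(1)] L(3) q by (intro exI[of _ ?L]) auto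
qed

text \<open>
  The set \<open>S'\<close> collects the elements of \<open>T i\<close> that are needed to generate \<open>S\<close>: those used directly and
  the coefficients of one equation \<open>q y\<close> for each solution \<open>y\<close> that is used.
\<close>
lemma finite_subset_of_PV_tower:
  assumes F: "diff_subfield D F" and T: "T 0 = F" "\<And>i. PV_closure D (T i) (T (Suc i))"
    and S: "finite S" "S \<subseteq> T i"
  shows "\<exists>K. iterated_PV_extension D F K \<and> no_new_constants_ext D K (T i) \<and> S \<subseteq> K"
  using S
proof (induction i arbitrary: S)
  case 0
  then show ?case
    using F T(1) iterated_PV_extension_refl by (intro exI[of _ F]) (auto simp: no_new_constants_ext_def)
next
  case (Suc i)
  let ?M = "T (Suc i)"
  define Y where "Y = {y. \<exists>n a. equation_over (T i) n a \<and> y \<in> solutions D n a ?M}"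
  have PV: "no_new_constants_ext D (T i) ?M" "?M = diff_generated D (T i \<union> Y)"
    "\<And>n a. equation_over (T i) n a \<Longrightarrow> full_set_of_solutions D n a ?M"
    using T(2)[of i] unfolding PV_closure_def Y_def by auto
  have "\<forall>s\<in>S. \<exists>A. finite A \<and> A \<subseteq> T i \<union> Y \<and> s \<in> diff_generated D A"
    using Suc.prems(2) unfolding PV(2) by (meson diff_generated_finitary subsetD)
  then obtain A where A: "\<And>s. s \<in> S \<Longrightarrow> finite (A s)" "\<And>s. s \<in> S \<Longrightarrow> A s \<subseteq> T i \<union> Y"
    "\<And>s. s \<in> S \<Longrightarrow> s \<in> diff_generated D (A s)"
    by metis
  define B where "B = (\<Union>s\<in>S. A s)"
  have B: "finite B" "B \<subseteq> T i \<union> Y" using A Suc.prems(1) unfolding B_def by auto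
  have "\<forall>y\<in>Y. \<exists>q. equation_over (T i) (fst q) (snd q) \<and> y \<in> solutions D (fst q) (snd q) ?M"
    unfolding Y_def by auto
  then obtain q where q: "\<And>y. y \<in> Y \<Longrightarrow> equation_over (T i) (fst (q y)) (snd (q y))"
    "\<And>y. y \<in> Y \<Longrightarrow> y \<in> solutions D (fst (q y)) (snd (q y)) ?M"
    by metis
  define S' where "S' = (B \<inter> T i) \<union> (\<Union>y\<in>B \<inter> Y. snd (q y) ` {..<fst (q y)})"
  have "finite S'" "S' \<subseteq> T i"
    using B q(1) unfolding S'_def equation_over_def by auto
  from Suc.IH[OF this] obtain K where K: "iterated_PV_extension D F K"
    "no_new_constants_ext D K (T i)" "S' \<subseteq> K" by blast
  have KM: "no_new_constants_ext D K ?M"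
    using K(2) PV(1) unfolding no_new_constants_ext_def by auto
  have "equation_over K n a \<and> full_set_of_solutions D n a ?M" if na: "(n, a) \<in> q ` (B \<inter> Y)" for n a
  proof -
    from na obtain y where y: "y \<in> B" "y \<in> Y" "q y = (n, a)" by auto
    then have "a ` {..<n} \<subseteq> S'" unfolding S'_def by force
    then show ?thesis using K(3) q(1)[OF y(2)] y(3) PV(3) unfolding equation_over_def by auto
  qed
  moreover have "finite (q ` (B \<inter> Y))" using B(1) by simp
  ultimately have "\<exists>L. iterated_PV_extension D F L \<and> no_new_constants_ext D L ?M \<and> K \<subseteq> L \<and>
      (\<forall>(n, a)\<in>q ` (B \<inter> Y). solutions D n a ?M \<subseteq> L)"
    by (intro iterated_PV_extension_adjoin_solution_spaces[OF K(1) KM]) auto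
  then obtain L where L: "iterated_PV_extension D F L" "no_new_constants_ext D L ?M" "K \<subseteq> L"
    "\<forall>(n, a)\<in>q ` (B \<inter> Y). solutions D n a ?M \<subseteq> L" by blast
  have "B \<subseteq> L"
  proof
    fix x assume x: "x \<in> B"
    show "x \<in> L"
    proof (cases "x \<in> Y")
      case True
      then have "solutions D (fst (q x)) (snd (q x)) ?M \<subseteq> L"
        using L(4) x by (auto simp: case_prod_unfold)
      then show ?thesis using q(2)[OF True] by blast
    next
      case False
      then show ?thesis using x B(2) K(3) L(3) unfolding S'_def by blast
    qed
  qed
  moreover have "diff_subfield D L" using L(2) unfolding no_new_constants_ext_def by simp
  ultimately have "diff_generated D (A s) \<subseteq> L" if "s \<in> S" for s
    using that unfolding B_def by (intro diff_generated_least) auto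
  then have "S \<subseteq> L" using A(3) by blast
  with L show ?case by blast
qed

lemma PV_tower_no_new_constants:
  assumes F: "diff_subfield D F" and T: "T 0 = F" "\<And>i. PV_closure D (T i) (T (Suc i))"
  shows "no_new_constants_ext D F (T i)"
proof (induction i)
  case (Suc i)
  then show ?case using T(2)[of i] unfolding PV_closure_def no_new_constants_ext_def by auto
qed (use F T(1) in \<open>simp add: no_new_constants_ext_def\<close>)

lemma finitely_generated_in_iterated_PV_extension:
  assumes F: "diff_subfield D F" and Finf: "complete_PV_closure D F Finf"
    and E: "E \<subseteq> Finf" "fin_gen_over D F E"
  shows "\<exists>K. iterated_PV_extension D F K \<and> E \<subseteq> K"
proof -
  obtain T where T: "T 0 = F" "\<And>i. PV_closure D (T i) (T (Suc i))" "Finf = (\<Union>i. T i)"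
    using Finf unfolding complete_PV_closure_def by blast
  obtain S where S: "finite S" "S \<subseteq> E" "E = diff_generated D (F \<union> S)"
    using E(2) unfolding fin_gen_over_def by blast
  have "T i \<subseteq> T (Suc i)" for i
    using T(2)[of i] unfolding PV_closure_def no_new_constants_ext_def by auto
  then have mono: "T i \<subseteq> T j" if "i \<le> j" for i j
    using that by (rule lift_Suc_mono_le)
  have "\<exists>i. S \<subseteq> T i"
    using S(1) subset_trans[OF S(2) E(1)]
  proof (induction S rule: finite_induct)
    case (insert x S)
    then obtain i j where "S \<subseteq> T i" "x \<in> T j" using T(3) by auto
    then show ?case using mono[of i "max i j"] mono[of j "max i j"] by (intro exI[of _ "max i j"]) auto
  qed auto
  then obtain i where "S \<subseteq> T i" by blast
  from finite_subset_of_PV_tower[OF F T(1,2) S(1) this]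
  obtain K where K: "iterated_PV_extension D F K" "S \<subseteq> K" by blast
  have "diff_subfield D K" "F \<subseteq> K"
    using iterated_PV_extension_no_new_constants[OF K(1)] unfolding no_new_constants_ext_def by auto
  then have "E \<subseteq> K" unfolding S(3) using K(2) by (intro diff_generated_least) auto
  with K(1) show ?thesis by blast
qed

section \<open>Embedding iterated Picard--Vessiot extensions\<close>

text \<open>
  \<open>U j\<close> is mapped into \<open>T j\<close>, starting from the inverse of \<open>\<phi>\<close>.  All \<open>T j\<close> have the constants of \<open>F\<close>, and all
  \<open>U j\<close> those of \<open>\<phi> ` F\<close>, so the conditions on constants for the uniqueness theorem persist.
\<close>
lemma iterated_PV_extension_embeds:
  fixes D :: "'a::field_char_0 \<Rightarrow> 'a" and D' :: "'b::field_char_0 \<Rightarrow> 'b"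
  assumes D: "differential_field D" and D': "differential_field D'"
    and F: "diff_subfield D F" and C: "alg_closed_subfield (constants D F)"
    and Finf: "complete_PV_closure D F Finf"
    and \<phi>: "diff_field_hom D F D' L \<phi>" and K: "iterated_PV_extension D' (\<phi> ` F) K"
  shows "\<exists>\<sigma>. diff_field_hom D' K D Finf \<sigma> \<and> (\<forall>x\<in>F. \<sigma> (\<phi> x) = x)"
proof -
  obtain T where T: "T 0 = F" "\<And>i. PV_closure D (T i) (T (Suc i))" "Finf = (\<Union>i. T i)"
    using Finf unfolding complete_PV_closure_def by blast
  obtain m U where U: "U 0 = \<phi> ` F" "U m = K" "\<And>i. i \<le> m \<Longrightarrow> diff_subfield D' (U i)"
    "\<And>i. i < m \<Longrightarrow> PV_extension D' (U i) (U (Suc i))"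
    using K unfolding iterated_PV_extension_def by blast
  have \<phi>h: "hom_on F \<phi>" using \<phi> unfolding diff_field_hom_iff by simp
  have \<phi>C: "alg_closed_subfield (\<phi> ` constants D F)"
    by (rule alg_closed_hom_image[OF C hom_on_subset[OF \<phi>h]]) (auto simp: constants_def)
  have TF: "no_new_constants_ext D F (T i)" for i by (rule PV_tower_no_new_constants[OF F T(1,2)])
  have "no_new_constants_ext D' (\<phi> ` F) (U j) \<and>
      (\<exists>\<sigma>. diff_field_hom D' (U j) D (T j) \<sigma> \<and> (\<forall>x\<in>F. \<sigma> (\<phi> x) = x))" if "j \<le> m" for j
    using that
  proof (induction j)
    case 0
    have "diff_field_hom D' (U 0) D (T 0) (inv_into F \<phi>)"
      unfolding U(1) T(1) by (rule diff_field_hom_inv_into[OF D F subset_refl \<phi>])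
    moreover have "inv_into F \<phi> (\<phi> x) = x" if "x \<in> F" for x
      by (rule inv_into_f_f[OF hom_on_subfield_inj[OF diff_subfield_subfield[OF F] \<phi>h] that])
    moreover have "no_new_constants_ext D' (\<phi> ` F) (U 0)"
      using U(1) U(3)[of 0] by (simp add: no_new_constants_ext_def)
    ultimately show ?case by blast
  next
    case (Suc j)
    then obtain \<sigma> where j: "j < m" and \<sigma>: "diff_field_hom D' (U j) D (T j) \<sigma>" "\<And>x. x \<in> F \<Longrightarrow> \<sigma> (\<phi> x) = x"
      and Uj: "no_new_constants_ext D' (\<phi> ` F) (U j)" by auto
    have Tj: "T j \<subseteq> T (Suc j)" "diff_subfield D (T (Suc j))"
      and full: "\<And>n a. equation_over (T j) n a \<Longrightarrow> full_set_of_solutions D n a (T (Suc j))"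
      using T(2)[of j] unfolding PV_closure_def no_new_constants_ext_def by auto
    have CU: "constants D' (U j) = \<phi> ` constants D F"
      using Uj constants_hom_image[OF D F \<phi>] unfolding no_new_constants_ext_def by simp
    have \<sigma>': "diff_field_hom D' (U j) D (T (Suc j)) \<sigma>"
      using \<sigma>(1) Tj(1) unfolding diff_field_hom_iff by auto
    have "(\<lambda>x. \<sigma> (\<phi> x)) ` constants D F = (\<lambda>x. x) ` constants D F"
      by (rule image_cong) (auto simp: constants_def \<sigma>(2))
    then have "\<sigma> ` \<phi> ` constants D F = constants D F" by (simp add: image_image)
    then have C2: "constants D (T (Suc j)) = \<sigma> ` constants D' (U j)"
      using TF[of "Suc j"] unfolding CU no_new_constants_ext_def by simp
    have fullU: "full_set_of_solutions D n a (T (Suc j))" if "equation_over (\<sigma> ` U j) n a" for n a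
    proof (rule full)
      have "\<sigma> ` U j \<subseteq> T j" using \<sigma>(1) unfolding diff_field_hom_iff by simp
      then show "equation_over (T j) n a" using that unfolding equation_over_def by auto
    qed
    obtain h where h: "diff_field_hom D' (U (Suc j)) D (T (Suc j)) h" "\<And>x. x \<in> U j \<Longrightarrow> h x = \<sigma> x"
      by (rule PV_extension_embeds[OF D' D U(4)[OF j] Tj(2) \<sigma>' fullU _ C2]) (simp_all add: \<phi>C CU)
    have "\<phi> ` F \<subseteq> U j" using Uj unfolding no_new_constants_ext_def by simp
    then have "h (\<phi> x) = x" if "x \<in> F" for x using h(2) \<sigma>(2) that by auto
    moreover have "no_new_constants_ext D' (\<phi> ` F) (U (Suc j))"
      using Uj U(4)[OF j] unfolding PV_extension_def no_new_constants_ext_def by auto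
    ultimately show ?case using h(1) by blast
  qed
  from this[OF order_refl] obtain \<sigma> where "diff_field_hom D' K D (T m) \<sigma>" "\<forall>x\<in>F. \<sigma> (\<phi> x) = x"
    unfolding U(2) by blast
  moreover from this(1) have "diff_field_hom D' K D Finf \<sigma>"
    unfolding T(3) diff_field_hom_iff by auto
  ultimately show ?thesis by blast
qed

theorem theorem2:
  fixes D :: "'a::field_char_0 \<Rightarrow> 'a"
    and F Finf :: "'a set"
  assumes "differential_field D"
    and "diff_subfield D F"
    and "alg_closed_subfield (constants D F)"
    and "complete_PV_closure D F Finf"
  shows "(\<forall>E. diff_subfield D E \<and> F \<subseteq> E \<and> E \<subseteq> Finf \<and> fin_gen_over D F E \<longrightarrow>
            (\<exists>K. iterated_PV_extension D F K \<and> E \<subseteq> K)) \<and>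
         (\<forall>(D' :: 'b::field_char_0 \<Rightarrow> 'b) \<phi> K E.
            differential_field D' \<and> diff_field_hom D F D' K \<phi> \<and>
            iterated_PV_extension D' (\<phi> ` F) K \<and>
            diff_subfield D' E \<and> \<phi> ` F \<subseteq> E \<and> E \<subseteq> K \<longrightarrow>
            (\<exists>\<sigma>. diff_field_hom D' E D Finf \<sigma> \<and> (\<forall>x\<in>F. \<sigma> (\<phi> x) = x)))"
proof (intro conjI allI impI)
  fix E assume "diff_subfield D E \<and> F \<subseteq> E \<and> E \<subseteq> Finf \<and> fin_gen_over D F E"
  then show "\<exists>K. iterated_PV_extension D F K \<and> E \<subseteq> K"
    using finitely_generated_in_iterated_PV_extension[OF assms(2,4)] by blast
next
  fix D' :: "'b \<Rightarrow> 'b" and \<phi> K E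
  assume "differential_field D' \<and> diff_field_hom D F D' K \<phi> \<and>
    iterated_PV_extension D' (\<phi> ` F) K \<and> diff_subfield D' E \<and> \<phi> ` F \<subseteq> E \<and> E \<subseteq> K"
  then have D': "differential_field D'" and \<phi>: "diff_field_hom D F D' K \<phi>"
    and K: "iterated_PV_extension D' (\<phi> ` F) K" and EK: "E \<subseteq> K" by simp_all
  from iterated_PV_extension_embeds[OF assms(1) D' assms(2-4) \<phi> K]
  obtain \<sigma> where \<sigma>: "diff_field_hom D' K D Finf \<sigma>" "\<forall>x\<in>F. \<sigma> (\<phi> x) = x"
    by blast
  from \<sigma>(1) have "diff_field_hom D' E D Finf \<sigma>"
    using EK hom_on_subset[OF _ EK] unfolding diff_field_hom_iff by (meson image_mono subset_iff)
  with \<sigma>(2) show "\<exists>\<sigma>. diff_field_hom D' E D Finf \<sigma> \<and> (\<forall>x\<in>F. \<sigma> (\<phi> x) = x)" by blast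
qed

end
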